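(* Let $m\in\mathbb Z^+$ and $\mathcal D_{2m}=\{(z,w)\in\mathbb C^2:|z|^2+|w|^{2m}<1\}$. For each $\eta\in\mathcal D_{2m}$, the function $\zeta\mapsto S_{\mathcal D_{2m}}(\zeta,\eta)$, where $S_{\mathcal D_{2m}}$ is the Fefferman--Szegő kernel of $\mathcal D_{2m}$, extends holomorphically to a neighbourhood of $\overline{\mathcal D}_{2m}$.
   Context: Put $\rho(z,w)=|z|^2+|w|^{2m}-1$ and let $\sigma_{\mathrm E}$ be the Euclidean surface measure on $\partial\mathcal D_{2m}$. The Fefferman surface area measure is $d\sigma_{\mathrm F}=\varpi_{\mathrm F}\,d\sigma_{\mathrm E}$ with $$\varpi_{\mathrm F}=\frac1{|d\rho|}\left|\det\begin{pmatrix}\rho&\partial_{\bar j}\rho\\ \partial_i\rho&\partial_i\partial_{\bar j}\rho\end{pmatrix}_{1\le i,j\le 2}\right|^{\frac13},\qquad |d\rho|=\big(|\partial_z\rho|^2+|\partial_w\rho|^2\big)^{1/2},$$ i.e. $\varpi_{\mathrm F}(z,w)=\dfrac{(m^2|w|^{2m-2})^{1/3}}{\sqrt{|z|^2+m^2|w|^{4m-2}}}$ on $\partial\mathcal D_{2m}$. For $\xi\in\partial\mathcal D_{2m}$ let $\nu_\xi$ be the outward unit normal and let $\delta_\xi(z)$ be the minimum of the Euclidean distances from $z$ to $\partial\mathcal D_{2m}$ and to the tangent plane of $\partial\mathcal D_{2m}$ at $\xi$. For $\alpha>0$ let $\Gamma_\alpha(\xi)=\{z\in\mathcal D_{2m}:|(\xi-z)\cdot\overline{\nu_\xi}|<(1+\alpha)\delta_\xi(z),\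 |\xi-z|^2<\alpha\delta_\xi(z)\}$, where $\cdot$ is the complex bilinear dot product, and let $\mathcal N(f)(\xi)=\sup_{z\in\Gamma_\alpha(\xi)}|f(z)|$. The Fefferman--Hardy space $\mathrm H^2_{\mathrm F}(\partial\mathcal D_{2m})$ is the set of holomorphic $f$ on $\mathcal D_{2m}$ with $\mathcal N(f)\in L^2(\partial\mathcal D_{2m},\sigma_{\mathrm F})$. Each such $f$ has a non-tangential boundary value $f^*$ $\sigma_{\mathrm F}$-a.e., and with the norm $\big(\int|f^*|^2d\sigma_{\mathrm F}\big)^{1/2}$ the space is a reproducing kernel Hilbert space. Its reproducing kernel $S_{\mathcal D_{2m}}(\zeta,\eta)$, satisfying $f(\zeta)=\int_{\partial\mathcal D_{2m}}S_{\mathcal D_{2m}}(\zeta,\xi)f^*(\xi)\,d\sigma_{\mathrm F}(\xi)$, is the Fefferman--Szegő kernel. *)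

theory Defs
  imports "HOL-Analysis.Analysis"
begin

section \<open>Holomorphic functions of two complex variables\<close>

text \<open>The norm and the inner product that the library puts on \<^typ>\<open>complex \<times> complex\<close> are
  the Euclidean ones of \<open>\<real>\<^sup>4\<close>.\<close>

definition holomorphic2_on :: "(complex \<times> complex \<Rightarrow> complex) \<Rightarrow> (complex \<times> complex) set \<Rightarrow> bool"
    (infixl "holomorphic2'_on" 50) where
  "f holomorphic2_on U \<longleftrightarrow>
     open U \<and> (\<forall>p\<in>U. \<exists>a b. (f has_derivative (\<lambda>(h, k). a * h + b * k)) (at p))"

definition cscale :: "complex \<Rightarrow> complex \<times> complex \<Rightarrow> complex \<times> complex" where
  "cscale c v = (c * fst v, c * snd v)"

text \<open>Wirtinger derivatives \<open>(D\<^sub>v - \<i> D\<^bsub>\<i>v\<^esub>)/2\<close> and \<open>(D\<^sub>v + \<i> D\<^bsub>\<i>v\<^esub>)/2\<close> in a coordinate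
  direction \<open>v\<close>, where \<open>D\<^sub>v\<close> is the real directional derivative.\<close>

definition wirtinger ::
    "complex \<times> complex \<Rightarrow> (complex \<times> complex \<Rightarrow> complex) \<Rightarrow> complex \<times> complex \<Rightarrow> complex" where
  "wirtinger v u p =
     (frechet_derivative u (at p) v - \<i> * frechet_derivative u (at p) (cscale \<i> v)) / 2"

definition wirtinger_bar ::
    "complex \<times> complex \<Rightarrow> (complex \<times> complex \<Rightarrow> complex) \<Rightarrow> complex \<times> complex \<Rightarrow> complex" where
  "wirtinger_bar v u p =
     (frechet_derivative u (at p) v + \<i> * frechet_derivative u (at p) (cscale \<i> v)) / 2"

abbreviation "dir_z \<equiv> (1, 0) :: complex \<times> complex"
abbreviation "dir_w \<equiv> (0, 1) :: complex \<times> complex"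

definition cdot :: "complex \<times> complex \<Rightarrow> complex \<times> complex \<Rightarrow> complex" where
  "cdot u v = fst u * fst v + snd u * snd v"

definition cnj2 :: "complex \<times> complex \<Rightarrow> complex \<times> complex" where
  "cnj2 v = (cnj (fst v), cnj (snd v))"


section \<open>Surface measure\<close>

text \<open>Euclidean surface measure on a smooth hypersurface of \<open>\<real>\<^sup>4\<close> is taken to be the
  three-dimensional Hausdorff measure, with the factor (volume of the unit ball times
  (diameter / 2) to the power \<open>d\<close>) that makes \<open>d\<close>-dimensional Hausdorff measure agree with
  Lebesgue measure on \<open>\<real>\<^sup>d\<close> and with surface area on smooth \<open>d\<close>-dimensional submanifolds.
  The dimension \<open>d\<close> is meant to be positive: the empty set and singletons have diameter 0
  and contribute nothing to a cover. Being a metric outer measure, \<open>hausdorff_outer d\<close> is then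
  countably additive on the Borel sets, so \<^const>\<open>measure_of\<close> does return it.\<close>

definition hausdorff_pre :: "nat \<Rightarrow> real \<Rightarrow> 'a::metric_space set \<Rightarrow> ennreal" where
  "hausdorff_pre d \<delta> A =
     (INF C \<in> {C :: nat \<Rightarrow> 'a set. A \<subseteq> (\<Union>i. C i) \<and> (\<forall>i. bounded (C i) \<and> diameter (C i) \<le> \<delta>)}.
        \<Sum>i. ennreal (unit_ball_vol (real d) * (diameter (C i) / 2) ^ d))"

definition hausdorff_outer :: "nat \<Rightarrow> 'a::metric_space set \<Rightarrow> ennreal" where
  "hausdorff_outer d A = (SUP \<delta>\<in>{0<..}. hausdorff_pre d \<delta> A)"

definition hausdorff_measure :: "nat \<Rightarrow> 'a::metric_space measure" where
  "hausdorff_measure d = measure_of UNIV (sets borel) (hausdorff_outer d)"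


section \<open>The domain and the Fefferman surface measure\<close>

definition rho :: "nat \<Rightarrow> complex \<times> complex \<Rightarrow> real" where
  "rho m = (\<lambda>(z, w). cmod z ^ 2 + cmod w ^ (2 * m) - 1)"

definition egg :: "nat \<Rightarrow> (complex \<times> complex) set" where
  "egg m = {(z, w). cmod z ^ 2 + cmod w ^ (2 * m) < 1}"

definition fefferman_matrix :: "(complex \<times> complex \<Rightarrow> real) \<Rightarrow> complex \<times> complex \<Rightarrow> complex^3^3" where
  "fefferman_matrix r p = (let
      u = (\<lambda>q. complex_of_real (r q));
      d = wirtinger; db = wirtinger_bar; z = dir_z; w = dir_w
    in vector
     [vector [u p,     db z u p,       db w u p],
      vector [d z u p, d z (db z u) p, d z (db w u) p],
      vector [d w u p, d w (db z u) p, d w (db w u) p]])"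

text \<open>On the boundary this is the closed form proved in \<open>fefferman_weight_explicit\<close> below.\<close>

definition fefferman_weight :: "nat \<Rightarrow> complex \<times> complex \<Rightarrow> real" where
  "fefferman_weight m p =
     cmod (det (fefferman_matrix (rho m) p)) powr (1 / 3) /
     sqrt (cmod (wirtinger dir_z (\<lambda>q. complex_of_real (rho m q)) p) ^ 2 +
           cmod (wirtinger dir_w (\<lambda>q. complex_of_real (rho m q)) p) ^ 2)"

definition euclidean_surface :: "nat \<Rightarrow> (complex \<times> complex) measure" where
  "euclidean_surface m = restrict_space (hausdorff_measure 3) (frontier (egg m))"

definition fefferman_surface :: "nat \<Rightarrow> (complex \<times> complex) measure" where
  "fefferman_surface m = density (euclidean_surface m) (\<lambda>p. ennreal (fefferman_weight m p))"


section \<open>Approach regions and the Fefferman--Hardy space\<close>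

definition unit_normal :: "nat \<Rightarrow> complex \<times> complex \<Rightarrow> complex \<times> complex" where
  "unit_normal m \<xi> = sgn (THE g. GDERIV (rho m) \<xi> :> g)"

definition tangent_plane :: "nat \<Rightarrow> complex \<times> complex \<Rightarrow> (complex \<times> complex) set" where
  "tangent_plane m \<xi> = {p. inner (p - \<xi>) (unit_normal m \<xi>) = 0}"

definition approach_dist :: "nat \<Rightarrow> complex \<times> complex \<Rightarrow> complex \<times> complex \<Rightarrow> real" where
  "approach_dist m \<xi> p = min (infdist p (frontier (egg m))) (infdist p (tangent_plane m \<xi>))"

definition approach_region :: "nat \<Rightarrow> real \<Rightarrow> complex \<times> complex \<Rightarrow> (complex \<times> complex) set" where
  "approach_region m \<alpha> \<xi> =
     {p \<in> egg m.
        cmod (cdot (\<xi> - p) (cnj2 (unit_normal m \<xi>))) < (1 + \<alpha>) * approach_dist m \<xi> p \<and>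
        norm (\<xi> - p) ^ 2 < \<alpha> * approach_dist m \<xi> p}"

definition nt_maximal ::
    "nat \<Rightarrow> real \<Rightarrow> (complex \<times> complex \<Rightarrow> complex) \<Rightarrow> complex \<times> complex \<Rightarrow> ennreal" where
  "nt_maximal m \<alpha> f \<xi> = (SUP p\<in>approach_region m \<alpha> \<xi>. ennreal (cmod (f p)))"

text \<open>Members of the space are total functions of which only the values on \<^term>\<open>egg m\<close>
  matter.\<close>

definition fefferman_hardy :: "nat \<Rightarrow> real \<Rightarrow> (complex \<times> complex \<Rightarrow> complex) set" where
  "fefferman_hardy m \<alpha> =
     {f. f holomorphic2_on egg m \<and>
         nt_maximal m \<alpha> f \<in> borel_measurable (fefferman_surface m) \<and>
         (\<integral>\<^sup>+ \<xi>. nt_maximal m \<alpha> f \<xi> ^ 2 \<partial>fefferman_surface m) < \<infinity>}"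

text \<open>\<open>nt_boundary_value m \<alpha> f g\<close> says that \<open>g\<close> is the non-tangential boundary value \<open>f\<^sup>*\<close>.
  Each member of the Hardy space has one, and it is unique almost everywhere because \<open>\<xi>\<close> is a
  limit point of its approach region.\<close>

definition nt_boundary_value ::
    "nat \<Rightarrow> real \<Rightarrow> (complex \<times> complex \<Rightarrow> complex) \<Rightarrow> (complex \<times> complex \<Rightarrow> complex) \<Rightarrow> bool" where
  "nt_boundary_value m \<alpha> f g \<longleftrightarrow>
     g \<in> borel_measurable (fefferman_surface m) \<and>
     (AE \<xi> in fefferman_surface m. (f \<longlongrightarrow> g \<xi>) (at \<xi> within approach_region m \<alpha> \<xi>))"


section \<open>The Fefferman--Szego kernel\<close>

text \<open>\<open>k\<close> is the element of the Hardy space that represents evaluation at \<open>\<eta>\<close>, with respect to the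
  inner product of \<open>L\<^sup>2\<close> of the boundary values: \<open>f \<eta> = \<integral> f\<^sup>* cnj k\<^sup>*\<close>. The function
  \<open>\<xi> \<mapsto> cnj (k\<^sup>* \<xi>)\<close> is \<open>S(\<eta>, \<xi>)\<close> at the boundary points \<open>\<xi>\<close>.\<close>

definition represents_evaluation ::
    "nat \<Rightarrow> real \<Rightarrow> complex \<times> complex \<Rightarrow> (complex \<times> complex \<Rightarrow> complex) \<Rightarrow> bool" where
  "represents_evaluation m \<alpha> \<eta> k \<longleftrightarrow>
     k \<in> fefferman_hardy m \<alpha> \<and>
     (\<exists>kb. nt_boundary_value m \<alpha> k kb \<and>
        (\<forall>f\<in>fefferman_hardy m \<alpha>. \<forall>fb. nt_boundary_value m \<alpha> f fb \<longrightarrow>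
           f \<eta> = (\<integral>\<xi>. fb \<xi> * cnj (kb \<xi>) \<partial>fefferman_surface m)))"

text \<open>For \<open>\<eta>\<close> in the domain the representing function is unique on the domain; the choice only
  affects the irrelevant values at \<open>\<zeta>\<close> outside it.\<close>

definition fefferman_szego ::
    "nat \<Rightarrow> real \<Rightarrow> complex \<times> complex \<Rightarrow> complex \<times> complex \<Rightarrow> complex" where
  "fefferman_szego m \<alpha> \<zeta> \<eta> = (SOME k. represents_evaluation m \<alpha> \<eta> k) \<zeta>"


section \<open>The weight and the normal direction in explicit form\<close>

lemma wirtinger_eqI:
  assumes "(u has_derivative (\<lambda>(h,k). a*h + b*cnj h + c*k + d*cnj k)) (at p)"
  shows "wirtinger dir_z u p = a" "wirtinger_bar dir_z u p = b"
        "wirtinger dir_w u p = c" "wirtinger_bar dir_w u p = d"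
proof -
  have D: "frechet_derivative u (at p) = (\<lambda>(h,k). a*h + b*cnj h + c*k + d*cnj k)"
    by (rule frechet_derivative_at[OF assms, symmetric])
  have i: "\<i> * (x * \<i> + y * cnj \<i>) = y - x" for x y
    by (simp add: complex_eq_iff)
  show "wirtinger dir_z u p = a" "wirtinger_bar dir_z u p = b"
        "wirtinger dir_w u p = c" "wirtinger_bar dir_w u p = d"
    using i[of a b] i[of c d] by (simp_all add: wirtinger_def wirtinger_bar_def cscale_def D)
qed

lemma rho_complex: "complex_of_real (rho m q) = fst q * cnj (fst q) + (snd q * cnj (snd q))^m - 1"
proof (cases q)
  case (Pair z w)
  have "complex_of_real (cmod w ^ (2*m)) = complex_of_real (cmod w ^ 2) ^ m"
    by (simp add: power_mult)
  then have "complex_of_real (cmod w ^ (2*m)) = (w * cnj w)^m"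
    by (simp only: complex_norm_square)
  moreover have "complex_of_real (cmod z ^ 2) = z * cnj z"
    by (rule complex_norm_square)
  ultimately show ?thesis
    by (simp only: Pair rho_def prod.case fst_conv snd_conv of_real_diff of_real_add of_real_1)
qed

lemma has_derivative_rho: 
  "((\<lambda>q. complex_of_real (rho m q)) has_derivative (\<lambda>(h,k). 
     cnj z*h + z*cnj h + (of_nat m * (w * cnj w)^(m-1) * cnj w)*k + (of_nat m * (w * cnj w)^(m-1) * w)*cnj k)) (at (z,w))"
  unfolding rho_complex
  by (rule has_derivative_eq_rhs, (rule derivative_intros bounded_linear.has_derivative[OF bounded_linear_cnj])+)
     (auto simp: algebra_simps)

lemma wirtinger_rho: "wirtinger dir_z (\<lambda>q. complex_of_real (rho m q)) = (\<lambda>p. cnj (fst p))"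
 "wirtinger_bar dir_z (\<lambda>q. complex_of_real (rho m q)) = (\<lambda>p. fst p)"
 "wirtinger dir_w (\<lambda>q. complex_of_real (rho m q)) = (\<lambda>p. of_nat m * (snd p * cnj (snd p))^(m-1) * cnj (snd p))"
 "wirtinger_bar dir_w (\<lambda>q. complex_of_real (rho m q)) = (\<lambda>p. of_nat m * (snd p * cnj (snd p))^(m-1) * snd p)"
  using wirtinger_eqI[OF has_derivative_rho] by (auto simp: fun_eq_iff)

lemma wirtinger_fst: "wirtinger dir_z (\<lambda>p. fst p) = (\<lambda>p. 1)" "wirtinger dir_w (\<lambda>p. fst p) = (\<lambda>p. 0)"
proof -
  have "(fst has_derivative (\<lambda>(h,k). 1*h + 0*cnj h + 0*k + 0*cnj k)) (at p)" for p :: "complex \<times> complex"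
    by (rule has_derivative_eq_rhs, (rule derivative_intros)+) auto
  from wirtinger_eqI[OF this] show "wirtinger dir_z (\<lambda>p. fst p) = (\<lambda>p. 1)" "wirtinger dir_w (\<lambda>p. fst p) = (\<lambda>p. 0)" by auto
qed

lemma wirtinger_snd_part: 
  assumes "m \<ge> 1"
  shows "wirtinger dir_w (\<lambda>p. of_nat m * (snd p * cnj (snd p))^(m-1) * snd p) = (\<lambda>p. of_nat m ^ 2 * (snd p * cnj (snd p))^(m-1))"
   "wirtinger dir_z (\<lambda>p. of_nat m * (snd p * cnj (snd p))^(m-1) * snd p) = (\<lambda>p. 0)"
proof -
  have "((\<lambda>p. of_nat m * (snd p * cnj (snd p))^(m-1) * snd p) has_derivative (\<lambda>(h,k). 0*h + 0*cnj h + (of_nat m ^ 2 * (w * cnj w)^(m-1))*k + (of_nat m * of_nat (m-1) * (w * cnj w)^(m-2)*w^2)*cnj k)) (at (z,w))" for z w :: complex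
  proof (rule has_derivative_eq_rhs, (rule derivative_intros bounded_linear.has_derivative[OF bounded_linear_cnj])+, goal_cases)
    case 1
    obtain j where j: "m = Suc j" using assms by (cases m) auto
    show ?case
      by (cases j) (auto simp: j fun_eq_iff algebra_simps power2_eq_square)
  qed
  from wirtinger_eqI[OF this] show "wirtinger dir_w (\<lambda>p. of_nat m * (snd p * cnj (snd p))^(m-1) * snd p) = (\<lambda>p. of_nat m ^ 2 * (snd p * cnj (snd p))^(m-1))"
   "wirtinger dir_z (\<lambda>p. of_nat m * (snd p * cnj (snd p))^(m-1) * snd p) = (\<lambda>p. 0)" by (auto simp: fun_eq_iff)
qed

lemma fefferman_weight_explicit:
  assumes m: "m \<ge> 1" and p: "rho m (z, w) = 0"
  shows "fefferman_weight m (z, w) =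
    (real m ^ 2 * cmod w ^ (2*m-2)) powr (1/3) / sqrt (cmod z ^ 2 + real m ^ 2 * cmod w ^ (4*m-2))"
proof -
  obtain j where j: "m = Suc j" using m by (cases m) auto
  have e: "z * cnj z = 1 - (w * cnj w)^m" using p rho_complex[of m "(z,w)"] by (simp add: algebra_simps)
  have det: "det (fefferman_matrix (rho m) (z,w)) = - of_real (real m ^ 2 * cmod w ^ (2*m-2))"
  proof -
    have "det (fefferman_matrix (rho m) (z,w)) = - (of_nat m ^2 * (w * cnj w)^(m-1) * (z * cnj z) + of_nat m ^2 * (w * cnj w)^(m-1) * (w * cnj w)^m)"
      unfolding fefferman_matrix_def Let_def wirtinger_rho wirtinger_fst wirtinger_snd_part[OF m] det_3 p
      by (simp add: algebra_simps j power2_eq_square flip: power_add)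
    also have "\<dots> = - (of_nat m ^2 * (w * cnj w)^(m-1))" unfolding e by (simp add: algebra_simps)
    also have "\<dots> = - of_real (real m ^ 2 * cmod w ^ (2*m-2))"
      by (simp add: j power_mult flip: complex_norm_square)
    finally show ?thesis .
  qed
  have "cmod (of_nat m * (w * cnj w)^(m-1) * cnj w)^2 = (real m * cmod w ^ (2*j+1))^2"
    unfolding j norm_mult norm_power complex_mod_cnj norm_of_nat
    by (simp add: power_mult power2_eq_square)
  also have "\<dots> = real m ^2 * cmod w ^ (4*m-2)"
  proof -
    have "4*m-2 = (2*j+1)*2" using j by simp
    then show ?thesis by (simp only: power_mult_distrib power_mult)
  qed
  finally have "cmod (of_nat m * (w * cnj w)^(m-1) * cnj w)^2 = real m ^2 * cmod w ^ (4*m-2)" .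
  then show ?thesis
    unfolding fefferman_weight_def det wirtinger_rho by (simp add: norm_mult norm_power)
qed

lemma gradient_rho_explicit:
  "(THE g. GDERIV (rho m) (z,w) :> g) = 2 *\<^sub>R (z, of_nat m * (w * cnj w)^(m-1) * w)"
proof (rule the_equality)
  have *: "(rho m has_derivative (\<lambda>h. Re (case h of (h,k) \<Rightarrow> 
     cnj z*h + z*cnj h + (of_nat m * (w * cnj w)^(m-1) * cnj w)*k + (of_nat m * (w * cnj w)^(m-1) * w)*cnj k))) (at (z,w))"
    using bounded_linear.has_derivative[OF bounded_linear_Re has_derivative_rho[of m z w]] by simp
  have r: "of_nat m * (w * cnj w)^(m-1) = complex_of_real (real m * cmod w ^(2*(m-1)))"
     by (simp add: power_mult flip: complex_norm_square)
  show g: "GDERIV (rho m) (z,w) :> 2 *\<^sub>R (z, of_nat m * (w * cnj w)^(m-1) * w)"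
    unfolding gderiv_def
    apply (rule has_derivative_eq_rhs[OF *])
    unfolding r by (auto simp: fun_eq_iff inner_complex_def algebra_simps)
  fix g assume "GDERIV (rho m) (z,w) :> g"
  with g have "(\<lambda>h. inner h g) = (\<lambda>h. inner h (2 *\<^sub>R (z, of_nat m * (w * cnj w)^(m-1) * w)))"
    unfolding gderiv_def using has_derivative_unique by blast
  then show "g = 2 *\<^sub>R (z, of_nat m * (w * cnj w)^(m-1) * w)"
    by (meson vector_eq_ldot)
qed

end

theory Submission
  imports Defs "HOL-Complex_Analysis.Complex_Analysis"
begin

text \<open>The torus acts on the egg by isometries that preserve the Fefferman weight, so the monomials
  are orthogonal for the boundary measure. Radial segments stay in the approach regions, hence the
  dilates \<open>f(t\<xi>)\<close> of a member \<open>f\<close> of the Hardy space are dominated by its maximal function, and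
  letting \<open>t \<rightarrow> 1\<close> identifies the pairing of \<open>f\<^sup>*\<close> with a monomial as the Taylor coefficient times
  the squared norm of the monomial. Thus the kernel is the series \<open>\<Sum> \<zeta>\<^sup>a cnj \<eta>\<^sup>a / N\<^sub>a\<close> over
  multi-indices \<open>a\<close>, with \<open>N\<^sub>a\<close> the squared norms. Estimating \<open>N\<^sub>a\<close> from below by the part of
  the boundary near a given point shows that \<open>\<Sum> x\<^sup>i y\<^sup>j / N\<^bsub>(i,j)\<^esub>\<close> converges when \<open>\<bar>x\<bar> + \<bar>y\<bar>\<^sup>m < 1\<close>, so the kernel
  is holomorphic on \<open>{\<zeta>. \<bar>\<eta>\<^sub>1 \<zeta>\<^sub>1\<bar> + \<bar>\<eta>\<^sub>2 \<zeta>\<^sub>2\<bar>\<^sup>m < 1}\<close>. By the arithmetic-geometric mean inequality this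
  open set contains the closed egg.\<close>

section \<open>Hausdorff measure\<close>

text \<open>The measure is given only through \<open>measure_of\<close>, which returns the zero
  measure when the set function is not countably additive, so Caratheodory's criterion for Hausdorff
  measure must come first. The facts then extracted are qualitative: invariance under isometries,
  finiteness on the boundary, and positivity on certain pieces of it. Crude constants are therefore
  good enough in every comparison with Lebesgue measure. For m > 1 the weight vanishes on the circle
  w = 0, so positivity is claimed on pieces of the boundary that avoid this circle. Existence of the
  kernel comes from an explicit candidate: it is bounded on the closed egg, hence a member of the
  Hardy space, and it reproduces each member through its Taylor series. The shape of the domain of
  convergence has its origin in the variables x = |z|^2, y = |w|^2, in which the boundary is the
  curve x + y^m = 1. If X + Y^m < 1, the piece x >= X, y > Y has positive measure, and there the
  squared monomial of index (i, j) is at least X^i Y^j.\<close>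

definition hausdorff_cost :: "nat \<Rightarrow> 'a::metric_space set \<Rightarrow> ennreal" where
  "hausdorff_cost d C = ennreal (unit_ball_vol (real d) * (diameter C / 2) ^ d)"

definition small_covers :: "real \<Rightarrow> 'a::metric_space set \<Rightarrow> (nat \<Rightarrow> 'a set) set" where
  "small_covers \<delta> A = {C. A \<subseteq> (\<Union>i. C i) \<and> (\<forall>i. bounded (C i) \<and> diameter (C i) \<le> \<delta>)}"

section \<open>Hausdorff outer measure: subadditivity, and additivity on separated sets\<close>

lemma hausdorff_pre_alt: "hausdorff_pre d \<delta> A = (INF C\<in>small_covers \<delta> A. \<Sum>i. hausdorff_cost d (C i))"
  by (simp add: hausdorff_pre_def small_covers_def hausdorff_cost_def)

text \<open>In dimension 0 the empty set would cost 1, because 0^0 = 1. With \<open>d > 0\<close>,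
  covers may be padded with empty sets free of charge.\<close>

lemma hausdorff_cost_empty [simp]: "d > 0 \<Longrightarrow> hausdorff_cost d {} = 0"
  by (simp add: hausdorff_cost_def power_0_left)

lemma hausdorff_pre_le:
  "A \<subseteq> (\<Union>i. C i) \<Longrightarrow> (\<And>i. bounded (C i)) \<Longrightarrow> (\<And>i. diameter (C i) \<le> \<delta>) \<Longrightarrow>
   hausdorff_pre d \<delta> A \<le> (\<Sum>i. hausdorff_cost d (C i))"
  unfolding hausdorff_pre_alt by (rule INF_lower) (auto simp: small_covers_def)

lemma hausdorff_pre_mono: "A \<subseteq> B \<Longrightarrow> hausdorff_pre d \<delta> A \<le> hausdorff_pre d \<delta> B"
  unfolding hausdorff_pre_alt by (rule INF_superset_mono) (auto simp: small_covers_def)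

lemma hausdorff_pre_antimono: "\<delta> \<le> \<epsilon> \<Longrightarrow> hausdorff_pre d \<epsilon> A \<le> hausdorff_pre d \<delta> A"
  unfolding hausdorff_pre_alt by (rule INF_superset_mono) (auto simp: small_covers_def intro: order_trans)

lemma hausdorff_pre_empty:
  assumes "d > 0" "\<delta> > 0"
  shows "hausdorff_pre d \<delta> {} = 0"
  using hausdorff_pre_le[of "{}" "\<lambda>_. {}" \<delta> d] assms by simp

text \<open>Near-optimal covers of the \<open>A n\<close>, with slack e / 2^(n+1), are merged into
  one sequence through \<open>prod_decode\<close>; the slacks add up to e.\<close>

lemma hausdorff_pre_subadditive:
  "hausdorff_pre d \<delta> (\<Union>i. A i) \<le> (\<Sum>n. hausdorff_pre d \<delta> (A n))"
proof (rule ennreal_le_epsilon)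
  let ?O = "hausdorff_pre d \<delta>"
  fix e :: real assume "0 < e" and fin: "(\<Sum>n. ?O (A n)) < top"
  have "\<exists>C\<in>small_covers \<delta> (A n). (\<Sum>i. hausdorff_cost d (C i)) < ?O (A n) + e * (1/2)^Suc n" for n
  proof (rule INF_approx_ennreal)
    show "0 < e * (1/2)^Suc n" using \<open>0 < e\<close> by simp
    show "?O (A n) \<noteq> \<infinity>" using fin by (auto dest!: ennreal_suminf_lessD[of _ _ n])
  qed (rule hausdorff_pre_alt)
  then obtain B where B: "\<And>n. B n \<in> small_covers \<delta> (A n)"
    and Ble: "\<And>n. (\<Sum>i. hausdorff_cost d (B n i)) \<le> ?O (A n) + e * (1/2)^Suc n"
    by (metis less_imp_le)
  define C where "C = case_prod B o prod_decode"
  have "?O (\<Union>i. A i) \<le> (\<Sum>i. hausdorff_cost d (C i))"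
  proof (rule hausdorff_pre_le)
    show "(\<Union>i. A i) \<subseteq> (\<Union>i. C i)"
      using B by (auto simp: C_def subset_eq small_covers_def) (metis prod.case prod_encode_inverse)
  qed (use B in \<open>auto simp: C_def small_covers_def split: prod.split\<close>)
  also have "\<dots> = (\<Sum>n. \<Sum>i. hausdorff_cost d (B n i))"
    unfolding C_def comp_def by (intro suminf_ennreal_2dimen) auto
  also have "\<dots> \<le> (\<Sum>n. ?O (A n) + e * (1/2) ^ Suc n)"
    by (intro suminf_le allI Ble) auto
  also have "\<dots> = (\<Sum>n. ?O (A n)) + (\<Sum>n. ennreal e * ennreal ((1/2) ^ Suc n))"
    using \<open>0 < e\<close> by (subst suminf_add[symmetric])
                     (auto simp del: ennreal_suminf_cmult simp add: ennreal_mult[symmetric])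
  also have "\<dots> = (\<Sum>n. ?O (A n)) + e"
    unfolding ennreal_suminf_cmult
    by (subst suminf_ennreal_eq[OF zero_le_power power_half_series]) auto
  finally show "?O (\<Union>i. A i) \<le> (\<Sum>n. ?O (A n)) + e" .
qed

text \<open>A set of diameter at most \<delta> < e cannot meet both \<open>A\<close> and
  \<open>B\<close>. A cover of the union therefore splits into a cover of \<open>A\<close> and one
  of \<open>B\<close>, with no member paid for twice.\<close>

lemma hausdorff_pre_separated:
  assumes d: "d > 0" and \<delta>: "0 < \<delta>" "\<delta> < e" and sep: "\<And>a b. a \<in> A \<Longrightarrow> b \<in> B \<Longrightarrow> e \<le> dist a b"
  shows "hausdorff_pre d \<delta> A + hausdorff_pre d \<delta> B \<le> hausdorff_pre d \<delta> (A \<union> B)"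
  unfolding hausdorff_pre_alt[of d \<delta> "A \<union> B"]
proof (rule INF_greatest)
  fix C assume "C \<in> small_covers \<delta> (A \<union> B)"
  then have C: "A \<union> B \<subseteq> (\<Union>i. C i)" "\<And>i. bounded (C i)" "\<And>i. diameter (C i) \<le> \<delta>"
    by (auto simp: small_covers_def)
  define CA where "CA i = (if C i \<inter> A \<noteq> {} then C i else {})" for i
  define CB where "CB i = (if C i \<inter> B \<noteq> {} then C i else {})" for i
  have disj: "C i \<inter> A = {} \<or> C i \<inter> B = {}" for i
  proof (rule ccontr)
    assume "\<not> ?thesis"
    then obtain a b where "a \<in> C i" "a \<in> A" "b \<in> C i" "b \<in> B" by auto
    then show False
      using sep[of a b] diameter_bounded_bound[OF C(2)[of i], of a b] C(3)[of i] \<delta> by auto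
  qed
  have "A \<subseteq> (\<Union>i. CA i)" "B \<subseteq> (\<Union>i. CB i)"
    using C(1) unfolding CA_def CB_def by fastforce+
  then have "hausdorff_pre d \<delta> A \<le> (\<Sum>i. hausdorff_cost d (CA i))"
    "hausdorff_pre d \<delta> B \<le> (\<Sum>i. hausdorff_cost d (CB i))"
    by (intro hausdorff_pre_le; use C \<delta> in \<open>simp add: CA_def CB_def\<close>)+
  then have "hausdorff_pre d \<delta> A + hausdorff_pre d \<delta> B
      \<le> (\<Sum>i. hausdorff_cost d (CA i) + hausdorff_cost d (CB i))"
    by (subst suminf_add[symmetric]) (auto intro: add_mono)
  also have "\<dots> \<le> (\<Sum>i. hausdorff_cost d (C i))"
    by (rule suminf_le) (use disj d in \<open>auto simp: CA_def CB_def\<close>)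
  finally show "hausdorff_pre d \<delta> A + hausdorff_pre d \<delta> B \<le> (\<Sum>i. hausdorff_cost d (C i))" .
qed

lemma hausdorff_outer_mono: "A \<subseteq> B \<Longrightarrow> hausdorff_outer d A \<le> hausdorff_outer d B"
  unfolding hausdorff_outer_def by (rule SUP_mono') (rule hausdorff_pre_mono)

lemma hausdorff_outer_empty: "d > 0 \<Longrightarrow> hausdorff_outer d {} = 0"
  unfolding hausdorff_outer_def by (auto simp: hausdorff_pre_empty intro!: SUP_eq_const)

lemma hausdorff_outer_subadditive:
  "hausdorff_outer d (\<Union>i. A i) \<le> (\<Sum>n. hausdorff_outer d (A n))"
  unfolding hausdorff_outer_def
proof (rule SUP_least)
  fix \<delta> :: real assume "\<delta> \<in> {0<..}"
  then have "(\<Sum>n. hausdorff_pre d \<delta> (A n)) \<le> (\<Sum>n. SUP \<delta>\<in>{0<..}. hausdorff_pre d \<delta> (A n))"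
    by (intro suminf_le) (auto intro: SUP_upper)
  with hausdorff_pre_subadditive show "hausdorff_pre d \<delta> (\<Union>i. A i) \<le> (\<Sum>n. SUP \<delta>\<in>{0<..}. hausdorff_pre d \<delta> (A n))"
    by (rule order_trans)
qed

lemma outer_measure_space_hausdorff: "d > 0 \<Longrightarrow> outer_measure_space (Pow UNIV) (hausdorff_outer d)"
  by (simp add: outer_measure_space_def positive_def increasing_def countably_subadditive_def
      hausdorff_outer_empty hausdorff_outer_mono hausdorff_outer_subadditive)

text \<open>\<open>subadditive\<close> speaks of disjoint sets, hence the detour through
  \<open>B - A\<close> and monotonicity.\<close>

lemma hausdorff_outer_Un:
  assumes "d > 0"
  shows "hausdorff_outer d (A \<union> B) \<le> hausdorff_outer d A + hausdorff_outer d B"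
proof -
  interpret P: sigma_algebra "UNIV :: 'a set" "Pow UNIV" by (rule sigma_algebra_Pow)
  have "subadditive (Pow UNIV) (hausdorff_outer d :: 'a set \<Rightarrow> _)"
    using outer_measure_space_hausdorff[OF assms, where 'a='a] unfolding outer_measure_space_def
    by (intro P.countably_subadditive_subadditive) blast+
  then have "A \<inter> (B - A) = {} \<Longrightarrow> hausdorff_outer d (A \<union> (B - A)) \<le> hausdorff_outer d A + hausdorff_outer d (B - A)"
    by (auto simp: subadditive_def simp del: Un_Diff_cancel)
  then have "hausdorff_outer d (A \<union> B) \<le> hausdorff_outer d A + hausdorff_outer d (B - A)"
    by auto
  also have "\<dots> \<le> hausdorff_outer d A + hausdorff_outer d B"
    by (intro add_left_mono hausdorff_outer_mono) auto
  finally show ?thesis .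
qed

text \<open>The two suprema over \<delta> can be added because \<open>hausdorff_pre\<close> grows as
  \<delta> shrinks; for the same reason \<delta> may be taken below the separation e.\<close>

lemma hausdorff_outer_separated:
  assumes d: "d > 0" and e: "e > 0" and sep: "\<And>a b. a \<in> A \<Longrightarrow> b \<in> B \<Longrightarrow> e \<le> dist a b"
  shows "hausdorff_outer d A + hausdorff_outer d B \<le> hausdorff_outer d (A \<union> B)"
proof -
  have "hausdorff_outer d A + hausdorff_outer d B = (SUP \<delta>\<in>{0<..}. hausdorff_pre d \<delta> A + hausdorff_pre d \<delta> B)"
    unfolding hausdorff_outer_def
  proof (rule SUP_add_directed_ennreal[symmetric])
    fix i j :: real assume "i \<in> {0<..}" "j \<in> {0<..}"
    then show "\<exists>k\<in>{0<..}. hausdorff_pre d i A + hausdorff_pre d j B \<le> hausdorff_pre d k A + hausdorff_pre d k B"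
      by (intro bexI[of _ "min i j"] add_mono hausdorff_pre_antimono) auto
  qed
  also have "\<dots> \<le> hausdorff_outer d (A \<union> B)"
  proof (rule SUP_least)
    fix \<delta> :: real assume \<delta>: "\<delta> \<in> {0<..}"
    define \<epsilon> where "\<epsilon> = min \<delta> (e / 2)"
    have \<epsilon>: "0 < \<epsilon>" "\<epsilon> < e" "\<epsilon> \<le> \<delta>" using e \<delta> by (auto simp: \<epsilon>_def)
    have "hausdorff_pre d \<delta> A + hausdorff_pre d \<delta> B \<le> hausdorff_pre d \<epsilon> A + hausdorff_pre d \<epsilon> B"
      by (intro add_mono hausdorff_pre_antimono \<epsilon>)
    also have "\<dots> \<le> hausdorff_pre d \<epsilon> (A \<union> B)"
      by (rule hausdorff_pre_separated[OF d \<epsilon>(1,2) sep])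
    also have "\<dots> \<le> hausdorff_outer d (A \<union> B)"
      unfolding hausdorff_outer_def using \<epsilon> by (intro SUP_upper) auto
    finally show "hausdorff_pre d \<delta> A + hausdorff_pre d \<delta> B \<le> hausdorff_outer d (A \<union> B)" .
  qed
  finally show ?thesis .
qed

section \<open>Caratheodory's criterion and the Hausdorff measure on Borel sets\<close>

lemma tendsto_ennreal_suminf_tail:
  fixes f :: "nat \<Rightarrow> ennreal"
  assumes "suminf f < top"
  shows "(\<lambda>n. \<Sum>k. f (k + n)) \<longlonglongrightarrow> 0"
proof -
  have "(\<Sum>k. f (k + n)) = suminf f - sum f {..<n}" for n
  proof -
    have "suminf f = (\<Sum>k. f (k + n)) + sum f {..<n}" by (rule suminf_offset) simp
    moreover have "sum f {..<n} \<noteq> top" using assms calculation by (auto simp: less_top)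
    ultimately show ?thesis by (metis ennreal_add_diff_cancel_right)
  qed
  moreover have "(\<lambda>n. suminf f - sum f {..<n}) \<longlonglongrightarrow> suminf f - suminf f"
    using assms by (intro tendsto_diff_ennreal tendsto_const summable_LIMSEQ) auto
  ultimately show ?thesis using assms by (simp add: less_top)
qed

text \<open>Caratheodory's criterion, with the layers \<open>R k\<close> of \<open>X\<close> around \<open>F\<close>: layers of equal
  parity are pairwise separated, so their outer measures have a finite sum.\<close>

lemma hausdorff_outer_closed:
  fixes F X :: "'a::metric_space set"
  assumes d: "d > 0" and F: "closed F"
  shows "hausdorff_outer d (X \<inter> F) + hausdorff_outer d (X - F) \<le> hausdorff_outer d X"
proof (cases "F = {} \<or> hausdorff_outer d X = top")
  case True
  then show ?thesis using d by (auto simp: hausdorff_outer_empty)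
next
  case False
  then have ne: "F \<noteq> {}" and fin: "hausdorff_outer d X < top" by (auto simp: less_top)
  let ?H = "hausdorff_outer d :: 'a set \<Rightarrow> ennreal"
  define R where "R k = {x\<in>X. 1 / real (k + 2) \<le> infdist x F \<and> infdist x F < 1 / real (k + 1)}" for k
  define Y where "Y n = {x\<in>X. 1 / real (n + 1) \<le> infdist x F}" for n
  have far: "infdist x F \<le> infdist y F + dist x y" for x y by (rule infdist_triangle)
  have 1: "?H (X \<inter> F) + ?H (Y n) \<le> ?H X" for n
  proof -
    have "?H (X \<inter> F) + ?H (Y n) \<le> ?H ((X \<inter> F) \<union> Y n)"
    proof (rule hausdorff_outer_separated[OF d])
      show "0 < 1 / real (n + 1)" by simp
      fix a b assume "a \<in> X \<inter> F" "b \<in> Y n"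
      then show "1 / real (n + 1) \<le> dist a b"
        using far[of b a] by (auto simp: Y_def dist_commute)
    qed
    also have "\<dots> \<le> ?H X" by (rule hausdorff_outer_mono) (auto simp: Y_def)
    finally show ?thesis .
  qed
  have part: "(\<Sum>k<n. ?H (R (2 * k + p))) \<le> ?H (\<Union>k<n. R (2 * k + p))" for n p
  proof (induction n)
    case 0
    then show ?case using d by (simp add: hausdorff_outer_empty)
  next
    case (Suc n)
    let ?q = "2 * n + p"
    have "(\<Sum>k<Suc n. ?H (R (2 * k + p))) \<le> ?H (\<Union>k<n. R (2 * k + p)) + ?H (R ?q)"
      using Suc by (simp add: add_right_mono)
    also have "\<dots> \<le> ?H ((\<Union>k<n. R (2 * k + p)) \<union> R ?q)"
    proof (rule hausdorff_outer_separated[OF d])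
      \<comment> \<open>Points of earlier layers of this parity are at distance at least 1/?q from
        \<open>F\<close>, those of layer ?q at distance less than 1/(?q+1). For ?q = 0 there is no
        earlier layer, and 1 merely replaces a division by zero.\<close>
      let ?e = "if ?q = 0 then 1 else 1 / real ?q - 1 / real (?q + 1)"
      show "0 < ?e" by (auto simp: field_simps)
      fix a b assume "a \<in> (\<Union>k<n. R (2 * k + p))" and b: "b \<in> R ?q"
      then obtain k where k: "k < n" "a \<in> R (2 * k + p)" by auto
      then have "1 / real ?q \<le> 1 / real (2 * k + p + 2)"
        by (intro divide_left_mono) auto
      with k have "1 / real ?q \<le> infdist a F" by (auto simp: R_def)
      moreover have "infdist b F < 1 / real (?q + 1)" using b by (auto simp: R_def)
      ultimately show "?e \<le> dist a b" using far[of a b] k by auto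
    qed
    also have "(\<Union>k<n. R (2 * k + p)) \<union> R ?q = (\<Union>k<Suc n. R (2 * k + p))"
      by (auto simp: less_Suc_eq)
    finally show ?case .
  qed
  have part': "(\<Sum>k<n. ?H (R (2 * k + p))) \<le> ?H X" for n p
    using part by (rule order_trans) (rule hausdorff_outer_mono, auto simp: R_def)
  have "(\<Sum>k<n. ?H (R k)) \<le> 2 * ?H X" for n
  proof -
    have "(\<Sum>k<n. ?H (R k)) \<le> (\<Sum>k<2 * n. ?H (R k))" by (intro sum_mono2) auto
    also have "\<dots> = (\<Sum>k<n. ?H (R (2 * k + 0))) + (\<Sum>k<n. ?H (R (2 * k + 1)))"
      by (induction n) (auto simp: algebra_simps)
    also have "\<dots> \<le> ?H X + ?H X" by (intro add_mono part')
    finally show ?thesis by (simp add: mult_2)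
  qed
  then have "(\<Sum>k. ?H (R k)) \<le> 2 * ?H X" by (intro suminf_le_const) auto
  then have tail: "(\<lambda>n. \<Sum>k. ?H (R (k + n))) \<longlonglongrightarrow> 0"
    using fin by (intro tendsto_ennreal_suminf_tail) (auto simp: ennreal_mult_less_top intro: le_less_trans)
  have 2: "?H (X - F) \<le> ?H (Y n) + (\<Sum>k. ?H (R (k + n)))" for n
  proof -
    have "X - F \<subseteq> Y n \<union> (\<Union>k. R (k + n))"
    proof
      fix x assume x: "x \<in> X - F"
      then have pos: "infdist x F > 0"
        using F ne infdist_pos_not_in_closed by auto
      show "x \<in> Y n \<union> (\<Union>k. R (k + n))"
      proof (cases "x \<in> Y n")
        case False
        define j where "j = (LEAST j. 1 / real (j + 2) \<le> infdist x F)"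
        have "\<exists>j. 1 / real (j + 2) \<le> infdist x F"
        proof -
          obtain j where "inverse (real (Suc j)) < infdist x F" using reals_Archimedean[OF pos] by auto
          moreover have "1 / real (j + 2) \<le> inverse (real (Suc j))" by (simp add: field_simps)
          ultimately show ?thesis by (intro exI[of _ j]) linarith
        qed
        then have j1: "1 / real (j + 2) \<le> infdist x F" unfolding j_def by (rule LeastI_ex)
        have n: "infdist x F < 1 / real (n + 1)" using False x by (auto simp: Y_def)
        have "j \<ge> n"
        proof (rule ccontr)
          assume "\<not> j \<ge> n"
          then have "1 / real (n + 1) \<le> 1 / real (j + 2)" by (intro divide_left_mono) auto
          with j1 n show False by linarith
        qed
        moreover have "infdist x F < 1 / real (j + 1)"
        proof (cases j)
          case 0
          then show ?thesis using n \<open>j \<ge> n\<close> by simp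
        next
          case (Suc i)
          then have "\<not> 1 / real (i + 2) \<le> infdist x F" unfolding j_def by (intro not_less_Least) auto
          then show ?thesis using Suc by simp
        qed
        ultimately have "x \<in> R ((j - n) + n)" using x j1 by (auto simp: R_def)
        then show ?thesis by blast
      qed auto
    qed
    then have "?H (X - F) \<le> ?H (Y n \<union> (\<Union>k. R (k + n)))" by (rule hausdorff_outer_mono)
    also have "\<dots> \<le> ?H (Y n) + ?H (\<Union>k. R (k + n))" by (rule hausdorff_outer_Un[OF d])
    also have "\<dots> \<le> ?H (Y n) + (\<Sum>k. ?H (R (k + n)))"
      by (intro add_left_mono hausdorff_outer_subadditive)
    finally show ?thesis .
  qed
  have "?H (X \<inter> F) + ?H (X - F) \<le> ?H X + (\<Sum>k. ?H (R (k + n)))" for n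
  proof -
    have "?H (X \<inter> F) + ?H (X - F) \<le> ?H (X \<inter> F) + (?H (Y n) + (\<Sum>k. ?H (R (k + n))))"
      by (intro add_left_mono 2)
    also have "\<dots> \<le> ?H X + (\<Sum>k. ?H (R (k + n)))"
      unfolding add.assoc[symmetric] by (intro add_right_mono 1)
    finally show ?thesis .
  qed
  moreover have "(\<lambda>n. ?H X + (\<Sum>k. ?H (R (k + n)))) \<longlonglongrightarrow> ?H X + 0"
    by (intro tendsto_add tendsto_const tail)
  ultimately show ?thesis by (intro tendsto_lowerbound[of _ "?H X"]) (auto intro: always_eventually)
qed

text \<open>The sets satisfying Caratheodory's condition form a sigma-algebra on which the outer
  measure is countably additive. It contains the closed sets, hence the Borel sets. This is the
  condition under which \<open>measure_of\<close> keeps the given values.\<close>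

lemma measure_space_hausdorff:
  assumes "d > 0"
  shows "measure_space (UNIV :: 'a::metric_space set) (sets borel) (hausdorff_outer d)"
proof -
  let ?H = "hausdorff_outer d :: 'a set \<Rightarrow> ennreal"
  interpret P: sigma_algebra "UNIV :: 'a set" "Pow UNIV" by (rule sigma_algebra_Pow)
  let ?L = "lambda_system UNIV (Pow UNIV) ?H"
  have L: "measure_space UNIV ?L ?H"
    by (rule P.caratheodory_lemma[OF outer_measure_space_hausdorff[OF assms]])
  have "F \<in> ?L" if "closed F" for F :: "'a set"
  proof -
    have "?H (X \<inter> F) + ?H (X - F) = ?H X" for X
    proof (rule antisym)
      show "?H X \<le> ?H (X \<inter> F) + ?H (X - F)"
        using hausdorff_outer_Un[OF assms, of "X \<inter> F" "X - F"] by (simp add: Int_Diff_Un)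
    qed (rule hausdorff_outer_closed[OF assms that])
    then show ?thesis unfolding P.lambda_system_eq by simp
  qed
  then have "sigma_sets UNIV (Collect closed) \<subseteq> ?L"
    using L unfolding measure_space_def by (intro sigma_algebra.sigma_sets_subset) blast+
  then have sub: "sets borel \<subseteq> ?L"
    unfolding borel_eq_closed by (subst sets_measure_of) auto
  have "sigma_algebra UNIV (sets (borel :: 'a measure))"
    using sets.sigma_algebra_axioms[of "borel :: 'a measure"] by simp
  moreover have "positive (sets borel) ?H" using assms by (simp add: positive_def hausdorff_outer_empty)
  moreover have "countably_additive (sets borel) ?H"
  proof (rule countably_additiveI)
    fix A :: "nat \<Rightarrow> 'a set" assume A: "range A \<subseteq> sets borel" "disjoint_family A" "(\<Union>i. A i) \<in> sets borel"
    have "countably_additive ?L ?H" using L by (simp add: measure_space_def)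
    then show "(\<Sum>i. ?H (A i)) = ?H (\<Union>i. A i)"
      using A(2) subset_trans[OF A(1) sub] subsetD[OF sub A(3)]
      unfolding countably_additive_def by blast
  qed
  ultimately show ?thesis by (simp add: measure_space_def)
qed

lemma space_hausdorff [simp]: "space (hausdorff_measure d) = UNIV"
  and sets_hausdorff [simp, measurable_cong]: "sets (hausdorff_measure d) = sets borel"
  using sets.sigma_sets_eq[of borel] 
  by (auto simp: hausdorff_measure_def space_measure_of_conv sets_measure_of_conv)

lemma emeasure_hausdorff:
  assumes "d > 0" "A \<in> sets borel"
  shows "emeasure (hausdorff_measure d) A = hausdorff_outer d A"
  unfolding hausdorff_measure_def
  using measure_space_hausdorff[OF assms(1), where 'a='a] assms(2) sets.sigma_sets_eq[of "borel :: 'a measure"]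
  by (intro emeasure_measure_of_sigma) (auto simp: measure_space_def)

section \<open>Invariance under isometries\<close>

text \<open>An isometry carries covers to covers of equal diameters. The inequality is later applied
  to a bijective isometry and to its inverse, which gives equality.\<close>

lemma hausdorff_outer_isometry_le:
  fixes T :: "'a::metric_space \<Rightarrow> 'b::metric_space"
  assumes T: "\<And>x y. dist (T x) (T y) = dist x y"
  shows "hausdorff_outer d (T ` A) \<le> hausdorff_outer d A"
proof -
  have bd: "bounded (T ` C)" if "bounded C" for C
  proof -
    from that obtain x e where "\<forall>y\<in>C. dist x y \<le> e" by (auto simp: bounded_def)
    then show ?thesis by (auto simp: bounded_def T intro!: exI[of _ "T x"] exI[of _ e])
  qed
  have dm: "diameter (T ` C) = diameter C" for C
  proof -
    have "(\<lambda>(x, y). dist x y) ` (T ` C \<times> T ` C) = (\<lambda>(x, y). dist x y) ` (C \<times> C)"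
      by (force simp: T image_iff)
    then show ?thesis by (simp add: diameter_def)
  qed
  have "hausdorff_pre d \<delta> (T ` A) \<le> hausdorff_pre d \<delta> A" for \<delta>
    unfolding hausdorff_pre_alt[of d \<delta> A]
  proof (rule INF_greatest)
    fix C assume "C \<in> small_covers \<delta> A"
    then have "A \<subseteq> (\<Union>i. C i)" "\<And>i. bounded (C i)" "\<And>i. diameter (C i) \<le> \<delta>"
      by (auto simp: small_covers_def)
    then have "hausdorff_pre d \<delta> (T ` A) \<le> (\<Sum>i. hausdorff_cost d (T ` C i))"
    proof (intro hausdorff_pre_le bd)
      assume "A \<subseteq> (\<Union>i. C i)"
      then have "T ` A \<subseteq> T ` (\<Union>i. C i)" by (rule image_mono)
      then show "T ` A \<subseteq> (\<Union>i. T ` C i)" by (simp only: image_UN)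
    qed (simp_all add: dm)
    then show "hausdorff_pre d \<delta> (T ` A) \<le> (\<Sum>i. hausdorff_cost d (C i))"
      by (simp add: hausdorff_cost_def dm)
  qed
  then show ?thesis unfolding hausdorff_outer_def by (intro SUP_mono') 
qed

lemma distr_hausdorff_isometry:
  fixes T T' :: "'a::metric_space \<Rightarrow> 'a"
  assumes d: "d > 0" and T: "\<And>x y. dist (T x) (T y) = dist x y" and inv: "\<And>x. T (T' x) = x"
  shows "distr (hausdorff_measure d) (hausdorff_measure d) T = hausdorff_measure d"
proof (rule measure_eqI)
  have T': "dist (T' x) (T' y) = dist x y" for x y using T[of "T' x" "T' y"] by (simp add: inv)
  have inv': "T' (T x) = x" for x using T[of "T' (T x)" x] by (simp add: inv)
  have "continuous_on UNIV T" unfolding continuous_on_iff using T by (auto intro: exI)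
  then have meas: "T \<in> borel_measurable borel" by (rule borel_measurable_continuous_onI)
  fix A assume "A \<in> sets (distr (hausdorff_measure d) (hausdorff_measure d) T)"
  then have A: "A \<in> sets borel" by simp
  have "T -` A = T' ` A" by (force simp: inv inv')
  moreover have "A = T ` (T' ` A)" by (force simp: inv)
  ultimately have "hausdorff_outer d (T -` A) = hausdorff_outer d A"
    using hausdorff_outer_isometry_le[of T d "T' ` A"] hausdorff_outer_isometry_le[of T' d A] T T'
    by auto
  moreover have "T -` A \<in> sets borel" using measurable_sets[OF meas A] by simp
  ultimately show "emeasure (distr (hausdorff_measure d) (hausdorff_measure d) T) A = emeasure (hausdorff_measure d) A"
    using A d meas by (subst emeasure_distr) (auto simp: emeasure_hausdorff)
qed simp


section \<open>Comparison with Lebesgue measure: positivity and finiteness\<close>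

text \<open>The image of a cover member under the contraction \<pi> lies in the ball around any of
  its points whose radius is the full diameter. Taking the diameter as radius instead of half of it
  costs the factor 1/2 per dimension. The estimate does not depend on the mesh, so mesh 1
  suffices.\<close>

lemma lborel_le_hausdorff_outer:
  fixes \<pi> :: "'a::metric_space \<Rightarrow> 'b::euclidean_space"
  assumes \<pi>: "\<And>x y. dist (\<pi> x) (\<pi> y) \<le> dist x y" and sub: "S \<subseteq> \<pi> ` A"
  shows "ennreal ((1 / 2) ^ DIM('b)) * emeasure lborel S \<le> hausdorff_outer DIM('b) A"
proof -
  let ?d = "DIM('b)"
  have "ennreal ((1 / 2) ^ ?d) * emeasure lborel S \<le> hausdorff_pre ?d 1 A"
    unfolding hausdorff_pre_alt
  proof (rule INF_greatest)
    fix C assume "C \<in> small_covers 1 A"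
    then have C: "A \<subseteq> (\<Union>i. C i)" "\<And>i. bounded (C i)" by (auto simp: small_covers_def)
    define B where "B i = (if C i = {} then {} else cball (\<pi> (SOME x. x \<in> C i)) (diameter (C i)))" for i
    have CB: "\<pi> ` C i \<subseteq> B i" for i
    proof (cases "C i = {}")
      case False
      then have "(SOME x. x \<in> C i) \<in> C i" by (auto intro: someI)
      then have "dist (\<pi> (SOME x. x \<in> C i)) (\<pi> y) \<le> diameter (C i)" if "y \<in> C i" for y
        using diameter_bounded_bound[OF C(2)] that \<pi> order_trans by blast
      then show ?thesis using False by (auto simp: B_def)
    qed auto
    have "S \<subseteq> (\<Union>i. \<pi> ` C i)"
      using order_trans[OF sub image_mono[OF C(1)]] by (simp only: image_UN)
    also have "\<dots> \<subseteq> (\<Union>i. B i)" by (rule UN_mono[OF order_refl CB])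
    finally have "S \<subseteq> (\<Union>i. B i)" .
    then have "emeasure lborel S \<le> emeasure lborel (\<Union>i. B i)"
      by (intro emeasure_mono) (auto simp: B_def)
    also have "\<dots> \<le> (\<Sum>i. emeasure lborel (B i))"
      by (intro emeasure_subadditive_countably) (auto simp: B_def)
    finally have "ennreal ((1 / 2) ^ ?d) * emeasure lborel S
        \<le> (\<Sum>i. ennreal ((1 / 2) ^ ?d) * emeasure lborel (B i))"
      unfolding ennreal_suminf_cmult by (rule mult_left_mono) simp
    also have "\<dots> \<le> (\<Sum>i. hausdorff_cost ?d (C i))"
    proof (rule suminf_le)
      fix i
      show "ennreal ((1 / 2) ^ ?d) * emeasure lborel (B i) \<le> hausdorff_cost ?d (C i)"
        using diameter_ge_0[OF C(2)[of i]]
        by (auto simp: B_def hausdorff_cost_def emeasure_cball power_divide field_simps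
            simp flip: ennreal_mult)
    qed auto
    finally show "ennreal ((1 / 2) ^ ?d) * emeasure lborel S \<le> (\<Sum>i. hausdorff_cost ?d (C i))" .
  qed
  also have "\<dots> \<le> hausdorff_outer ?d A"
    unfolding hausdorff_outer_def by (rule SUP_upper) simp
  finally show ?thesis .
qed

lemma unit_interval_cell:
  fixes x :: real
  assumes "0 \<le> x" "x \<le> 1" "n > 0"
  obtains i where "i < n" "real i / real n \<le> x" "x \<le> (real i + 1) / real n"
proof (cases "x = 1")
  case True
  then show ?thesis using assms by (intro that[of "n - 1"]) (auto simp: of_nat_diff field_simps)
next
  case False
  let ?i = "nat \<lfloor>real n * x\<rfloor>"
  have fl: "of_int \<lfloor>real n * x\<rfloor> \<le> real n * x" "real n * x < of_int \<lfloor>real n * x\<rfloor> + 1" by linarith+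
  have i: "real ?i = of_int \<lfloor>real n * x\<rfloor>" using assms by simp
  have "real n * x < real n * 1" using assms False by (intro mult_strict_left_mono) auto
  then have "real ?i < real n" using i fl by linarith
  then show ?thesis
    using assms fl i by (intro that[of ?i]) (auto simp: field_simps)
qed

text \<open>Cutting the unit cube into n^3 cells of side 1/n cuts \<open>A\<close> into pieces of
  diameter at most 3L/n, whose total cost \<open>?K\<close> does not depend on n. Only the inverse
  of the chart is Lipschitz; the coordinates themselves may jump, as \<open>Arg\<close>
  does.\<close>

lemma hausdorff_outer_chart:
  fixes A :: "'a::metric_space set" and g1 g2 g3 :: "'a \<Rightarrow> real"
  assumes L: "L \<ge> 0"
    and dist: "\<And>p q. p \<in> A \<Longrightarrow> q \<in> A \<Longrightarrow> dist p q \<le> L * (\<bar>g1 p - g1 q\<bar> + \<bar>g2 p - g2 q\<bar> + \<bar>g3 p - g3 q\<bar>)"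
    and A: "\<And>p. p \<in> A \<Longrightarrow> g1 p \<in> {0..1} \<and> g2 p \<in> {0..1} \<and> g3 p \<in> {0..1}"
  shows "hausdorff_outer 3 A < top"
proof -
  let ?K = "unit_ball_vol 3 * (3 * L / 2) ^ 3"
  have "hausdorff_pre 3 \<delta> A \<le> ennreal ?K" if \<delta>: "\<delta> > 0" for \<delta>
  proof -
    obtain n :: nat where n: "3 * L / \<delta> < real n" using reals_Archimedean2 by blast
    have "0 \<le> 3 * L / \<delta>" using L \<delta> by simp
    with n have n0: "n > 0" by (cases n) auto
    have n\<delta>: "3 * L / real n \<le> \<delta>" using n n0 \<delta> by (simp add: field_simps)
    define cell where "cell i = {real i / real n .. (real i + 1) / real n}" for i
    let ?I = "{..<n} \<times> {..<n} \<times> {..<n}"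
    have "card ?I = n ^ 3" by (simp add: power3_eq_cube)
    then obtain h where h: "bij_betw h {..<n ^ 3} ?I"
      using ex_bij_betw_nat_finite[of ?I] by (auto simp: atLeast0LessThan)
    define D where "D = (\<lambda>(i, j, k). {p\<in>A. g1 p \<in> cell i \<and> g2 p \<in> cell j \<and> g3 p \<in> cell k})"
    define C where "C l = (if l < n ^ 3 then D (h l) else {})" for l
    have D: "bounded (D x)" "diameter (D x) \<le> 3 * L / real n" for x
    proof -
      obtain i j k where x: "x = (i, j, k)" by (cases x) auto
      have cell: "\<bar>a - b\<bar> \<le> 1 / real n" if "a \<in> cell i" "b \<in> cell i" for a b i
        using that n0 by (auto simp: cell_def field_simps abs_if)
      have "dist p q \<le> 3 * L / real n" if "p \<in> D x" "q \<in> D x" for p q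
      proof -
        have p: "p \<in> A" "q \<in> A" "g1 p \<in> cell i" "g1 q \<in> cell i" "g2 p \<in> cell j" "g2 q \<in> cell j"
          "g3 p \<in> cell k" "g3 q \<in> cell k"
          using \<open>p \<in> D x\<close> \<open>q \<in> D x\<close> by (auto simp: D_def x)
        have "dist p q \<le> L * (\<bar>g1 p - g1 q\<bar> + \<bar>g2 p - g2 q\<bar> + \<bar>g3 p - g3 q\<bar>)" by (rule dist) (fact p)+
        also have "\<dots> \<le> L * (1 / real n + 1 / real n + 1 / real n)"
          by (intro mult_left_mono add_mono cell L; fact p)
        finally show ?thesis by (simp add: field_simps)
      qed
      note dD = this
      show "bounded (D x)"
      proof (cases "D x = {}")
        case False
        then obtain p where "p \<in> D x" by auto
        then show ?thesis unfolding bounded_def using dD by blast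
      qed auto
      show "diameter (D x) \<le> 3 * L / real n"
        unfolding diameter_def using dD L by (auto intro!: cSUP_least)
    qed
    have "hausdorff_pre 3 \<delta> A \<le> (\<Sum>l. hausdorff_cost 3 (C l))"
    proof (rule hausdorff_pre_le)
      show "A \<subseteq> (\<Union>l. C l)"
      proof
        fix p assume "p \<in> A"
        then obtain i j k where "i < n" "j < n" "k < n" "g1 p \<in> cell i" "g2 p \<in> cell j" "g3 p \<in> cell k"
          using unit_interval_cell[of "g1 p" n] unit_interval_cell[of "g2 p" n] unit_interval_cell[of "g3 p" n] A[of p] n0
          unfolding cell_def by (metis atLeastAtMost_iff)
        then have "p \<in> D (i, j, k)" "(i, j, k) \<in> ?I" using \<open>p \<in> A\<close> by (auto simp: D_def)
        then show "p \<in> (\<Union>l. C l)"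
          using h unfolding bij_betw_def C_def by (auto simp: image_iff set_eq_iff) (metis lessThan_iff imageE)
      qed
      show "bounded (C l)" "diameter (C l) \<le> \<delta>" for l
        using D(1)[of "h l"] order_trans[OF D(2)[of "h l"] n\<delta>] \<delta> by (auto simp: C_def)
    qed
    also have "\<dots> = (\<Sum>l<n ^ 3. hausdorff_cost 3 (C l))"
      by (rule suminf_finite) (auto simp: C_def)
    also have "\<dots> \<le> (\<Sum>l<n ^ 3. ennreal (unit_ball_vol 3 * (3 * L / real n / 2) ^ 3))"
    proof (rule sum_mono)
      fix l assume "l \<in> {..<n ^ 3}"
      have "(diameter (C l) / 2) ^ 3 \<le> (3 * L / real n / 2) ^ 3"
        using D[of "h l"] L by (intro power_mono divide_right_mono) (auto simp: C_def diameter_ge_0)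
      then show "hausdorff_cost 3 (C l) \<le> ennreal (unit_ball_vol 3 * (3 * L / real n / 2) ^ 3)"
        unfolding hausdorff_cost_def by (intro ennreal_leI) (auto intro: mult_left_mono)
    qed
    also have "\<dots> = ennreal (real (n ^ 3) * (unit_ball_vol 3 * (3 * L / real n / 2) ^ 3))"
      by (subst sum_ennreal) (use L in auto)
    also have "real (n ^ 3) * (unit_ball_vol 3 * (3 * L / real n / 2) ^ 3) = ?K"
      using n0 by (simp add: field_simps)
    finally show ?thesis .
  qed
  then have "hausdorff_outer 3 A \<le> ennreal ?K"
    unfolding hausdorff_outer_def by (intro SUP_least) auto
  then show ?thesis by (rule le_less_trans) simp
qed

section \<open>Geometry of the egg domain\<close>

lemma rho_eq: "rho m p = cmod (fst p) ^ 2 + cmod (snd p) ^ (2 * m) - 1"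
  by (simp add: rho_def split: prod.split)

lemma egg_eq: "egg m = {p. rho m p < 0}"
  by (auto simp: egg_def rho_def)

lemma continuous_on_rho [continuous_intros]: "continuous_on S f \<Longrightarrow> continuous_on S (\<lambda>x. rho m (f x))"
  unfolding rho_eq by (intro continuous_intros)

lemma open_egg [simp]: "open (egg m)"
  unfolding egg_eq by (intro open_Collect_less continuous_intros)

lemma rho_scaleR_le:
  assumes "m \<ge> 1" "0 \<le> t" "t \<le> 1"
  shows "rho m (t *\<^sub>R p) \<le> t\<^sup>2 * (rho m p + 1) - 1"
proof -
  have "t ^ (2 * m) \<le> t\<^sup>2" using assms by (intro power_decreasing) auto
  then have "t ^ (2 * m) * cmod (snd p) ^ (2 * m) \<le> t\<^sup>2 * cmod (snd p) ^ (2 * m)"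
    by (intro mult_right_mono) auto
  then show ?thesis using assms by (simp add: rho_eq power_mult_distrib algebra_simps)
qed

lemma scaleR_in_egg:
  assumes "m \<ge> 1" "0 \<le> t" "t < 1" "rho m p \<le> 0"
  shows "t *\<^sub>R p \<in> egg m"
proof -
  have "t\<^sup>2 * (rho m p + 1) \<le> t\<^sup>2 * 1" using assms by (intro mult_left_mono) auto
  moreover have "t\<^sup>2 < 1" using assms by (simp add: power_less_one_iff)
  ultimately show ?thesis
    using rho_scaleR_le[of m t p] assms by (simp add: egg_eq)
qed

text \<open>The egg is star-shaped about 0, so a point with \<open>rho m p \<le> 0\<close> is the
  limit of its dilates by factors below 1, which lie in the egg.\<close>

lemma closure_egg:
  assumes "m \<ge> 1"
  shows "closure (egg m) = {p. rho m p \<le> 0}"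
proof
  show "closure (egg m) \<subseteq> {p. rho m p \<le> 0}"
    by (rule closure_minimal) (auto simp: egg_eq intro!: closed_Collect_le continuous_intros)
  show "{p. rho m p \<le> 0} \<subseteq> closure (egg m)"
  proof
    fix p assume p: "p \<in> {p. rho m p \<le> 0}"
    have "(\<lambda>n. (1 - inverse (real (Suc n))) *\<^sub>R p) \<longlonglongrightarrow> (1 - 0) *\<^sub>R p"
      by (intro tendsto_intros LIMSEQ_inverse_real_of_nat)
    moreover have "(1 - inverse (real (Suc n))) *\<^sub>R p \<in> egg m" for n
      using p assms by (intro scaleR_in_egg) (auto simp: field_simps)
    ultimately show "p \<in> closure (egg m)"
      unfolding closure_sequential by (intro exI[of _ "\<lambda>n. (1 - inverse (real (Suc n))) *\<^sub>R p"]) simp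
  qed
qed

lemma frontier_egg: "m \<ge> 1 \<Longrightarrow> frontier (egg m) = {p. rho m p = 0}"
  unfolding frontier_def by (auto simp: closure_egg interior_open) (auto simp: egg_eq)

lemma rho_le_0_bounds:
  assumes "m \<ge> 1" "rho m p \<le> 0"
  shows "cmod (fst p) \<le> 1" "cmod (snd p) \<le> 1" "norm p \<le> 2"
proof -
  have "0 \<le> cmod (fst p) ^ 2" "0 \<le> cmod (snd p) ^ (2 * m)" by simp_all
  then have "cmod (fst p) ^ 2 \<le> 1" "cmod (snd p) ^ (2 * m) \<le> 1"
    using assms(2) unfolding rho_eq by linarith+
  then show 1: "cmod (fst p) \<le> 1" "cmod (snd p) \<le> 1"
    using assms by (simp_all add: power_le_one_iff)
  show "norm p \<le> 2" using 1 norm_Pair_le[of "fst p" "snd p"] by simp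
qed

lemma compact_frontier_egg [simp]:
  assumes "m \<ge> 1"
  shows "compact (frontier (egg m))"
proof -
  have "bounded (egg m)"
    using rho_le_0_bounds[OF assms] unfolding bounded_iff egg_eq by (meson less_imp_le mem_Collect_eq)
  then show ?thesis by (rule compact_frontier_bounded)
qed

lemma frontier_egg_nonempty: "m \<ge> 1 \<Longrightarrow> frontier (egg m) \<noteq> {}"
proof -
  assume m: "m \<ge> 1"
  then have "(1, 0) \<in> frontier (egg m)" by (auto simp: frontier_egg[OF m] rho_eq power_0_left)
  then show ?thesis by blast
qed

section \<open>The normal direction\<close>

text \<open>Half of the real gradient of \<open>rho m\<close>, that is, the pair of its conjugate
  Wirtinger derivatives. The positive factor disappears in \<open>sgn\<close>, so its direction is
  that of \<open>unit_normal\<close>.\<close>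

definition half_grad :: "nat \<Rightarrow> complex \<times> complex \<Rightarrow> complex \<times> complex" where
  "half_grad m p = (fst p, (real m * cmod (snd p) ^ (2 * (m - 1))) *\<^sub>R snd p)"

lemma unit_normal_eq: "unit_normal m p = sgn (half_grad m p)"
proof (cases p)
  case (Pair z w)
  have "of_nat m * (w * cnj w) ^ (m - 1) * w = snd (half_grad m p)"
    by (simp add: half_grad_def Pair power_mult scaleR_conv_of_real flip: complex_norm_square)
  then have "2 *\<^sub>R (z, of_nat m * (w * cnj w) ^ (m - 1) * w) = 2 *\<^sub>R half_grad m p"
    by (simp add: half_grad_def Pair)
  then show ?thesis unfolding unit_normal_def Pair gradient_rho_explicit by (simp add: sgn_scaleR)
qed

lemma inner_half_grad:
  assumes "m \<ge> 1"
  shows "inner p (half_grad m p) = cmod (fst p) ^ 2 + real m * cmod (snd p) ^ (2 * m)"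
proof -
  obtain j where j: "m = Suc j" using assms by (cases m) auto
  have "inner p (half_grad m p) = cmod (fst p) ^ 2 + real m * cmod (snd p) ^ (2 * (m - 1)) * cmod (snd p) ^ 2"
    by (simp add: half_grad_def inner_prod_def dot_square_norm)
  then show ?thesis by (simp add: j power_mult power_mult_distrib power2_eq_square)
qed

text \<open>Uniform transversality of the radius to the boundary: replacing the coefficient m by 1
  leaves \<open>rho m p + 1\<close>.\<close>

lemma inner_half_grad_ge_1:
  assumes "m \<ge> 1" "rho m p = 0"
  shows "1 \<le> inner p (half_grad m p)"
proof -
  have "1 * cmod (snd p) ^ (2 * m) \<le> real m * cmod (snd p) ^ (2 * m)"
    using assms by (intro mult_right_mono) auto
  then show ?thesis using assms by (simp add: inner_half_grad rho_eq)
qed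

lemma half_grad_nonzero: "m \<ge> 1 \<Longrightarrow> rho m p = 0 \<Longrightarrow> half_grad m p \<noteq> 0"
  using inner_half_grad_ge_1[of m p] by auto

lemma norm_half_grad_le:
  assumes "m \<ge> 1" "rho m p = 0"
  shows "norm (half_grad m p) \<le> 1 + real m"
proof -
  have b: "cmod (fst p) \<le> 1" "cmod (snd p) \<le> 1" using rho_le_0_bounds[of m p] assms by auto
  have "norm (half_grad m p) \<le> cmod (fst p) + real m * (cmod (snd p) ^ (2 * (m - 1)) * cmod (snd p))"
    unfolding half_grad_def by (rule order_trans[OF norm_Pair_le]) (simp add: norm_mult norm_power)
  also have "\<dots> \<le> 1 + real m * (1 * 1)"
    using b by (intro add_mono mult_left_mono mult_mono power_le_one) auto
  finally show ?thesis by simp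
qed

lemma continuous_on_half_grad: "continuous_on S (half_grad m)"
  unfolding half_grad_def by (intro continuous_intros)

text \<open>Each coordinate of \<open>half_grad m p\<close> is a nonnegative real multiple of the
  same coordinate of \<open>p\<close>, so the Hermitian product has no imaginary part.\<close>

lemma cdot_half_grad: "cdot p (cnj2 (half_grad m p)) = of_real (inner p (half_grad m p))"
proof -
  have "inner p (half_grad m p) = cmod (fst p) ^ 2 + real m * cmod (snd p) ^ (2 * (m - 1)) * cmod (snd p) ^ 2"
    by (simp add: half_grad_def inner_prod_def dot_square_norm)
  then show ?thesis
    by (simp only: of_real_add of_real_mult complex_norm_square)
      (simp add: cdot_def cnj2_def half_grad_def scaleR_conv_of_real)
qed

section \<open>Radial segments in the approach regions\<close>

text \<open>Induction on the exponent: the remainder for m + 1 is \<open>B\<close> times the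
  remainder for m, plus \<open>real m * A ^ (m - 1) * (B - A)\<^sup>2\<close>. This yields the new
  constant R C + m R^(m-1).\<close>

lemma power_second_order:
  fixes R :: real
  assumes "R \<ge> 0"
  obtains C where "C \<ge> 0"
    "\<And>A B. 0 \<le> A \<Longrightarrow> A \<le> R \<Longrightarrow> 0 \<le> B \<Longrightarrow> B \<le> R \<Longrightarrow>
      B ^ m - A ^ m - real m * A ^ (m - 1) * (B - A) \<le> C * (B - A)\<^sup>2"
proof -
  have "\<exists>C\<ge>0. \<forall>A B. 0 \<le> A \<and> A \<le> R \<and> 0 \<le> B \<and> B \<le> R \<longrightarrow>
      B ^ m - A ^ m - real m * A ^ (m - 1) * (B - A) \<le> C * (B - A)\<^sup>2"
  proof (induction m)
    case 0
    then show ?case by auto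
  next
    case (Suc m)
    then obtain C where C: "C \<ge> 0" "\<And>A B. 0 \<le> A \<Longrightarrow> A \<le> R \<Longrightarrow> 0 \<le> B \<Longrightarrow> B \<le> R \<Longrightarrow>
      B ^ m - A ^ m - real m * A ^ (m - 1) * (B - A) \<le> C * (B - A)\<^sup>2" by blast
    have "B ^ Suc m - A ^ Suc m - real (Suc m) * A ^ (Suc m - 1) * (B - A) \<le> (R * C + real m * R ^ (m - 1)) * (B - A)\<^sup>2"
      if AB: "0 \<le> A" "A \<le> R" "0 \<le> B" "B \<le> R" for A B
    proof -
      have "B ^ Suc m - A ^ Suc m - real (Suc m) * A ^ (Suc m - 1) * (B - A)
        = B * (B ^ m - A ^ m - real m * A ^ (m - 1) * (B - A)) + real m * A ^ (m - 1) * (B - A)\<^sup>2"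
        by (cases m) (auto simp: algebra_simps power2_eq_square)
      also have "\<dots> \<le> R * (C * (B - A)\<^sup>2) + real m * R ^ (m - 1) * (B - A)\<^sup>2"
      proof (rule add_mono)
        have "B * (B ^ m - A ^ m - real m * A ^ (m - 1) * (B - A)) \<le> B * (C * (B - A)\<^sup>2)"
          using C AB by (intro mult_left_mono) auto
        also have "\<dots> \<le> R * (C * (B - A)\<^sup>2)" using C AB by (intro mult_right_mono) auto
        finally show "B * (B ^ m - A ^ m - real m * A ^ (m - 1) * (B - A)) \<le> R * (C * (B - A)\<^sup>2)" .
        show "real m * A ^ (m - 1) * (B - A)\<^sup>2 \<le> real m * R ^ (m - 1) * (B - A)\<^sup>2"
          using AB by (intro mult_right_mono mult_left_mono power_mono) auto
      qed
      finally show ?thesis by (simp add: algebra_simps)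
    qed
    moreover have "R * C + real m * R ^ (m - 1) \<ge> 0" using C assms by simp
    ultimately show ?case by blast
  qed
  then show ?thesis using that by blast
qed

text \<open>In the variable A = |w|^2 the second term of \<open>rho m\<close> is the power A^m, to
  which the one-variable bound applies with R = 36 = 6^2. The factor 144 is 12^2, from |w| + |w'|
  \<le> 12. The radius 6 leaves room for boundary points of norm at most 2 and displacements of norm
  at most 4.\<close>

lemma rho_second_order:
  assumes m: "m \<ge> 1"
  obtains M where "M \<ge> 0"
    "\<And>p q. norm p \<le> 6 \<Longrightarrow> norm q \<le> 6 \<Longrightarrow>
      rho m q \<le> rho m p + 2 * inner (q - p) (half_grad m p) + M * norm (q - p) ^ 2"
proof -
  obtain C where C: "C \<ge> 0" "\<And>A B. 0 \<le> A \<Longrightarrow> A \<le> 36 \<Longrightarrow> 0 \<le> B \<Longrightarrow> B \<le> 36 \<Longrightarrow>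
      B ^ m - A ^ m - real m * A ^ (m - 1) * (B - A) \<le> C * (B - A)\<^sup>2"
    using power_second_order[of 36 m] by auto
  let ?M = "1 + real m * 36 ^ (m - 1) + 144 * C"
  have "rho m q \<le> rho m p + 2 * inner (q - p) (half_grad m p) + ?M * norm (q - p) ^ 2"
    if pq: "norm p \<le> 6" "norm q \<le> 6" for p q
  proof -
    obtain z w where p: "p = (z, w)" by (cases p)
    obtain z' w' where q: "q = (z', w')" by (cases q)
    have w: "cmod w \<le> 6" "cmod w' \<le> 6"
      using pq norm_snd_le[of w z] norm_snd_le[of w' z'] by (auto simp: p q)
    define h k where "h = z' - z" and "k = w' - w"
    define A B where "A = cmod w ^ 2" and "B = cmod w' ^ 2"
    have AB: "0 \<le> A" "A \<le> 36" "0 \<le> B" "B \<le> 36"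
      using w power_mono[OF w(1), of 2] power_mono[OF w(2), of 2] by (auto simp: A_def B_def)
    have kB: "B - A = 2 * inner k w + cmod k ^ 2"
      unfolding A_def B_def k_def power2_norm_eq_inner
      by (simp add: inner_diff_left inner_diff_right inner_commute algebra_simps)
    have hh: "cmod z' ^ 2 - cmod z ^ 2 = 2 * inner h z + cmod h ^ 2"
      unfolding h_def power2_norm_eq_inner
      by (simp add: inner_diff_left inner_diff_right inner_commute algebra_simps)
    have "\<bar>B - A\<bar> = \<bar>cmod w' - cmod w\<bar> * (cmod w' + cmod w)"
      by (simp add: A_def B_def power2_eq_square abs_mult[symmetric] square_diff_square_factored mult.commute abs_mult)
    also have "\<dots> \<le> cmod k * 12"
      unfolding k_def using w norm_triangle_ineq3[of w' w] by (intro mult_mono) auto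
    finally have "(B - A)\<^sup>2 \<le> (cmod k * 12)\<^sup>2" by (metis abs_ge_zero power2_abs power_mono)
    then have sq: "C * (B - A)\<^sup>2 \<le> C * (144 * cmod k ^ 2)"
      using C by (intro mult_left_mono) (auto simp: power_mult_distrib)
    have "real m * A ^ (m - 1) * cmod k ^ 2 \<le> real m * 36 ^ (m - 1) * cmod k ^ 2"
      using AB by (intro mult_right_mono mult_left_mono power_mono) auto
    moreover have "B ^ m - A ^ m \<le> real m * A ^ (m - 1) * (2 * inner k w + cmod k ^ 2) + C * (B - A)\<^sup>2"
      using C(2)[OF AB] by (simp add: kB)
    ultimately have 1: "B ^ m - A ^ m \<le> 2 * (real m * A ^ (m - 1) * inner k w)
        + (real m * 36 ^ (m - 1) + 144 * C) * cmod k ^ 2"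
      using sq by (simp add: algebra_simps)
    have gr: "inner (q - p) (half_grad m p) = inner h z + real m * A ^ (m - 1) * inner k w"
      by (simp add: p q half_grad_def A_def h_def k_def power_mult[symmetric])
    have nn: "norm (q - p) ^ 2 = cmod h ^ 2 + cmod k ^ 2"
      by (simp add: p q h_def k_def norm_prod_def)
    have "rho m q - rho m p = (cmod z' ^ 2 - cmod z ^ 2) + (B ^ m - A ^ m)"
      by (simp add: p q rho_eq A_def B_def power_mult)
    also have "\<dots> \<le> 2 * inner (q - p) (half_grad m p) + cmod h ^ 2 + (real m * 36 ^ (m - 1) + 144 * C) * cmod k ^ 2"
      unfolding hh gr using 1 by (simp add: algebra_simps)
    also have "\<dots> \<le> 2 * inner (q - p) (half_grad m p) + ?M * (cmod h ^ 2 + cmod k ^ 2)"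
    proof -
      have "0 \<le> (real m * 36 ^ (m - 1) + 144 * C) * cmod h ^ 2" using C by (intro mult_nonneg_nonneg) auto
      then show ?thesis by (simp add: algebra_simps)
    qed
    finally show ?thesis by (simp add: nn)
  qed
  moreover have "?M \<ge> 0" using C by simp
  ultimately show ?thesis using that by blast
qed

lemma norm_unit_normal: "m \<ge> 1 \<Longrightarrow> rho m \<xi> = 0 \<Longrightarrow> norm (unit_normal m \<xi>) = 1"
  using half_grad_nonzero[of m \<xi>] by (simp add: unit_normal_eq norm_sgn)

lemma infdist_tangent_plane:
  assumes "m \<ge> 1" "rho m \<xi> = 0"
  shows "infdist p (tangent_plane m \<xi>) = \<bar>inner (p - \<xi>) (unit_normal m \<xi>)\<bar>"
proof (rule antisym)
  let ?n = "unit_normal m \<xi>"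
  have n: "norm ?n = 1" "inner ?n ?n = 1" using norm_unit_normal[OF assms] by (auto simp: dot_square_norm)
  let ?q = "p - inner (p - \<xi>) ?n *\<^sub>R ?n"
  have "?q \<in> tangent_plane m \<xi>" using n by (simp add: tangent_plane_def inner_diff_left algebra_simps)
  then have "infdist p (tangent_plane m \<xi>) \<le> dist p ?q" by (rule infdist_le)
  then show "infdist p (tangent_plane m \<xi>) \<le> \<bar>inner (p - \<xi>) ?n\<bar>" using n by (simp add: dist_norm)
  have "\<xi> \<in> tangent_plane m \<xi>" by (simp add: tangent_plane_def)
  moreover have "\<bar>inner (p - \<xi>) ?n\<bar> \<le> dist p a" if "a \<in> tangent_plane m \<xi>" for a
  proof -
    have "inner (p - \<xi>) ?n = inner (p - a) ?n"
      using that by (simp add: tangent_plane_def inner_diff_left algebra_simps)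
    then show ?thesis using Cauchy_Schwarz_ineq2[of "p - a" ?n] n by (simp add: dist_norm)
  qed
  ultimately show "\<bar>inner (p - \<xi>) ?n\<bar> \<le> infdist p (tangent_plane m \<xi>)"
    by (subst infdist_notempty) (auto intro!: cINF_greatest)
qed

lemma cdot_scaleR: "cdot (a *\<^sub>R u) (cnj2 (b *\<^sub>R v)) = of_real (a * b) * cdot u (cnj2 v)"
  by (simp add: cdot_def cnj2_def scaleR_conv_of_real algebra_simps)

text \<open>On the boundary the Hermitian product of \<open>\<xi>\<close> with its normal is real, so on the segment
  from \<open>0\<close> to \<open>\<xi>\<close> the first condition of the approach region only compares the distance to the
  tangent plane with the distance to the boundary. The constant \<open>t0\<close> does not depend on \<open>\<xi>\<close>; this is
  what turns the maximal function into a dominating function.\<close>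

lemma radial_approach:
  assumes m: "m \<ge> 1" and \<alpha>: "\<alpha> > 0"
  obtains t0 where "0 \<le> t0" "t0 < 1"
    "\<And>\<xi> t. rho m \<xi> = 0 \<Longrightarrow> t0 < t \<Longrightarrow> t < 1 \<Longrightarrow> t *\<^sub>R \<xi> \<in> approach_region m \<alpha> \<xi>"
proof -
  obtain M where M: "M \<ge> 0" "\<And>p q. norm p \<le> 6 \<Longrightarrow> norm q \<le> 6 \<Longrightarrow>
      rho m q \<le> rho m p + 2 * inner (q - p) (half_grad m p) + M * norm (q - p) ^ 2"
    using rho_second_order[OF m] by blast
  \<comment> \<open>Any value strictly between 1 / (1 + \<alpha>) and 1 would do: being below 1
    leaves room for the quadratic error, and (1 + \<alpha>) \<kappa> > 1 makes the first condition
    of the approach region strict.\<close>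
  define \<kappa> where "\<kappa> = (1 + \<alpha> / 2) / (1 + \<alpha>)"
  have "(1 + \<alpha>) * \<kappa> = 1 + \<alpha> / 2" using \<alpha> by (simp add: \<kappa>_def)
  then have \<kappa>: "0 < \<kappa>" "\<kappa> < 1" "(1 + \<alpha>) * \<kappa> > 1"
    using \<alpha> by (auto simp: \<kappa>_def)
  \<comment> \<open>A lower bound for the inner product of \<xi> with its unit normal: the product
    with \<open>half_grad\<close> is at least 1, and the norm of \<open>half_grad\<close> is at most
    1 + m.\<close>
  define a0 where "a0 = 1 / (1 + real m)"
  have a0: "a0 > 0" by (simp add: a0_def add_pos_nonneg)
  \<comment> \<open>The three bounds serve in turn to keep all points in the ball of radius 6, to
    keep the quadratic error below the linear gain, and to obtain the second condition of the
    approach region.\<close>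
  define s0 where "s0 = min 1 (min ((1 - \<kappa>) / (16 * M + 1)) (\<alpha> * \<kappa> * a0 / 8))"
  have s0: "0 < s0" "s0 \<le> 1" using M \<kappa> \<alpha> a0 by (auto simp: s0_def)
  show ?thesis
  proof (rule that[of "1 - s0"])
    fix \<xi> :: "complex \<times> complex" and t :: real
    assume \<xi>: "rho m \<xi> = 0" and t: "1 - s0 < t" "t < 1"
    define s where "s = 1 - t"
    have s: "0 < s" "s < s0" using t by (auto simp: s_def)
    have s1: "s < 1" using s s0 by simp
    have "s < (1 - \<kappa>) / (16 * M + 1)" using s by (simp add: s0_def)
    then have "s * (16 * M + 1) < 1 - \<kappa>" using M by (simp add: pos_less_divide_eq)
    then have sM: "16 * M * s < 2 * (1 - \<kappa>)" using s \<kappa> by (simp add: algebra_simps)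
    have sa: "8 * s < \<alpha> * \<kappa> * a0" using s by (simp add: s0_def)
    let ?g = "half_grad m \<xi>" and ?n = "unit_normal m \<xi>"
    have g: "norm ?g > 0" using half_grad_nonzero[OF m \<xi>] by simp
    have nsc: "?n = inverse (norm ?g) *\<^sub>R ?g" by (simp add: unit_normal_eq sgn_div_norm)
    define a where "a = inner \<xi> ?n"
    have ag: "a * norm ?g = inner \<xi> ?g" using g by (simp add: a_def nsc)
    have a: "a \<ge> a0"
    proof -
      have "1 \<le> a * norm ?g" using inner_half_grad_ge_1[OF m \<xi>] by (simp add: ag)
      moreover from this have "0 < a" using g by (metis less_le_trans zero_less_mult_pos2 zero_less_one)
      moreover have "a * norm ?g \<le> a * (1 + real m)"
        using norm_half_grad_le[OF m \<xi>] \<open>0 < a\<close> by (intro mult_left_mono) auto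
      ultimately have "1 \<le> a * (1 + real m)" by linarith
      then show ?thesis by (simp add: a0_def field_simps)
    qed
    with a0 have a_pos: "a > 0" by simp
    have n1: "norm ?n = 1" by (rule norm_unit_normal[OF m \<xi>])
    have \<xi>2: "norm \<xi> \<le> 2" using rho_le_0_bounds[of m \<xi>] m \<xi> by simp
    have a2: "a \<le> 2" using Cauchy_Schwarz_ineq2[of \<xi> ?n] n1 \<xi>2 by (simp add: a_def)
    have \<xi>t: "\<xi> - t *\<^sub>R \<xi> = s *\<^sub>R \<xi>" by (simp add: s_def algebra_simps)
    \<comment> \<open>Going inward by s \<xi> changes the product with \<open>?g\<close> by -s times
      \<open>inner \<xi> ?g\<close>. By Cauchy-Schwarz a further displacement shorter than \<kappa>
      s a wins back at most the fraction \<kappa> of it, since a times the norm of \<open>?g\<close>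
      is that same product. What remains outweighs the quadratic term, so the distance to the
      boundary is at least \<kappa> s a, against s a for the tangent plane.\<close>
    have ball: "ball (t *\<^sub>R \<xi>) (\<kappa> * s * a) \<subseteq> egg m"
    proof
      fix q assume "q \<in> ball (t *\<^sub>R \<xi>) (\<kappa> * s * a)"
      then have q: "norm (q - t *\<^sub>R \<xi>) < \<kappa> * s * a" by (simp add: dist_norm norm_minus_commute)
      have q\<xi>: "q - \<xi> = (q - t *\<^sub>R \<xi>) - s *\<^sub>R \<xi>" by (simp add: s_def algebra_simps)
      have "\<kappa> * s * a \<le> 1 * s * 2" using \<kappa> s a2 a_pos by (intro mult_mono) auto
      then have n4: "norm (q - \<xi>) \<le> 4 * s"
      proof -
        have "norm (q - \<xi>) \<le> norm (q - t *\<^sub>R \<xi>) + norm (s *\<^sub>R \<xi>)"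
          unfolding q\<xi> by (rule norm_triangle_ineq4)
        moreover have "norm (s *\<^sub>R \<xi>) \<le> s * 2" using s \<xi>2 by simp
        ultimately show ?thesis using q \<open>\<kappa> * s * a \<le> 1 * s * 2\<close> by linarith
      qed
      have "norm q \<le> norm (q - \<xi>) + norm \<xi>" by (metis diff_add_cancel norm_triangle_ineq)
      then have q6: "norm q \<le> 6" using n4 s1 \<xi>2 by simp
      have "inner (q - t *\<^sub>R \<xi>) ?g \<le> norm (q - t *\<^sub>R \<xi>) * norm ?g" by (rule norm_cauchy_schwarz)
      also have "\<dots> \<le> \<kappa> * s * a * norm ?g" using q by (intro mult_right_mono) auto
      also have "\<dots> = \<kappa> * s * inner \<xi> ?g" by (simp flip: ag)
      finally have "inner (q - \<xi>) ?g \<le> - ((1 - \<kappa>) * s * inner \<xi> ?g)"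
        unfolding q\<xi> inner_diff_left by (simp add: algebra_simps)
      moreover have "(1 - \<kappa>) * s * 1 \<le> (1 - \<kappa>) * s * inner \<xi> ?g"
        using inner_half_grad_ge_1[OF m \<xi>] \<kappa> s by (intro mult_left_mono) auto
      ultimately have i: "inner (q - \<xi>) ?g \<le> - ((1 - \<kappa>) * s)" by simp
      have "norm (q - \<xi>) ^ 2 \<le> (4 * s) ^ 2" using n4 by (intro power_mono) auto
      then have "M * norm (q - \<xi>) ^ 2 \<le> M * (16 * s\<^sup>2)"
        using M by (intro mult_left_mono) (auto simp: power_mult_distrib)
      then have "rho m q \<le> 2 * (- ((1 - \<kappa>) * s)) + M * (16 * s\<^sup>2)"
        using M(2)[of \<xi> q] \<xi>2 q6 \<xi> i by simp
      also have "\<dots> = s * (16 * M * s - 2 * (1 - \<kappa>))" by (simp add: power2_eq_square algebra_simps)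
      also have "\<dots> < 0" using sM s by (intro mult_pos_neg) auto
      finally show "q \<in> egg m" by (simp add: egg_eq)
    qed
    have fr: "\<kappa> * s * a \<le> infdist (t *\<^sub>R \<xi>) (frontier (egg m))"
    proof -
      have "\<kappa> * s * a \<le> dist (t *\<^sub>R \<xi>) y" if "y \<in> frontier (egg m)" for y
      proof (rule ccontr)
        assume "\<not> ?thesis"
        then have "y \<in> egg m" using ball by auto
        with that show False unfolding frontier_egg[OF m] by (simp add: egg_eq)
      qed
      then show ?thesis
        unfolding infdist_notempty[OF frontier_egg_nonempty[OF m]]
        by (rule cINF_greatest[OF frontier_egg_nonempty[OF m]])
    qed
    have "inner (t *\<^sub>R \<xi> - \<xi>) ?n = - (s * a)" by (simp add: a_def s_def algebra_simps)
    then have tp: "infdist (t *\<^sub>R \<xi>) (tangent_plane m \<xi>) = s * a"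
      using s a_pos by (simp add: infdist_tangent_plane[OF m \<xi>])
    have "\<kappa> * s * a \<le> 1 * s * a" using \<kappa> s a_pos by (intro mult_right_mono) auto
    then have ad: "\<kappa> * s * a \<le> approach_dist m \<xi> (t *\<^sub>R \<xi>)"
      unfolding approach_dist_def tp using fr by simp
    have "cdot (\<xi> - t *\<^sub>R \<xi>) (cnj2 ?n) = of_real (s * a)"
      unfolding \<xi>t nsc cdot_scaleR cdot_half_grad ag[symmetric] using g by (simp add: field_simps)
    then have "cmod (cdot (\<xi> - t *\<^sub>R \<xi>) (cnj2 ?n)) = \<bar>s * a\<bar>" by (simp only: norm_of_real)
    also have "\<bar>s * a\<bar> = 1 * (s * a)" using s a_pos by simp
    also have "\<dots> < ((1 + \<alpha>) * \<kappa>) * (s * a)" using \<kappa> s a_pos by (intro mult_strict_right_mono) auto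
    also have "\<dots> = (1 + \<alpha>) * (\<kappa> * s * a)" by simp
    also have "\<dots> \<le> (1 + \<alpha>) * approach_dist m \<xi> (t *\<^sub>R \<xi>)" using ad \<alpha> by (intro mult_left_mono) auto
    finally have c1: "cmod (cdot (\<xi> - t *\<^sub>R \<xi>) (cnj2 ?n)) < (1 + \<alpha>) * approach_dist m \<xi> (t *\<^sub>R \<xi>)" .
    have "norm (\<xi> - t *\<^sub>R \<xi>) ^ 2 \<le> (s * 2)\<^sup>2"
      unfolding \<xi>t using s \<xi>2 by (intro power_mono) auto
    also have "\<dots> = s * (4 * s)" by (simp add: power2_eq_square)
    also have "\<dots> < s * (\<alpha> * \<kappa> * a)"
    proof (intro mult_strict_left_mono)
      have "\<alpha> * \<kappa> * a0 \<le> \<alpha> * \<kappa> * a" using a \<alpha> \<kappa> by (intro mult_left_mono) auto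
      then show "4 * s < \<alpha> * \<kappa> * a" using sa s by linarith
    qed (use s in auto)
    also have "\<dots> = \<alpha> * (\<kappa> * s * a)" by simp
    also have "\<dots> \<le> \<alpha> * approach_dist m \<xi> (t *\<^sub>R \<xi>)" using ad \<alpha> by (intro mult_left_mono) auto
    finally have c2: "norm (\<xi> - t *\<^sub>R \<xi>) ^ 2 < \<alpha> * approach_dist m \<xi> (t *\<^sub>R \<xi>)" .
    have "t *\<^sub>R \<xi> \<in> egg m"
      using ball \<kappa> s a_pos centre_in_ball[of "t *\<^sub>R \<xi>" "\<kappa> * s * a"] by auto
    with c1 c2 show "t *\<^sub>R \<xi> \<in> approach_region m \<alpha> \<xi>" by (simp add: approach_region_def)
  qed (use s0 in auto)
qed

section \<open>Measurability of the maximal function\<close>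

lemma continuous_on_unit_normal:
  assumes "m \<ge> 1"
  shows "continuous_on (frontier (egg m)) (unit_normal m)"
proof -
  have "continuous_on (frontier (egg m)) (\<lambda>\<xi>. sgn (half_grad m \<xi>))"
    unfolding sgn_div_norm using half_grad_nonzero[OF assms]
    by (intro continuous_intros continuous_on_half_grad) (auto simp: frontier_egg[OF assms])
  then show ?thesis by (simp add: unit_normal_eq[abs_def])
qed

text \<open>For fixed \<open>p\<close> both conditions are strict inequalities between continuous
  functions of the boundary point.\<close>

lemma openin_approach:
  assumes m: "m \<ge> 1"
  shows "openin (top_of_set (frontier (egg m))) {\<xi>\<in>frontier (egg m). p \<in> approach_region m \<alpha> \<xi>}"
proof (cases "p \<in> egg m")
  case True
  let ?F = "frontier (egg m)" and ?n = "unit_normal m"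
  let ?D = "\<lambda>\<xi>. min (infdist p ?F) \<bar>inner (p - \<xi>) (?n \<xi>)\<bar>"
  note n = continuous_on_unit_normal[OF m]
  have D: "continuous_on ?F ?D"
    by (intro continuous_intros n)
  have c: "continuous_on ?F (\<lambda>\<xi>. cmod (cdot (\<xi> - p) (cnj2 (?n \<xi>))))"
    unfolding cdot_def cnj2_def by (auto intro!: continuous_intros n)
  let ?u = "\<lambda>\<xi>. (1 + \<alpha>) * ?D \<xi> - cmod (cdot (\<xi> - p) (cnj2 (?n \<xi>)))"
  let ?v = "\<lambda>\<xi>. \<alpha> * ?D \<xi> - norm (\<xi> - p) ^ 2"
  have "openin (top_of_set ?F) (?F \<inter> (\<lambda>\<xi>. min (?u \<xi>) (?v \<xi>)) -` {0<..})"
    by (rule continuous_openin_preimage_gen) (auto intro!: continuous_intros D c n)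
  moreover have "?F \<inter> (\<lambda>\<xi>. min (?u \<xi>) (?v \<xi>)) -` {0<..} = {\<xi>\<in>?F. p \<in> approach_region m \<alpha> \<xi>}"
    using True m by (auto simp: approach_region_def approach_dist_def infdist_tangent_plane frontier_egg)
  ultimately show ?thesis by simp
next
  case False
  then have "{\<xi>\<in>frontier (egg m). p \<in> approach_region m \<alpha> \<xi>} = {}" by (auto simp: approach_region_def)
  then show ?thesis by (simp only: openin_empty)
qed

text \<open>A superlevel set is a union, possibly uncountable, of the relatively open sets of
  \<open>openin_approach\<close>, hence relatively open. The maximal function is thus lower
  semicontinuous whatever \<open>f\<close> is.\<close>

lemma sets_nt_maximal_greater:
  assumes m: "m \<ge> 1"
  shows "{\<xi>\<in>frontier (egg m). c < nt_maximal m \<alpha> f \<xi>} \<in> sets (restrict_space borel (frontier (egg m)))"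
proof -
  let ?F = "frontier (egg m)"
  have "{\<xi>\<in>?F. c < nt_maximal m \<alpha> f \<xi>}
      = (\<Union>p\<in>{p. c < ennreal (cmod (f p))}. {\<xi>\<in>?F. p \<in> approach_region m \<alpha> \<xi>})"
    by (auto simp: nt_maximal_def less_SUP_iff)
  moreover have "openin (top_of_set ?F) \<dots>" using openin_approach[OF m] by (intro openin_Union) auto
  ultimately have "openin (top_of_set ?F) {\<xi>\<in>?F. c < nt_maximal m \<alpha> f \<xi>}" by simp
  then obtain T where "open T" "{\<xi>\<in>?F. c < nt_maximal m \<alpha> f \<xi>} = ?F \<inter> T"
    unfolding openin_open by blast
  then show ?thesis unfolding sets_restrict_space by (metis borel_open image_eqI)
qed

section \<open>Power series in two variables\<close>

text \<open>Geometric domination makes the family absolutely summable over pairs; its sum can then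
  be computed row by row or along the enumeration \<open>prod_decode\<close>.\<close>

lemma double_sums:
  fixes t :: "nat \<Rightarrow> nat \<Rightarrow> complex"
  assumes xy: "0 \<le> x" "x < 1" "0 \<le> y" "y < 1"
    and t: "\<And>a b. cmod (t a b) \<le> M * (x ^ a * y ^ b)"
    and u: "\<And>a. (\<lambda>b. t a b) sums u a" and S: "u sums S"
  shows "summable (\<lambda>n. cmod (case_prod t (prod_decode n)))"
    and "(\<lambda>n. case_prod t (prod_decode n)) sums S"
proof -
  have M: "M \<ge> 0" using order_trans[OF norm_ge_zero t[of 0 0]] by simp
  have geo: "summable (\<lambda>a. x ^ a)" "summable (\<lambda>b. y ^ b)" using xy by (auto intro: summable_geometric)
  have "(\<lambda>(a, b). M * (x ^ a * y ^ b)) summable_on (UNIV \<times> UNIV)"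
  proof (rule summable_on_SigmaI[where g = "\<lambda>a. M * (x ^ a * (1 / (1 - y)))"])
    fix a
    have "(\<lambda>b. M * (x ^ a * y ^ b)) sums (M * (x ^ a * (1 / (1 - y))))"
      using xy by (intro sums_mult geometric_sums) auto
    then have "((\<lambda>b. M * (x ^ a * y ^ b)) has_sum M * (x ^ a * (1 / (1 - y)))) UNIV"
      using M xy by (intro sums_nonneg_imp_has_sum) auto
    then show "((\<lambda>b. (\<lambda>(a, b). M * (x ^ a * y ^ b)) (a, b)) has_sum M * (x ^ a * (1 / (1 - y)))) UNIV"
      by simp
  next
    have "summable (\<lambda>a. M * (x ^ a * (1 / (1 - y))))" using geo by (intro summable_mult summable_mult2)
    then show "(\<lambda>a. M * (x ^ a * (1 / (1 - y)))) summable_on UNIV"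
      using M xy by (subst summable_on_UNIV_nonneg_real_iff) auto
  qed (use M xy in auto)
  then have abs: "(\<lambda>p. norm (case_prod t p)) summable_on (UNIV \<times> UNIV)"
    by (rule summable_on_comparison_test) (use t in auto)
  have sumb: "summable (\<lambda>b. cmod (t a b))" for a
  proof (rule summable_comparison_test')
    show "summable (\<lambda>b. M * x ^ a * y ^ b)" by (intro summable_mult geo(2))
    show "norm (cmod (t a b)) \<le> M * x ^ a * y ^ b" if "b \<ge> 0" for b
      using t[of a b] by (simp add: mult.assoc)
  qed
  have inner: "((\<lambda>b. case_prod t (a, b)) has_sum u a) UNIV" for a
    using norm_summable_imp_has_sum[OF sumb u] by simp
  have "cmod (u a) \<le> (M * (1 / (1 - y))) * x ^ a" for a
  proof -
    have "cmod (u a) \<le> (\<Sum>b. cmod (t a b))"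
      using summable_norm[OF sumb[of a]] u[of a] by (simp add: sums_iff)
    also have "\<dots> \<le> (\<Sum>b. M * x ^ a * y ^ b)"
    proof (rule suminf_le)
      show "cmod (t a b) \<le> M * x ^ a * y ^ b" for b using t[of a b] by (simp add: mult.assoc)
    qed (intro sumb summable_mult geo(2))+
    also have "\<dots> = (M * (1 / (1 - y))) * x ^ a"
      using xy geo(2) by (subst suminf_mult) (auto simp: suminf_geometric)
    finally show ?thesis .
  qed
  then have "summable (\<lambda>a. cmod (u a))"
    by (intro summable_comparison_test'[OF summable_mult[OF geo(1)], of 0 _ "M * (1 / (1 - y))"]) (simp only: real_norm_def abs_norm_cancel)
  then have "(u has_sum S) UNIV" using S by (rule norm_summable_imp_has_sum)
  then have hs: "(case_prod t has_sum S) (UNIV \<times> UNIV)"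
    by (rule has_sum_SigmaI[OF inner _ abs_summable_summable[OF abs]])
  have bij: "bij_betw prod_decode UNIV (UNIV \<times> UNIV)" by (simp add: bij_prod_decode)
  show "(\<lambda>n. case_prod t (prod_decode n)) sums S"
    using hs has_sum_reindex_bij_betw[OF bij, of "case_prod t" S] by (intro has_sum_imp_sums) simp
  show "summable (\<lambda>n. cmod (case_prod t (prod_decode n)))"
    using abs summable_on_reindex_bij_betw[OF bij, of "\<lambda>p. cmod (case_prod t p)"]
    by (intro summable_on_imp_summable) simp
qed

section \<open>Taylor expansion on polydiscs centred at 0\<close>

text \<open>Multi-indices are coded by one natural number, so that \<open>sums\<close> and the
  exchange of sum and integral apply to a single sequence.\<close>

definition mon :: "nat \<Rightarrow> complex \<times> complex \<Rightarrow> complex" where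
  "mon n p = fst p ^ fst (prod_decode n) * snd p ^ snd (prod_decode n)"

lemma continuous_on_mon [continuous_intros]:
  "continuous_on S f \<Longrightarrow> continuous_on S (\<lambda>x. mon n (f x))"
  unfolding mon_def by (intro continuous_intros)

lemma holomorphic2_on_imp_continuous_on: "f holomorphic2_on U \<Longrightarrow> continuous_on U f"
  unfolding holomorphic2_on_def
  by (metis (no_types, lifting) continuous_at_imp_continuous_on has_derivative_continuous)

lemma holomorphic2_on_slices:
  assumes f: "f holomorphic2_on U"
  shows "(\<And>z. z \<in> A \<Longrightarrow> (z, w) \<in> U) \<Longrightarrow> (\<lambda>z. f (z, w)) holomorphic_on A"
    and "(\<And>z. z \<in> A \<Longrightarrow> (w, z) \<in> U) \<Longrightarrow> (\<lambda>z. f (w, z)) holomorphic_on A"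
proof -
  assume A: "\<And>z. z \<in> A \<Longrightarrow> (z, w) \<in> U"
  show "(\<lambda>z. f (z, w)) holomorphic_on A"
    unfolding holomorphic_on_def
  proof
    fix z assume "z \<in> A"
    then obtain a b where d: "(f has_derivative (\<lambda>(h, k). a * h + b * k)) (at (z, w))"
      using f A unfolding holomorphic2_on_def by blast
    have "((\<lambda>z. (z, w)) has_derivative (\<lambda>h. (h, 0))) (at z)" by (auto intro!: derivative_eq_intros)
    from has_derivative_compose[OF this d] have "((\<lambda>z. f (z, w)) has_field_derivative a) (at z)"
      by (simp add: has_field_derivative_def)
    then show "(\<lambda>z. f (z, w)) field_differentiable (at z within A)"
      using field_differentiable_def field_differentiable_at_within by blast
  qed
next
  assume A: "\<And>z. z \<in> A \<Longrightarrow> (w, z) \<in> U"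
  show "(\<lambda>z. f (w, z)) holomorphic_on A"
    unfolding holomorphic_on_def
  proof
    fix z assume "z \<in> A"
    then obtain a b where d: "(f has_derivative (\<lambda>(h, k). a * h + b * k)) (at (w, z))"
      using f A unfolding holomorphic2_on_def by blast
    have "((\<lambda>z. (w, z)) has_derivative (\<lambda>h. (0, h))) (at z)" by (auto intro!: derivative_eq_intros)
    from has_derivative_compose[OF this d] have "((\<lambda>z. f (w, z)) has_field_derivative b) (at z)"
      by (simp add: has_field_derivative_def)
    then show "(\<lambda>z. f (w, z)) field_differentiable (at z within A)"
      using field_differentiable_def field_differentiable_at_within by blast
  qed
qed

definition coeff1 :: "(complex \<times> complex \<Rightarrow> complex) \<Rightarrow> nat \<Rightarrow> complex \<Rightarrow> complex" where
  "coeff1 f a w = (deriv ^^ a) (\<lambda>z. f (z, w)) 0 / fact a"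

text \<open>Cauchy's inequality and the Taylor series in the first variable. The bound is uniform in
  the parameter \<open>w\<close>, which is what the limit argument and the second expansion rely
  on.\<close>

lemma coeff1_bounds:
  assumes f: "f holomorphic2_on U" and U: "cball 0 r \<times> T \<subseteq> U" and r: "r > 0"
    and M: "\<And>p. p \<in> cball 0 r \<times> T \<Longrightarrow> cmod (f p) \<le> M" and w: "w \<in> T"
  shows "cmod (coeff1 f a w) \<le> M / r ^ a"
    and "cmod z < r \<Longrightarrow> (\<lambda>a. coeff1 f a w * z ^ a) sums f (z, w)"
proof -
  have hol: "(\<lambda>z. f (z, w)) holomorphic_on cball 0 r"
    by (rule holomorphic2_on_slices(1)[OF f]) (use U w in auto)
  have "norm ((deriv ^^ a) (\<lambda>z. f (z, w)) 0) \<le> fact a * M / r ^ a"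
  proof (rule Cauchy_inequality)
    show "(\<lambda>z. f (z, w)) holomorphic_on ball 0 r" using hol by (rule holomorphic_on_subset) auto
    show "continuous_on (cball 0 r) (\<lambda>z. f (z, w))" using hol by (rule holomorphic_on_imp_continuous_on)
    show "cmod (f (x, w)) \<le> M" if "cmod (0 - x) = r" for x using M that w by auto
  qed (fact r)
  then show "cmod (coeff1 f a w) \<le> M / r ^ a"
    by (simp add: coeff1_def norm_divide field_simps)
  assume z: "cmod z < r"
  show "(\<lambda>a. coeff1 f a w * z ^ a) sums f (z, w)"
    using holomorphic_power_series[of "\<lambda>z. f (z, w)" 0 r z] hol z
    by (simp add: coeff1_def holomorphic_on_subset[OF _ ball_subset_cball])
qed

text \<open>The coefficient functions are limits of difference quotients: if the lower ones are
  holomorphic, then so is \<open>(f(h,w) - (\<Sum>k<a. g\<^sub>k(w) h^k)) / h^a\<close>, which tends to \<open>g\<^sub>a(w)\<close> uniformly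
  as \<open>h \<rightarrow> 0\<close>.\<close>

lemma holomorphic_coeff1:
  assumes f: "f holomorphic2_on U" and U: "cball 0 r \<times> T \<subseteq> U" and r: "r > 0" and T: "open T"
    and M: "\<And>p. p \<in> cball 0 r \<times> T \<Longrightarrow> cmod (f p) \<le> M"
  shows "coeff1 f a holomorphic_on T"
proof (induction a rule: less_induct)
  case (less a)
  note bd = coeff1_bounds[OF f U r M]
  \<comment> \<open>Since |h n| \<le> r/2, the tail of the series is dominated by a geometric series
    of ratio 1/2; its sum 2 cancels the 2 in this denominator.\<close>
  define h where "h n = complex_of_real (r / (2 * real (Suc n)))" for n
  have h: "h n \<noteq> 0" "cmod (h n) \<le> r / 2" "cmod (h n) < r" for n
  proof -
    show "h n \<noteq> 0" using r by (simp add: h_def del: of_nat_Suc)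
    have "r / (2 * real (Suc n)) \<le> r / 2" using r by (intro divide_left_mono) auto
    then show "cmod (h n) \<le> r / 2" using r by (simp add: h_def del: of_nat_Suc of_real_divide)
    then show "cmod (h n) < r" using r by simp
  qed
  define q where "q n w = (f (h n, w) - (\<Sum>k<a. coeff1 f k w * h n ^ k)) / h n ^ a" for n w
  have hq: "q n holomorphic_on T" for n
    unfolding q_def using h[of n] U
    by (intro holomorphic_intros holomorphic2_on_slices(2)[OF f] less.IH) auto
  have est: "cmod (q n w - coeff1 f a w) \<le> M / r ^ a / real (Suc n)" if w: "w \<in> T" for n w
  proof -
    let ?s = "cmod (h n) / r"
    have s: "0 \<le> ?s" "?s \<le> 1 / 2" using h(2)[of n] r by (auto simp: field_simps)
    have M0: "M \<ge> 0" using order_trans[OF norm_ge_zero bd(1)[OF _ w, of 0]] by simp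
    have "(\<lambda>k. coeff1 f (k + a) w * h n ^ (k + a)) sums (f (h n, w) - (\<Sum>k<a. coeff1 f k w * h n ^ k))"
      using bd(2)[OF _ w h(3)] by (intro sums_split_initial_segment) auto
    then have "(\<lambda>k. coeff1 f (k + a) w * h n ^ (k + a) / h n ^ a) sums q n w"
      unfolding q_def by (rule sums_divide)
    then have "(\<lambda>k. coeff1 f (k + a) w * h n ^ k) sums q n w"
      using h(1)[of n] by (simp add: power_add)
    then have sm: "(\<lambda>k. coeff1 f (Suc k + a) w * h n ^ Suc k) sums (q n w - coeff1 f a w)"
      by (subst sums_Suc_iff) simp
    have bdk: "cmod (coeff1 f (Suc k + a) w * h n ^ Suc k) \<le> M / r ^ a * ?s * (1 / 2) ^ k" for k
    proof -
      have "cmod (coeff1 f (Suc k + a) w * h n ^ Suc k) \<le> M / r ^ (Suc k + a) * cmod (h n) ^ Suc k"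
        unfolding norm_mult norm_power by (intro mult_right_mono bd(1) w) auto
      also have "\<dots> = M / r ^ a * ?s * ?s ^ k" using r by (simp add: power_add field_simps)
      also have "\<dots> \<le> M / r ^ a * ?s * (1 / 2) ^ k"
        using s r M0 by (intro mult_left_mono power_mono mult_nonneg_nonneg divide_nonneg_nonneg) auto
      finally show ?thesis .
    qed
    have half: "summable (\<lambda>k. M / r ^ a * ?s * (1 / 2) ^ k)" by (intro summable_mult summable_geometric) auto
    have nsum: "summable (\<lambda>k. cmod (coeff1 f (Suc k + a) w * h n ^ Suc k))"
      by (rule summable_comparison_test'[OF half, of 0]) (use bdk in auto)
    have "cmod (q n w - coeff1 f a w) \<le> (\<Sum>k. cmod (coeff1 f (Suc k + a) w * h n ^ Suc k))"
      using summable_norm[OF nsum] sm by (simp add: sums_iff)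
    also have "\<dots> \<le> (\<Sum>k. M / r ^ a * ?s * (1 / 2) ^ k)"
      by (rule suminf_le[OF bdk nsum half])
    also have "\<dots> = M / r ^ a * ?s * 2" by (subst suminf_mult) (auto simp: suminf_geometric)
    also have "\<dots> = M / r ^ a / real (Suc n)" using r by (simp add: h_def norm_divide norm_mult del: of_nat_Suc)
    finally show ?thesis .
  qed
  have ul: "uniform_limit T q (coeff1 f a) sequentially"
    unfolding uniform_limit_sequentially_iff
  proof (intro allI impI)
    fix e :: real assume e: "e > 0"
    have "(\<lambda>n. M / r ^ a / real (Suc n)) \<longlonglongrightarrow> 0"
      using tendsto_mult_right_zero[OF LIMSEQ_inverse_real_of_nat, of "M / r ^ a"] by (simp add: divide_inverse)
    then have "\<forall>\<^sub>F n in sequentially. M / r ^ a / real (Suc n) < e" using e by (rule order_tendstoD)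
    then obtain N where "\<And>n. n \<ge> N \<Longrightarrow> M / r ^ a / real (Suc n) < e" unfolding eventually_sequentially by blast
    then show "\<exists>N. \<forall>n\<ge>N. \<forall>x\<in>T. dist (q n x) (coeff1 f a x) < e"
      using est by (intro exI[of _ N]) (auto simp: dist_norm intro: le_less_trans)
  qed
  show ?case
  proof (rule holomorphic_uniform_sequence[OF T hq])
    fix x assume "x \<in> T"
    then obtain d where "d > 0" "cball x d \<subseteq> T" using T open_contains_cball by blast
    then show "\<exists>d. 0 < d \<and> cball x d \<subseteq> T \<and> uniform_limit (cball x d) q (coeff1 f a) sequentially"
      using uniform_limit_on_subset[OF ul] by blast
  qed
qed

text \<open>The series in \<open>z\<close> has coefficients that are holomorphic in
  \<open>w\<close>; each is expanded in turn. The numbers \<open>c n\<close> involve only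
  derivatives at 0, not the radii, so different polydiscs give the same coefficients.\<close>

lemma polydisc_expansion:
  assumes f: "f holomorphic2_on U" and U: "cball 0 r1 \<times> cball 0 r2 \<subseteq> U" and r: "r1 > 0" "r2 > 0"
    and p: "cmod z < r1" "cmod w < r2"
  defines "c \<equiv> \<lambda>n. case prod_decode n of (a, b) \<Rightarrow> (deriv ^^ b) (coeff1 f a) 0 / fact b"
  shows "summable (\<lambda>n. cmod (c n * mon n (z, w)))" and "(\<lambda>n. c n * mon n (z, w)) sums f (z, w)"
proof -
  have "continuous_on (cball 0 r1 \<times> cball 0 r2) f"
    using holomorphic2_on_imp_continuous_on[OF f] U by (rule continuous_on_subset)
  then have "compact (f ` (cball 0 r1 \<times> cball 0 r2))"
    by (intro compact_continuous_image compact_Times) auto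
  then obtain M where M: "\<And>p. p \<in> cball 0 r1 \<times> cball 0 r2 \<Longrightarrow> cmod (f p) \<le> M"
    by (meson bounded_iff compact_imp_bounded imageI)
  note bd = coeff1_bounds[OF f U r(1) M]
  \<comment> \<open>\<open>coeff1 f a\<close> is known to be holomorphic only on the open disc of
    radius r2, whereas Cauchy's inequality is used on a closed disc.\<close>
  obtain s where s: "cmod w < s" "s < r2" using p(2) dense by blast
  then have s0: "s > 0" using norm_ge_zero[of w] by linarith
  have hol: "coeff1 f a holomorphic_on ball 0 r2" for a
    by (rule holomorphic_coeff1[OF f _ r(1) _ M]) (use U in auto)
  define d where "d a b = (deriv ^^ b) (coeff1 f a) 0 / fact b" for a b
  define t where "t a b = d a b * (z ^ a * w ^ b)" for a b
  have t: "cmod (t a b) \<le> M * ((cmod z / r1) ^ a * (cmod w / s) ^ b)" for a b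
  proof -
    have "norm ((deriv ^^ b) (coeff1 f a) 0) \<le> fact b * (M / r1 ^ a) / s ^ b"
    proof (rule Cauchy_inequality)
      show "coeff1 f a holomorphic_on ball 0 s" using hol by (rule holomorphic_on_subset) (use s in auto)
      have "coeff1 f a holomorphic_on cball 0 s" using hol by (rule holomorphic_on_subset) (use s in auto)
      then show "continuous_on (cball 0 s) (coeff1 f a)" by (rule holomorphic_on_imp_continuous_on)
      show "cmod (coeff1 f a x) \<le> M / r1 ^ a" if "cmod (0 - x) = s" for x
        using bd(1) that s by simp
    qed (fact s0)
    then have "cmod (d a b) \<le> M / r1 ^ a / s ^ b" by (simp add: d_def norm_divide field_simps)
    then have "cmod (t a b) \<le> M / r1 ^ a / s ^ b * (cmod z ^ a * cmod w ^ b)"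
      unfolding t_def norm_mult norm_power by (intro mult_right_mono) auto
    then show ?thesis by (simp add: power_divide)
  qed
  have u: "(\<lambda>b. t a b) sums (coeff1 f a w * z ^ a)" for a
  proof -
    have "(\<lambda>b. d a b * w ^ b) sums coeff1 f a w"
      using holomorphic_power_series[OF hol, of w a] p unfolding d_def by simp
    from sums_mult2[OF this, of "z ^ a"] show ?thesis by (simp add: t_def mult_ac)
  qed
  have S: "(\<lambda>a. coeff1 f a w * z ^ a) sums f (z, w)"
    by (rule bd(2)) (use p in auto)
  have xy: "0 \<le> cmod z / r1" "cmod z / r1 < 1" "0 \<le> cmod w / s" "cmod w / s < 1"
    using p r s s0 by auto
  have eq: "case_prod t (prod_decode n) = c n * mon n (z, w)" for n
    by (simp add: c_def t_def d_def mon_def split: prod.split)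
  show "summable (\<lambda>n. cmod (c n * mon n (z, w)))" "(\<lambda>n. c n * mon n (z, w)) sums f (z, w)"
    using double_sums[OF xy t u S] by (simp_all add: eq)
qed

section \<open>Sums of power series are holomorphic\<close>

text \<open>The common summable majorant makes the partial sums of the derivatives converge
  uniformly as linear maps; each of the two coordinates receives half of the error.\<close>

lemma series_has_derivative2:
  fixes F :: "nat \<Rightarrow> complex \<times> complex \<Rightarrow> complex"
  assumes S: "convex S" "open S"
    and D: "\<And>n p. p \<in> S \<Longrightarrow> (F n has_derivative (\<lambda>(h, k). A n p * h + B n p * k)) (at p)"
    and bd: "\<And>n p. p \<in> S \<Longrightarrow> cmod (A n p) \<le> M n" "\<And>n p. p \<in> S \<Longrightarrow> cmod (B n p) \<le> M n"
    and M: "summable M" and F: "\<And>p. p \<in> S \<Longrightarrow> summable (\<lambda>n. F n p)" and p: "p \<in> S"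
  shows "((\<lambda>p. \<Sum>n. F n p) has_derivative (\<lambda>(h, k). (\<Sum>n. A n p) * h + (\<Sum>n. B n p) * k)) (at p)"
proof -
  have sA: "summable (\<lambda>n. A n p)" and sB: "summable (\<lambda>n. B n p)" if "p \<in> S" for p
    by (rule summable_comparison_test'[OF M, of 0], use bd that in blast)+
  have "\<exists>g. \<forall>p\<in>S. (\<lambda>n. F n p) sums g p \<and>
      (g has_derivative (\<lambda>(h, k). (\<Sum>n. A n p) * h + (\<Sum>n. B n p) * k)) (at p within S)"
  proof (rule has_derivative_series[OF S(1)])
    show "(F n has_derivative (\<lambda>(h, k). A n p * h + B n p * k)) (at p within S)" if "p \<in> S" for n p
      using D[OF that] by (rule has_derivative_at_withinI)
    show "p \<in> S" by (fact p)
    show "(\<lambda>n. F n p) sums (\<Sum>n. F n p)" using F[OF p] by (rule summable_sums)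
    fix e :: real assume e: "e > 0"
    have "(\<lambda>N. \<Sum>n. M (n + N)) \<longlonglongrightarrow> 0" using M by (rule suminf_exist_split2)
    then have "\<forall>\<^sub>F N in sequentially. (\<Sum>n. M (n + N)) < e / 2" using e by (intro order_tendstoD) auto
    then show "\<forall>\<^sub>F N in sequentially. \<forall>p\<in>S. \<forall>h. norm ((\<Sum>n<N. (\<lambda>(h, k). A n p * h + B n p * k) h) -
        (\<lambda>(h, k). (\<Sum>n. A n p) * h + (\<Sum>n. B n p) * k) h) \<le> e * norm h"
    proof eventually_elim
      case (elim N)
      show ?case
      proof (intro ballI allI)
        fix p h' :: "complex \<times> complex" assume p: "p \<in> S"
        obtain h k where h': "h' = (h, k)" by (cases h')
        have tail: "cmod ((\<Sum>n<N. X n) - (\<Sum>n. X n)) \<le> e / 2"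
          if X: "\<And>n. cmod (X n) \<le> M n" for X
        proof -
          have sX: "summable X" using summable_comparison_test'[OF M, of 0 X] X by blast
          have sn: "summable (\<lambda>n. cmod (X (n + N)))"
            using summable_comparison_test'[OF summable_ignore_initial_segment[OF M, of N], of 0 "\<lambda>n. cmod (X (n + N))"] X by simp
          have "(\<Sum>n. X n) = (\<Sum>n. X (n + N)) + (\<Sum>n<N. X n)" by (rule suminf_split_initial_segment[OF sX])
          then have "cmod ((\<Sum>n<N. X n) - (\<Sum>n. X n)) = cmod (\<Sum>n. X (n + N))"
            by (simp add: norm_minus_commute)
          also have "\<dots> \<le> (\<Sum>n. cmod (X (n + N)))" by (rule summable_norm[OF sn])
          also have "\<dots> \<le> (\<Sum>n. M (n + N))"
            by (rule suminf_le[OF X sn summable_ignore_initial_segment[OF M]])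
          finally show ?thesis using elim by simp
        qed
        have hk: "cmod h \<le> norm h'" "cmod k \<le> norm h'" using norm_fst_le[of h k] norm_snd_le[of k h] by (auto simp: h')
        have "(\<Sum>n<N. (\<lambda>(h, k). A n p * h + B n p * k) h') - (\<lambda>(h, k). (\<Sum>n. A n p) * h + (\<Sum>n. B n p) * k) h'
          = ((\<Sum>n<N. A n p) - (\<Sum>n. A n p)) * h + ((\<Sum>n<N. B n p) - (\<Sum>n. B n p)) * k"
          unfolding h' prod.case sum.distrib sum_distrib_right[symmetric] by (simp add: algebra_simps)
        also have "cmod \<dots> \<le> cmod ((\<Sum>n<N. A n p) - (\<Sum>n. A n p)) * cmod h + cmod ((\<Sum>n<N. B n p) - (\<Sum>n. B n p)) * cmod k"
          unfolding norm_mult[symmetric] by (rule norm_triangle_ineq)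
        also have "\<dots> \<le> e / 2 * norm h' + e / 2 * norm h'"
          using e by (intro add_mono mult_mono tail hk bd p) auto
        finally show "norm ((\<Sum>n<N. (\<lambda>(h, k). A n p * h + B n p * k) h') -
          (\<lambda>(h, k). (\<Sum>n. A n p) * h + (\<Sum>n. B n p) * k) h') \<le> e * norm h'" by simp
      qed
    qed
  qed
  then obtain g where g: "\<And>p. p \<in> S \<Longrightarrow> (\<lambda>n. F n p) sums g p"
    "(g has_derivative (\<lambda>(h, k). (\<Sum>n. A n p) * h + (\<Sum>n. B n p) * k)) (at p within S)" using p by blast
  have "(g has_derivative (\<lambda>(h, k). (\<Sum>n. A n p) * h + (\<Sum>n. B n p) * k)) (at p)"
    using g(2) at_within_open[OF p S(2)] by simp
  then show ?thesis
    by (rule has_derivative_transform_within_open[OF _ S(2) p]) (use g(1) sums_unique in blast)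
qed

text \<open>Bernoulli's inequality for (R/r)^a. It bounds the derivative of a monomial on a smaller
  disc by the monomial on a larger one, at the price of a factor independent of the degree.\<close>

lemma of_nat_mult_power_le:
  fixes r R :: real
  assumes "0 < r" "r < R"
  shows "real a * r ^ (a - 1) \<le> R ^ a / (R - r)"
proof (cases a)
  case 0
  then show ?thesis using assms by simp
next
  case (Suc b)
  have "1 + real a * (R / r - 1) \<le> (1 + (R / r - 1)) ^ a"
    using assms by (intro Bernoulli_inequality) (simp add: field_simps)
  then have "real a * (R / r - 1) \<le> (R / r) ^ a" by simp
  then have "real a * (R / r - 1) * r ^ a \<le> (R / r) ^ a * r ^ a" using assms by (intro mult_right_mono) auto
  also have "(R / r) ^ a * r ^ a = R ^ a" using assms by (simp add: power_divide)
  also have "real a * (R / r - 1) * r ^ a = real a * (R - r) * r ^ (a - 1)"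
    using assms Suc by (simp add: field_simps)
  finally have "real a * (R - r) * r ^ (a - 1) \<le> R ^ a" .
  then show ?thesis using assms by (simp add: field_simps)
qed

text \<open>Absolute convergence at the one real point (R1, R2) dominates the series on the polydisc
  with these radii. The differentiated series are dominated on the slightly smaller radii r1, r2, up
  to the constant \<open>C\<close>.\<close>

lemma power_series_holomorphic2:
  fixes c :: "nat \<Rightarrow> complex"
  assumes V: "open V"
    and dom: "\<And>p. p \<in> V \<Longrightarrow> \<exists>R1 R2. cmod (fst p) < R1 \<and> cmod (snd p) < R2 \<and>
      summable (\<lambda>n. cmod (c n) * cmod (mon n (complex_of_real R1, complex_of_real R2)))"
  shows "(\<lambda>p. \<Sum>n. c n * mon n p) holomorphic2_on V"
  unfolding holomorphic2_on_def
proof (intro conjI ballI V)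
  fix p assume "p \<in> V"
  then obtain R1 R2 where R: "cmod (fst p) < R1" "cmod (snd p) < R2"
    and sm: "summable (\<lambda>n. cmod (c n) * cmod (mon n (complex_of_real R1, complex_of_real R2)))"
    using dom by blast
  obtain r1 r2 where r: "cmod (fst p) < r1" "r1 < R1" "cmod (snd p) < r2" "r2 < R2"
    using R dense by metis
  have r0: "0 < r1" "0 < r2" using r norm_ge_zero[of "fst p"] norm_ge_zero[of "snd p"] by linarith+
  have R0: "0 < R1" "0 < R2" using r r0 by linarith+
  define A where "A n q = c n * (of_nat (fst (prod_decode n)) * fst q ^ (fst (prod_decode n) - 1) * snd q ^ snd (prod_decode n))" for n q
  define B where "B n q = c n * (fst q ^ fst (prod_decode n) * (of_nat (snd (prod_decode n)) * snd q ^ (snd (prod_decode n) - 1)))" for n q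
  define M0 where "M0 n = cmod (c n) * cmod (mon n (complex_of_real R1, complex_of_real R2))" for n
  have M0: "M0 n = cmod (c n) * (R1 ^ fst (prod_decode n) * R2 ^ snd (prod_decode n))" for n
    using R0 by (simp add: M0_def mon_def norm_mult norm_power)
  define C where "C = 1 / (R1 - r1) + 1 / (R2 - r2)"
  have C: "1 / (R1 - r1) \<le> C" "1 / (R2 - r2) \<le> C" using r by (auto simp: C_def)
  let ?S = "ball (0::complex) r1 \<times> ball (0::complex) r2"
  have "((\<lambda>p. \<Sum>n. c n * mon n p) has_derivative (\<lambda>(h, k). (\<Sum>n. A n p) * h + (\<Sum>n. B n p) * k)) (at p)"
  proof (rule series_has_derivative2)
    show "convex ?S" "open ?S" by (auto intro: convex_Times open_Times)
    show "p \<in> ?S" using r by (simp add: mem_Times_iff)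
    show "summable (\<lambda>n. C * M0 n)" unfolding M0_def by (intro summable_mult sm)
    fix n and q :: "complex \<times> complex" assume q: "q \<in> ?S"
    let ?a = "fst (prod_decode n)" and ?b = "snd (prod_decode n)"
    have q': "cmod (fst q) \<le> r1" "cmod (snd q) \<le> r2" using q by (auto simp: mem_Times_iff)
    show "((\<lambda>p. c n * mon n p) has_derivative (\<lambda>(h, k). A n q * h + B n q * k)) (at q)"
      unfolding mon_def A_def B_def by (rule derivative_eq_intros refl)+ (auto simp: algebra_simps)
    have "cmod (A n q) = cmod (c n) * (real ?a * cmod (fst q) ^ (?a - 1) * cmod (snd q) ^ ?b)"
      by (simp add: A_def norm_mult norm_power)
    also have "\<dots> \<le> cmod (c n) * (real ?a * r1 ^ (?a - 1) * R2 ^ ?b)"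
      using q' r r0 by (intro mult_left_mono mult_mono power_mono) auto
    also have "\<dots> \<le> cmod (c n) * (R1 ^ ?a * (1 / (R1 - r1)) * R2 ^ ?b)"
      using of_nat_mult_power_le[OF r0(1) r(2), of ?a] R0 by (intro mult_left_mono mult_right_mono) auto
    also have "\<dots> = 1 / (R1 - r1) * M0 n" by (simp add: M0)
    also have "\<dots> \<le> C * M0 n" using C by (intro mult_right_mono) (auto simp: M0_def)
    finally show "cmod (A n q) \<le> C * M0 n" .
    have "cmod (B n q) = cmod (c n) * (cmod (fst q) ^ ?a * (real ?b * cmod (snd q) ^ (?b - 1)))"
      by (simp add: B_def norm_mult norm_power)
    also have "\<dots> \<le> cmod (c n) * (R1 ^ ?a * (real ?b * r2 ^ (?b - 1)))"
      using q' r r0 by (intro mult_left_mono mult_mono power_mono) auto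
    also have "\<dots> \<le> cmod (c n) * (R1 ^ ?a * (R2 ^ ?b * (1 / (R2 - r2))))"
      using of_nat_mult_power_le[OF r0(2) r(4), of ?b] R0 by (intro mult_left_mono) auto
    also have "\<dots> = 1 / (R2 - r2) * M0 n" by (simp add: M0)
    also have "\<dots> \<le> C * M0 n" using C by (intro mult_right_mono) (auto simp: M0_def)
    finally show "cmod (B n q) \<le> C * M0 n" .
  next
    fix q :: "complex \<times> complex" assume q: "q \<in> ?S"
    then have q': "cmod (fst q) \<le> R1" "cmod (snd q) \<le> R2" using r by (auto simp: mem_Times_iff)
    have "norm (c n * mon n q) \<le> M0 n" for n
      unfolding M0 norm_mult mon_def norm_power using q' R0 by (intro mult_left_mono mult_mono power_mono) auto
    then show "summable (\<lambda>n. c n * mon n q)"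
      using summable_comparison_test'[OF sm, of 0 "\<lambda>n. c n * mon n q"] by (simp add: M0_def)
  qed
  then show "\<exists>a b. ((\<lambda>p. \<Sum>n. c n * mon n p) has_derivative (\<lambda>(h, k). a * h + b * k)) (at p)" by blast
qed

section \<open>The Fefferman surface measure\<close>

lemma norm_cis_diff_le: "cmod (cis s - cis t) \<le> \<bar>s - t\<bar>"
proof -
  have "cis s - cis t = cis t * (exp (\<i> * of_real (s - t)) - 1)"
    by (simp add: cis_conv_exp algebra_simps flip: exp_add)
  then have "cmod (cis s - cis t) = 2 * \<bar>sin ((s - t) / 2)\<bar>"
    by (simp only: norm_mult norm_cis dist_exp_i_1)
  also have "\<dots> \<le> 2 * \<bar>(s - t) / 2\<bar>" by (intro mult_left_mono abs_sin_x_le_abs_x) simp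
  finally show ?thesis by simp
qed

lemma polar_dist_le:
  assumes "cmod z' \<le> 1"
  shows "cmod (z - z') \<le> \<bar>cmod z - cmod z'\<bar> + \<bar>Arg z - Arg z'\<bar>"
proof -
  have e: "z = of_real (cmod z) * cis (Arg z)" for z
    using rcis_cmod_Arg[of z] by (simp add: rcis_def)
  have "z - z' = of_real (cmod z - cmod z') * cis (Arg z) + of_real (cmod z') * (cis (Arg z) - cis (Arg z'))"
    by (subst e[of z], subst e[of z']) (simp add: algebra_simps)
  also have "cmod \<dots> \<le> \<bar>cmod z - cmod z'\<bar> * 1 + cmod z' * cmod (cis (Arg z) - cis (Arg z'))"
    by (rule order_trans[OF norm_triangle_ineq]) (simp add: norm_mult del: of_real_diff)
  also have "\<dots> \<le> \<bar>cmod z - cmod z'\<bar> * 1 + 1 * \<bar>Arg z - Arg z'\<bar>"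
    using assms by (intro add_left_mono mult_mono norm_cis_diff_le) auto
  finally show ?thesis by simp
qed

lemma continuous_mon_mon: "continuous_on S (\<lambda>p. mon n p * cnj (mon k p))"
  by (intro continuous_intros)

text \<open>The angle pi / (a - c) turns the (a - c)-th power into -1, also for a < c.\<close>

lemma rotation_sign:
  assumes "a \<noteq> (c::nat)"
  obtains u where "cmod u = 1" "u ^ a * cnj (u ^ c) = -1"
proof
  let ?\<theta> = "pi / (real a - real c)"
  have "(real a - real c) * ?\<theta> = pi" using assms by simp
  then have "real a * ?\<theta> - real c * ?\<theta> = pi" by (simp only: left_diff_distrib)
  then have "cis (real a * ?\<theta>) * cis (- (real c * ?\<theta>)) = -1"
    by (simp add: cis_mult)
  then show "cis ?\<theta> ^ a * cnj (cis ?\<theta> ^ c) = -1"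
    unfolding Complex.DeMoivre cis_cnj .
qed simp

lemma summable_geometric2:
  fixes x y :: real
  assumes "0 \<le> x" "x < 1" "0 \<le> y" "y < 1"
  shows "summable (\<lambda>n. x ^ fst (prod_decode n) * y ^ snd (prod_decode n))"
proof -
  let ?t = "\<lambda>a b. complex_of_real (x ^ a) * complex_of_real y ^ b"
  have "summable (\<lambda>n. cmod (case_prod ?t (prod_decode n)))"
  proof (rule double_sums(1)[OF assms, of _ 1])
    show "cmod (?t a b) \<le> 1 * (x ^ a * y ^ b)" for a b using assms by (simp add: norm_mult norm_power)
    show "(\<lambda>b. ?t a b) sums (complex_of_real x ^ a * (1 / (1 - complex_of_real y)))" for a
      using assms sums_mult[OF geometric_sums[of "complex_of_real y"], of "complex_of_real x ^ a"] by simp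
    show "(\<lambda>a. complex_of_real x ^ a * (1 / (1 - complex_of_real y))) sums (1 / (1 - complex_of_real x) * (1 / (1 - complex_of_real y)))"
      using assms by (intro sums_mult2 geometric_sums) simp
  qed
  then show ?thesis using assms by (simp add: case_prod_unfold norm_mult norm_power)
qed

text \<open>Used to enlarge radii a little without violating a strict inequality.\<close>

lemma exists_pos_less:
  fixes \<phi> :: "real \<Rightarrow> real"
  assumes "isCont \<phi> 0" "\<phi> 0 < 1"
  obtains t where "t > 0" "\<phi> t < 1"
proof -
  have "(\<phi> \<longlongrightarrow> \<phi> 0) (at_right 0)"
    using assms(1) unfolding isCont_def by (rule tendsto_within_subset) simp
  then have "\<forall>\<^sub>F t in at_right 0. \<phi> t < 1" using assms(2) by (rule order_tendstoD)
  then have "\<forall>\<^sub>F t in at_right 0. \<phi> t < 1 \<and> t > 0"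
    using eventually_at_right_less by (rule eventually_conj)
  then show ?thesis using eventually_happens'[of "at_right (0::real)"] that by auto
qed

lemma exists_larger:
  assumes "x + y ^ m < (1::real)"
  obtains X Y where "X > x" "Y > y" "X + Y ^ m < 1"
proof -
  obtain t where "t > 0" "(x + t) + (y + t) ^ m < 1"
    by (rule exists_pos_less[of "\<lambda>t. (x + t) + (y + t) ^ m"]) (use assms in \<open>auto intro!: continuous_intros\<close>)
  then show ?thesis using that[of "x + t" "y + t"] by simp
qed

context
  fixes m :: nat
  assumes m: "m \<ge> 1"
begin

lemma borel_frontier [simp]: "frontier (egg m) \<in> sets borel"
  using compact_frontier_egg[OF m] by (simp add: borel_compact)

lemma space_fefferman [simp]: "space (fefferman_surface m) = frontier (egg m)"
  by (simp add: fefferman_surface_def euclidean_surface_def space_restrict_space)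

lemma sets_fefferman [measurable_cong]:
  "sets (fefferman_surface m) = sets (restrict_space borel (frontier (egg m)))"
  by (simp add: fefferman_surface_def euclidean_surface_def sets_restrict_space)

lemma sets_euclidean_surface:
  "sets (euclidean_surface m) = sets (restrict_space borel (frontier (egg m)))"
  by (simp add: euclidean_surface_def sets_restrict_space)

lemma measurable_fefferman_continuous:
  assumes "continuous_on (frontier (egg m)) f"
  shows "f \<in> borel_measurable (fefferman_surface m)"
  using borel_measurable_continuous_on_restrict[OF assms] by (simp cong: measurable_cong_sets add: sets_fefferman)

lemma fefferman_weight_frontier:
  assumes "p \<in> frontier (egg m)"
  shows "fefferman_weight m p = (real m ^ 2 * cmod (snd p) ^ (2 * m - 2)) powr (1 / 3) /
    sqrt (cmod (fst p) ^ 2 + real m ^ 2 * cmod (snd p) ^ (4 * m - 2))"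
  using fefferman_weight_explicit[OF m, of "fst p" "snd p"] assms by (simp add: frontier_egg[OF m])

lemma weight_denominator_pos:
  assumes "p \<in> frontier (egg m)"
  shows "cmod (fst p) ^ 2 + real m ^ 2 * cmod (snd p) ^ (4 * m - 2) > 0"
proof -
  have r: "cmod (fst p) ^ 2 + cmod (snd p) ^ (2 * m) = 1"
    using assms by (simp add: frontier_egg[OF m] rho_eq)
  show ?thesis
  proof (cases "fst p = 0")
    case True
    then have "snd p \<noteq> 0" using r m by (auto simp: power_0_left)
    then have "real m ^ 2 * cmod (snd p) ^ (4 * m - 2) > 0" using m by simp
    then show ?thesis by (simp add: add_nonneg_pos)
  next
    case False
    then show ?thesis by (simp add: add_pos_nonneg)
  qed
qed

text \<open>For m > 1 the base of \<open>powr\<close> vanishes where w = 0; continuity there rests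
  on the exponent 1/3 being positive.\<close>

lemma continuous_on_weight: "continuous_on (frontier (egg m)) (fefferman_weight m)"
proof -
  have "continuous_on (frontier (egg m)) (\<lambda>p. (real m ^ 2 * cmod (snd p) ^ (2 * m - 2)) powr (1 / 3) /
    sqrt (cmod (fst p) ^ 2 + real m ^ 2 * cmod (snd p) ^ (4 * m - 2)))"
    using weight_denominator_pos by (intro continuous_intros continuous_on_powr') (auto simp: less_imp_neq[symmetric])
  then show ?thesis by (rule continuous_on_eq) (simp add: fefferman_weight_frontier)
qed

lemma fefferman_weight_nonneg: "fefferman_weight m p \<ge> 0"
  unfolding fefferman_weight_def by simp

lemma fefferman_weight_pos:
  assumes "p \<in> frontier (egg m)" "snd p \<noteq> 0"
  shows "fefferman_weight m p > 0"
  unfolding fefferman_weight_frontier[OF assms(1)]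
  using weight_denominator_pos[OF assms(1)] assms(2) m by (intro divide_pos_pos) auto

lemma measurable_weight [measurable]: "fefferman_weight m \<in> borel_measurable (euclidean_surface m)"
  using borel_measurable_continuous_on_restrict[OF continuous_on_weight]
  by (simp cong: measurable_cong_sets add: sets_euclidean_surface)

lemma emeasure_euclidean_surface:
  assumes "A \<in> sets borel" "A \<subseteq> frontier (egg m)"
  shows "emeasure (euclidean_surface m) A = hausdorff_outer 3 A"
  unfolding euclidean_surface_def using assms
  by (subst emeasure_restrict_space) (auto simp: emeasure_hausdorff)

text \<open>Along the curve \<open>r\<^sup>2 + s\<^bsup>2m\<^esup> = 1\<close> in the quadrant, \<open>r\<close> decreases as \<open>s\<close> increases, so
  \<open>s - r\<close> is a chart with Lipschitz inverse even where the curve is not a smooth graph.\<close>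

lemma hausdorff_frontier_finite: "hausdorff_outer 3 (frontier (egg m)) < top"
proof (rule hausdorff_outer_chart)
  let ?g1 = "\<lambda>p::complex \<times> complex. (cmod (snd p) - cmod (fst p) + 1) / 2"
  let ?g2 = "\<lambda>p::complex \<times> complex. (Arg (fst p) + pi) / (2 * pi)"
  let ?g3 = "\<lambda>p::complex \<times> complex. (Arg (snd p) + pi) / (2 * pi)"
  show "0 \<le> 2 * pi" by simp
  fix p assume p: "p \<in> frontier (egg m)"
  then have pr: "rho m p = 0" by (simp add: frontier_egg[OF m])
  have pb: "cmod (fst p) \<le> 1" "cmod (snd p) \<le> 1" using rho_le_0_bounds[OF m, of p] pr by auto
  show "?g1 p \<in> {0..1} \<and> ?g2 p \<in> {0..1} \<and> ?g3 p \<in> {0..1}"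
  proof -
    have "- pi < Arg z" "Arg z \<le> pi" for z using Arg_bounded[of z] by auto
    note a = this[of "fst p"] this[of "snd p"]
    have "cmod (fst p) \<le> 1 + cmod (snd p)" "cmod (snd p) \<le> 1 + cmod (fst p)"
      using pb norm_ge_zero[of "fst p"] norm_ge_zero[of "snd p"] by linarith+
    then show ?thesis using a pb pi_gt_zero by (auto simp: field_simps)
  qed
  fix q assume q: "q \<in> frontier (egg m)"
  then have qr: "rho m q = 0" by (simp add: frontier_egg[OF m])
  have qb: "cmod (fst q) \<le> 1" "cmod (snd q) \<le> 1" using rho_le_0_bounds[OF m, of q] qr by auto
  have mono: "cmod (fst b) \<le> cmod (fst a)"
    if "rho m a = 0" "rho m b = 0" "cmod (snd a) \<le> cmod (snd b)" for a b
  proof -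
    have "cmod (snd a) ^ (2 * m) \<le> cmod (snd b) ^ (2 * m)" using that by (intro power_mono) auto
    then have "cmod (fst b) ^ 2 \<le> cmod (fst a) ^ 2" using that unfolding rho_eq by linarith
    then show ?thesis by (rule power2_le_imp_le) simp
  qed
  \<comment> \<open>Along the curve the increments of the two moduli have opposite signs, so their
    absolute values add up to the increment of the difference.\<close>
  have mod: "\<bar>cmod (fst p) - cmod (fst q)\<bar> + \<bar>cmod (snd p) - cmod (snd q)\<bar> = 2 * \<bar>?g1 p - ?g1 q\<bar>"
    using mono[OF pr qr] mono[OF qr pr] by (cases "cmod (snd p) \<le> cmod (snd q)") (auto simp: abs_if field_simps)
  have ang: "\<bar>Arg a - Arg b\<bar> = 2 * pi * \<bar>(Arg a + pi) / (2 * pi) - (Arg b + pi) / (2 * pi)\<bar>" for a b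
    by (simp add: diff_divide_distrib[symmetric] abs_divide)
  have "dist p q \<le> cmod (fst p - fst q) + cmod (snd p - snd q)"
    using norm_Pair_le[of "fst p - fst q" "snd p - snd q"] by (simp add: dist_norm minus_prod_def)
  also have "\<dots> \<le> (\<bar>cmod (fst p) - cmod (fst q)\<bar> + \<bar>Arg (fst p) - Arg (fst q)\<bar>)
      + (\<bar>cmod (snd p) - cmod (snd q)\<bar> + \<bar>Arg (snd p) - Arg (snd q)\<bar>)"
    by (intro add_mono polar_dist_le qb)
  also have "\<dots> = 2 * \<bar>?g1 p - ?g1 q\<bar> + 2 * pi * \<bar>?g2 p - ?g2 q\<bar> + 2 * pi * \<bar>?g3 p - ?g3 q\<bar>"
    using mod ang[of "fst p" "fst q"] ang[of "snd p" "snd q"] by linarith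
  also have "\<dots> \<le> 2 * pi * \<bar>?g1 p - ?g1 q\<bar> + 2 * pi * \<bar>?g2 p - ?g2 q\<bar> + 2 * pi * \<bar>?g3 p - ?g3 q\<bar>"
    using pi_gt3 by (intro add_right_mono mult_right_mono) auto
  finally show "dist p q \<le> 2 * pi * (\<bar>?g1 p - ?g1 q\<bar> + \<bar>?g2 p - ?g2 q\<bar> + \<bar>?g3 p - ?g3 q\<bar>)"
    by (simp only: distrib_left)
qed

lemma finite_measure_fefferman: "finite_measure (fefferman_surface m)"
proof (rule finite_measureI)
  let ?F = "frontier (egg m)"
  obtain K where K: "\<And>p. p \<in> ?F \<Longrightarrow> fefferman_weight m p \<le> K"
  proof -
    have "compact (fefferman_weight m ` ?F)"
      using continuous_on_weight compact_frontier_egg[OF m] by (rule compact_continuous_image)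
    then have "bounded (fefferman_weight m ` ?F)" by (rule compact_imp_bounded)
    then show ?thesis using that unfolding bounded_iff by (metis abs_le_D1 imageI real_norm_def)
  qed
  have "emeasure (fefferman_surface m) ?F = (\<integral>\<^sup>+p. ennreal (fefferman_weight m p) * indicator ?F p \<partial>euclidean_surface m)"
    unfolding fefferman_surface_def
    by (rule emeasure_density) (auto simp: sets_euclidean_surface sets_restrict_space intro!: image_eqI[of _ _ UNIV])
  also have "\<dots> \<le> (\<integral>\<^sup>+p. ennreal K \<partial>euclidean_surface m)"
    using K by (intro nn_integral_mono) (auto intro: ennreal_leI split: split_indicator)
  also have "\<dots> = ennreal K * hausdorff_outer 3 ?F"
    using emeasure_euclidean_surface[of ?F] by (simp add: euclidean_surface_def space_restrict_space)
  also have "\<dots> < top" using hausdorff_frontier_finite by (simp add: ennreal_mult_less_top)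
  finally show "emeasure (fefferman_surface m) (space (fefferman_surface m)) \<noteq> \<infinity>" by simp
qed

lemma integrable_fefferman_continuous:
  fixes f :: "complex \<times> complex \<Rightarrow> 'b::{banach, second_countable_topology}"
  assumes "continuous_on (frontier (egg m)) f"
  shows "integrable (fefferman_surface m) f"
proof -
  have "bounded (f ` frontier (egg m))"
    using assms compact_frontier_egg[OF m] by (intro compact_imp_bounded compact_continuous_image)
  then obtain B where "\<And>p. p \<in> frontier (egg m) \<Longrightarrow> norm (f p) \<le> B" unfolding bounded_iff by auto
  then show ?thesis
    by (intro finite_measure.integrable_const_bound[OF finite_measure_fefferman, of _ B] AE_I2
        measurable_fefferman_continuous assms) simp
qed

section \<open>Torus invariance and orthogonality of the monomials\<close>

text \<open>Invariance under isometries is available for Hausdorff measure on the whole space, so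
  boundary integrals are transferred there with an indicator and the weight.\<close>

lemma integral_fefferman:
  fixes g :: "complex \<times> complex \<Rightarrow> 'b::{banach, second_countable_topology}"
  assumes g: "continuous_on (frontier (egg m)) g"
  shows "(\<lambda>p. indicator (frontier (egg m)) p *\<^sub>R (fefferman_weight m p *\<^sub>R g p)) \<in> borel_measurable borel"
    and "(\<integral>p. g p \<partial>fefferman_surface m) =
      (\<integral>p. indicator (frontier (egg m)) p *\<^sub>R (fefferman_weight m p *\<^sub>R g p) \<partial>hausdorff_measure 3)"
proof -
  have c: "continuous_on (frontier (egg m)) (\<lambda>p. fefferman_weight m p *\<^sub>R g p)"
    by (intro continuous_intros continuous_on_weight g)
  show "(\<lambda>p. indicator (frontier (egg m)) p *\<^sub>R (fefferman_weight m p *\<^sub>R g p)) \<in> borel_measurable borel"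
    using borel_measurable_continuous_on_restrict[OF c] by (subst (asm) borel_measurable_restrict_space_iff) auto
  have "g \<in> borel_measurable (euclidean_surface m)"
    using borel_measurable_continuous_on_restrict[OF g]
    by (simp cong: measurable_cong_sets add: sets_euclidean_surface)
  then have "(\<integral>p. g p \<partial>fefferman_surface m) = (\<integral>p. fefferman_weight m p *\<^sub>R g p \<partial>euclidean_surface m)"
    unfolding fefferman_surface_def by (intro integral_density) (auto simp: fefferman_weight_nonneg)
  also have "\<dots> = (\<integral>p. indicator (frontier (egg m)) p *\<^sub>R (fefferman_weight m p *\<^sub>R g p) \<partial>hausdorff_measure 3)"
    unfolding euclidean_surface_def by (rule integral_restrict_space) simp
  finally show "(\<integral>p. g p \<partial>fefferman_surface m) = \<dots>" .
qed

lemma integral_fefferman_rotate: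
  fixes g :: "complex \<times> complex \<Rightarrow> complex"
  assumes g: "continuous_on (frontier (egg m)) g" and u: "cmod u = 1" "cmod v = 1"
  shows "(\<integral>p. g (u * fst p, v * snd p) \<partial>fefferman_surface m) = (\<integral>p. g p \<partial>fefferman_surface m)"
proof -
  define T where "T p = (u * fst p, v * snd p)" for p :: "complex \<times> complex"
  let ?F = "frontier (egg m)"
  let ?G = "\<lambda>p. indicator ?F p *\<^sub>R (fefferman_weight m p *\<^sub>R g p)"
  have TF: "T p \<in> ?F \<longleftrightarrow> p \<in> ?F" for p
    by (simp add: frontier_egg[OF m] rho_eq T_def norm_mult u)
  have Tw: "fefferman_weight m (T p) = fefferman_weight m p" if "p \<in> ?F" for p
  proof -
    have "T p \<in> ?F" using that by (simp add: TF)
    from fefferman_weight_frontier[OF this] fefferman_weight_frontier[OF that] show ?thesis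
      by (simp add: T_def norm_mult u)
  qed
  have Tc: "continuous_on S T" for S unfolding T_def by (intro continuous_intros)
  have d: "dist (T p) (T q) = dist p q" for p q
  proof -
    have "dist (c * a) (c * b) = dist a b" if "cmod c = 1" for a b c :: complex
      using that by (simp add: dist_norm norm_mult flip: right_diff_distrib)
    then show ?thesis by (simp add: dist_prod_def T_def u)
  qed
  have inv: "T (inverse u * fst p, inverse v * snd p) = p" for p
    using u by (simp add: T_def flip: mult.assoc) (metis mult_1 norm_zero prod.collapse right_inverse zero_neq_one)
  have distr: "distr (hausdorff_measure 3) (hausdorff_measure 3) T = hausdorff_measure 3"
    by (rule distr_hausdorff_isometry[OF _ d inv]) simp
  have "T \<in> borel_measurable borel" by (intro borel_measurable_continuous_onI Tc)
  then have TM: "T \<in> measurable (hausdorff_measure 3) (hausdorff_measure 3)" by (simp cong: measurable_cong_sets)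
  have GM: "?G \<in> borel_measurable (hausdorff_measure 3)"
    using integral_fefferman(1)[OF g] by (simp cong: measurable_cong_sets)
  have "continuous_on ?F (\<lambda>p. g (T p))"
    by (rule continuous_on_compose2[OF g Tc]) (use TF in auto)
  then have "(\<integral>p. g (T p) \<partial>fefferman_surface m) =
      (\<integral>p. indicator ?F p *\<^sub>R (fefferman_weight m p *\<^sub>R g (T p)) \<partial>hausdorff_measure 3)"
    by (rule integral_fefferman(2))
  also have "\<dots> = (\<integral>p. ?G (T p) \<partial>hausdorff_measure 3)"
    by (rule Bochner_Integration.integral_cong) (auto simp: TF Tw split: split_indicator)
  also have "\<dots> = (\<integral>p. ?G p \<partial>distr (hausdorff_measure 3) (hausdorff_measure 3) T)"
    by (rule integral_distr[OF TM GM, symmetric])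
  also have "\<dots> = (\<integral>p. g p \<partial>fefferman_surface m)"
    unfolding distr by (rule integral_fefferman(2)[OF g, symmetric])
  finally show ?thesis by (simp add: T_def)
qed

text \<open>A rotation in one coordinate, chosen by \<open>rotation_sign\<close>, preserves the
  integral and multiplies the integrand by -1.\<close>

lemma mon_orthogonal:
  assumes "n \<noteq> k"
  shows "(\<integral>p. mon n p * cnj (mon k p) \<partial>fefferman_surface m) = 0"
proof -
  let ?I = "\<integral>p. mon n p * cnj (mon k p) \<partial>fefferman_surface m"
  obtain a b c d where ab: "prod_decode n = (a, b)" and cd: "prod_decode k = (c, d)"
    by (cases "prod_decode n", cases "prod_decode k") auto
  have "(a, b) \<noteq> (c, d)" using assms ab cd by (metis prod_decode_inverse)
  then have "\<exists>u v. cmod u = 1 \<and> cmod v = 1 \<and> u ^ a * cnj (u ^ c) * (v ^ b * cnj (v ^ d)) = -1"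
  proof (cases "a = c")
    case True
    then have "b \<noteq> d" using \<open>(a, b) \<noteq> (c, d)\<close> by simp
    then obtain v where "cmod v = 1" "v ^ b * cnj (v ^ d) = -1" using rotation_sign by blast
    then show ?thesis by (intro exI[of _ 1] exI[of _ v]) simp
  next
    case False
    then obtain u where "cmod u = 1" "u ^ a * cnj (u ^ c) = -1" using rotation_sign by blast
    then show ?thesis by (intro exI[of _ u] exI[of _ 1]) simp
  qed
  then obtain u v where uv: "cmod u = 1" "cmod v = 1" "u ^ a * cnj (u ^ c) * (v ^ b * cnj (v ^ d)) = -1" by blast
  have "?I = (\<integral>p. mon n (u * fst p, v * snd p) * cnj (mon k (u * fst p, v * snd p)) \<partial>fefferman_surface m)"
    by (rule integral_fefferman_rotate[OF continuous_mon_mon uv(1,2), symmetric])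
  also have "\<dots> = (\<integral>p. (u ^ a * cnj (u ^ c) * (v ^ b * cnj (v ^ d))) * (mon n p * cnj (mon k p)) \<partial>fefferman_surface m)"
    by (rule Bochner_Integration.integral_cong) (simp_all add: mon_def ab cd power_mult_distrib mult_ac)
  also have "\<dots> = - ?I" unfolding uv(3) by simp
  finally show ?thesis by (metis eq_neg_iff_add_eq_0 mult_2 mult_eq_0_iff zero_neq_numeral)
qed

text \<open>Despite the name this is the square of the norm.\<close>

definition mon_norm :: "nat \<Rightarrow> real" where
  "mon_norm n = (\<integral>p. cmod (mon n p) ^ 2 \<partial>fefferman_surface m)"

lemma integral_mon_mon: "(\<integral>p. mon n p * cnj (mon k p) \<partial>fefferman_surface m) = (if n = k then of_real (mon_norm n) else 0)"
proof (cases "n = k")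
  case True
  have "(\<integral>p. mon n p * cnj (mon n p) \<partial>fefferman_surface m) = (\<integral>p. complex_of_real (cmod (mon n p) ^ 2) \<partial>fefferman_surface m)"
    by (simp only: complex_norm_square)
  then show ?thesis using True by (simp only: integral_complex_of_real mon_norm_def refl if_True)
qed (simp add: mon_orthogonal)

section \<open>Lower bounds for the norms of the monomials\<close>

text \<open>The contraction (z, w) to (w, Re z) maps the piece onto a set with nonempty interior in
  a three-dimensional space, so its Hausdorff measure is positive. The strict condition Y < |w|^2
  keeps w nonzero even when Y = 0, and so the weight positive.\<close>

lemma measure_frontier_piece_pos:
  assumes XY: "X \<ge> 0" "Y \<ge> 0" "X + Y ^ m < 1"
  defines "A \<equiv> {p\<in>frontier (egg m). X \<le> cmod (fst p) ^ 2 \<and> Y < cmod (snd p) ^ 2}"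
  shows "A \<in> sets (fefferman_surface m)" "measure (fefferman_surface m) A > 0"
proof -
  let ?F = "frontier (egg m)"
  have "closed {p :: complex \<times> complex. X \<le> cmod (fst p) ^ 2}" "open {p :: complex \<times> complex. Y < cmod (snd p) ^ 2}"
    by (intro closed_Collect_le open_Collect_less continuous_intros)+
  then have "?F \<inter> {p. X \<le> cmod (fst p) ^ 2} \<inter> {p. Y < cmod (snd p) ^ 2} \<in> sets borel"
    by (intro sets.Int borel_frontier) auto
  also have "?F \<inter> {p. X \<le> cmod (fst p) ^ 2} \<inter> {p. Y < cmod (snd p) ^ 2} = A" by (auto simp: A_def)
  finally have Ab: "A \<in> sets borel" .
  have AF: "A \<subseteq> ?F" by (auto simp: A_def)
  have As: "A \<in> sets (restrict_space borel ?F)"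
    using Ab AF by (auto simp: sets_restrict_space image_iff intro!: bexI[of _ A])
  then show "A \<in> sets (fefferman_surface m)" by (simp add: sets_fefferman)
  define \<pi> where "\<pi> p = (snd p, Re (fst p))" for p :: "complex \<times> complex"
  have \<pi>: "dist (\<pi> p) (\<pi> q) \<le> dist p q" for p q
  proof -
    have "dist (Re (fst p)) (Re (fst q)) \<le> dist (fst p) (fst q)"
      using abs_Re_le_cmod[of "fst p - fst q"] by (simp add: dist_norm)
    then have "(dist (Re (fst p)) (Re (fst q)))\<^sup>2 \<le> (dist (fst p) (fst q))\<^sup>2" by (intro power_mono) auto
    then show ?thesis by (simp add: dist_prod_def \<pi>_def)
  qed
  \<comment> \<open>For (w, x) in this open set, x^2 < 1 - |w|^(2m), so Im z can be recovered as a
    square root; the last condition gives |z|^2 > X.\<close>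
  let ?O = "{q :: complex \<times> real. Y < cmod (fst q) ^ 2 \<and> (snd q)\<^sup>2 < 1 - cmod (fst q) ^ (2 * m) \<and> cmod (fst q) ^ (2 * m) < 1 - X}"
  have "open ?O" by (intro open_Collect_conj open_Collect_less continuous_intros)
  moreover have "?O \<noteq> {}"
  proof -
    obtain t where t: "t > 0" "X + (Y + t) ^ m < 1"
      by (rule exists_pos_less[of "\<lambda>t. X + (Y + t) ^ m"]) (use XY in \<open>auto intro!: continuous_intros\<close>)
    have "(sqrt (Y + t)) ^ (2 * m) = (Y + t) ^ m" using XY t by (simp add: power_mult)
    then have "(of_real (sqrt (Y + t)), 0) \<in> ?O" using t XY by simp
    then show ?thesis by blast
  qed
  ultimately obtain c e where ce: "e > 0" "ball c e \<subseteq> ?O"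
    unfolding open_contains_ball by blast
  have "?O \<subseteq> \<pi> ` A"
  proof
    fix q assume q: "q \<in> ?O"
    define p where "p = (Complex (snd q) (sqrt (1 - cmod (fst q) ^ (2 * m) - (snd q)\<^sup>2)), fst q)"
    have "cmod (fst p) ^ 2 = 1 - cmod (fst q) ^ (2 * m)" using q by (simp add: p_def cmod_power2)
    then have "p \<in> A" using q by (simp add: A_def frontier_egg[OF m] rho_eq) (simp add: p_def)
    moreover have "\<pi> p = q" by (simp add: \<pi>_def p_def)
    ultimately show "q \<in> \<pi> ` A" by blast
  qed
  with ce have "ball c e \<subseteq> \<pi> ` A" by blast
  from lborel_le_hausdorff_outer[OF \<pi> this]
  have "ennreal ((1 / 2) ^ 3) * emeasure lborel (ball c e) \<le> hausdorff_outer 3 A" by simp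
  moreover have "0 < ennreal ((1 / 2) ^ 3) * emeasure lborel (ball c e)"
    using ce by (simp add: emeasure_ball ennreal_zero_less_mult_iff)
  ultimately have "hausdorff_outer 3 A > 0" by (rule order.strict_trans2[rotated])
  then have EA: "emeasure (euclidean_surface m) A > 0" by (simp add: emeasure_euclidean_surface Ab AF)
  have "emeasure (fefferman_surface m) A \<noteq> 0"
  proof
    have As': "A \<in> sets (euclidean_surface m)" using As by (simp add: sets_euclidean_surface)
    assume "emeasure (fefferman_surface m) A = 0"
    then have "(\<integral>\<^sup>+p. ennreal (fefferman_weight m p) * indicator A p \<partial>euclidean_surface m) = 0"
      unfolding fefferman_surface_def using As' by (subst (asm) emeasure_density) auto
    then have "emeasure (euclidean_surface m)
        {p\<in>space (euclidean_surface m). ennreal (fefferman_weight m p) * indicator A p \<noteq> 0} = 0"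
      using As' by (subst (asm) nn_integral_0_iff) auto
    also have "{p\<in>space (euclidean_surface m). ennreal (fefferman_weight m p) * indicator A p \<noteq> 0} = A"
    proof -
      have "ennreal (fefferman_weight m p) \<noteq> 0" if "p \<in> A" for p
      proof -
        have "snd p \<noteq> 0" using that XY by (auto simp: A_def)
        then have "fefferman_weight m p > 0" using that by (intro fefferman_weight_pos) (auto simp: A_def)
        then show ?thesis by (simp add: ennreal_eq_0_iff)
      qed
      then show ?thesis using AF
        by (auto simp: euclidean_surface_def space_restrict_space indicator_eq_0_iff split: if_splits)
    qed
    finally show False using EA by simp
  qed
  then show "measure (fefferman_surface m) A > 0"
    using finite_measure.emeasure_eq_measure[OF finite_measure_fefferman, of A]
    by (simp add: zero_less_measure_iff)
qed

text \<open>The integral is restricted to the piece where |z|^2 \<ge> X and |w|^2 > Y. The constant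
  is the measure of that piece and hence serves all indices at once.\<close>

lemma mon_norm_lower_bound:
  assumes XY: "X > 0" "Y > 0" "X + Y ^ m < 1"
  obtains c where "c > 0"
    "\<And>n. c * (X ^ fst (prod_decode n) * Y ^ snd (prod_decode n)) \<le> mon_norm n"
proof -
  define A where "A = {p\<in>frontier (egg m). X \<le> cmod (fst p) ^ 2 \<and> Y < cmod (snd p) ^ 2}"
  have A: "A \<in> sets (fefferman_surface m)" "measure (fefferman_surface m) A > 0"
    using measure_frontier_piece_pos[of X Y] XY by (auto simp: A_def)
  have AF: "A \<inter> frontier (egg m) = A" by (auto simp: A_def)
  have "measure (fefferman_surface m) A * (X ^ fst (prod_decode n) * Y ^ snd (prod_decode n)) \<le> mon_norm n" for n
  proof -
    let ?c = "X ^ fst (prod_decode n) * Y ^ snd (prod_decode n)"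
    have "(\<integral>p. indicator A p * ?c \<partial>fefferman_surface m) \<le> mon_norm n"
      unfolding mon_norm_def
    proof (rule integral_mono)
      show "integrable (fefferman_surface m) (\<lambda>p. indicator A p * ?c)"
        using A(1) finite_measure_fefferman
        by (intro integrable_mult_left integrable_real_indicator)
           (auto simp: finite_measure.emeasure_finite less_top[symmetric])
      show "integrable (fefferman_surface m) (\<lambda>p. cmod (mon n p) ^ 2)"
        by (intro integrable_fefferman_continuous continuous_intros)
      fix p
      have "?c \<le> cmod (mon n p) ^ 2" if "p \<in> A"
      proof -
        have "?c \<le> (cmod (fst p) ^ 2) ^ fst (prod_decode n) * (cmod (snd p) ^ 2) ^ snd (prod_decode n)"
          using that XY by (intro mult_mono power_mono) (auto simp: A_def)
        also have "\<dots> = cmod (mon n p) ^ 2"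
          by (simp add: mon_def norm_mult norm_power power_mult_distrib mult.commute flip: power_mult)
        finally show ?thesis .
      qed
      then show "indicator A p * ?c \<le> cmod (mon n p) ^ 2" by (auto split: split_indicator)
    qed
    moreover have "(\<integral>p. indicator A p * ?c \<partial>fefferman_surface m) = measure (fefferman_surface m) A * ?c"
      using A(1) by (simp add: AF)
    ultimately show ?thesis by linarith
  qed
  with A(2) that show ?thesis by blast
qed

lemma mon_norm_pos: "mon_norm n > 0"
proof -
  have "(1 / 2 :: real) ^ m \<le> (1 / 2) ^ 1" using m by (intro power_decreasing) auto
  then have "1 / 4 + (1 / 2 :: real) ^ m < 1" by simp
  from mon_norm_lower_bound[OF _ _ this] obtain c where
    "c > 0" "c * ((1 / 4) ^ fst (prod_decode n) * (1 / 2) ^ snd (prod_decode n)) \<le> mon_norm n" by auto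
  moreover from this have "0 < c * ((1 / 4) ^ fst (prod_decode n) * (1 / 2) ^ snd (prod_decode n))" by simp
  ultimately show ?thesis by linarith
qed

text \<open>Slightly larger X, Y still satisfy X + Y^m < 1, and the lower bound for them leaves a
  geometric series in x/X and y/Y.\<close>

lemma summable_mon_norm:
  assumes "x \<ge> 0" "y \<ge> 0" "x + y ^ m < 1"
  shows "summable (\<lambda>n. x ^ fst (prod_decode n) * y ^ snd (prod_decode n) / mon_norm n)"
proof -
  obtain X Y where XY: "X > x" "Y > y" "X + Y ^ m < 1" using exists_larger[OF assms(3)] .
  then have pos: "X > 0" "Y > 0" using assms by auto
  obtain c where c: "c > 0" "\<And>n. c * (X ^ fst (prod_decode n) * Y ^ snd (prod_decode n)) \<le> mon_norm n"
    using mon_norm_lower_bound[OF pos XY(3)] by blast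
  have "summable (\<lambda>n. 1 / c * ((x / X) ^ fst (prod_decode n) * (y / Y) ^ snd (prod_decode n)))"
    using XY pos assms by (intro summable_mult summable_geometric2) auto
  then show ?thesis
  proof (rule summable_comparison_test'[where N = 0])
    fix n
    let ?a = "fst (prod_decode n)" and ?b = "snd (prod_decode n)"
    have "norm (x ^ ?a * y ^ ?b / mon_norm n) = x ^ ?a * y ^ ?b / mon_norm n"
      using assms mon_norm_pos[of n] by simp
    also have "\<dots> \<le> x ^ ?a * y ^ ?b / (c * (X ^ ?a * Y ^ ?b))"
      using assms c pos mon_norm_pos[of n] by (intro divide_left_mono c(2) mult_pos_pos mult_nonneg_nonneg) auto
    also have "\<dots> = 1 / c * ((x / X) ^ ?a * (y / Y) ^ ?b)" by (simp add: power_divide)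
    finally show "norm (x ^ ?a * y ^ ?b / mon_norm n) \<le> 1 / c * ((x / X) ^ ?a * (y / Y) ^ ?b)" .
  qed
qed

end

section \<open>The Hardy space and its kernel\<close>

text \<open>Absolute convergence at a point strictly beyond each point of \<open>V\<close>, as
  \<open>power_series_holomorphic2\<close> requires. Strictness yields one majorant for a whole
  neighbourhood.\<close>

definition series_dominated :: "(nat \<Rightarrow> complex) \<Rightarrow> (complex \<times> complex) set \<Rightarrow> bool" where
  "series_dominated c V \<longleftrightarrow> (\<forall>p\<in>V. \<exists>R1 R2. cmod (fst p) < R1 \<and> cmod (snd p) < R2 \<and>
      summable (\<lambda>n. cmod (c n) * cmod (mon n (complex_of_real R1, complex_of_real R2))))"

lemma cmod_mon_mono:
  assumes "cmod (fst p) \<le> R1" "cmod (snd p) \<le> R2"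
  shows "cmod (mon n p) \<le> cmod (mon n (complex_of_real R1, complex_of_real R2))"
proof -
  have "0 \<le> R1" "0 \<le> R2" using assms norm_ge_zero order_trans by blast+
  then show ?thesis
    using assms by (auto simp: mon_def norm_mult norm_power intro!: mult_mono power_mono)
qed

text \<open>Finitely many of the dominating polydiscs cover \<open>K\<close>; the sum of their
  majorants bounds every partial sum on \<open>K\<close>.\<close>

lemma series_dominated_bounded:
  assumes c: "series_dominated c V" and K: "compact K" "K \<subseteq> V"
  obtains B where "B \<ge> 0" "\<And>p N. p \<in> K \<Longrightarrow> (\<Sum>n<N. cmod (c n * mon n p)) \<le> B"
    "\<And>p. p \<in> K \<Longrightarrow> summable (\<lambda>n. cmod (c n * mon n p))"
proof -
  obtain R1 R2 where R: "\<And>p. p \<in> K \<Longrightarrow> cmod (fst p) < R1 p" "\<And>p. p \<in> K \<Longrightarrow> cmod (snd p) < R2 p"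
    "\<And>p. p \<in> K \<Longrightarrow> summable (\<lambda>n. cmod (c n) * cmod (mon n (complex_of_real (R1 p), complex_of_real (R2 p))))"
    using c K(2) unfolding series_dominated_def by (metis subsetD)
  define S where "S p n = cmod (c n) * cmod (mon n (complex_of_real (R1 p), complex_of_real (R2 p)))" for p n
  define U where "U p = {q :: complex \<times> complex. cmod (fst q) < R1 p \<and> cmod (snd q) < R2 p}" for p
  have "open (U p)" for p unfolding U_def by (intro open_Collect_conj open_Collect_less continuous_intros)
  moreover have "K \<subseteq> (\<Union>p\<in>K. U p)" using R by (auto simp: U_def)
  ultimately obtain C where C: "C \<subseteq> K" "finite C" "K \<subseteq> (\<Union>p\<in>C. U p)"
    using compactE_image[OF K(1), of K U] by blast
  have S0: "S p n \<ge> 0" for p n by (simp add: S_def)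
  have sumS: "summable (S p)" if "p \<in> C" for p using R(3) C(1) that unfolding S_def by blast
  have le: "cmod (c n * mon n q) \<le> S p n" if "q \<in> U p" for p q n
    unfolding S_def norm_mult using that by (intro mult_left_mono cmod_mon_mono) (auto simp: U_def)
  show ?thesis
  proof (rule that)
    show "(\<Sum>p\<in>C. suminf (S p)) \<ge> 0" by (intro sum_nonneg suminf_nonneg sumS S0)
    fix q assume "q \<in> K"
    then obtain p where p: "p \<in> C" "q \<in> U p" using C(3) by blast
    show "summable (\<lambda>n. cmod (c n * mon n q))"
      by (rule summable_comparison_test'[OF sumS[OF p(1)], of 0]) (use le[OF p(2)] in simp)
    fix N
    have "(\<Sum>n<N. cmod (c n * mon n q)) \<le> (\<Sum>n<N. S p n)" by (intro sum_mono le p)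
    also have "\<dots> \<le> suminf (S p)" by (intro sum_le_suminf sumS p S0) auto
    also have "\<dots> \<le> (\<Sum>p\<in>C. suminf (S p))"
      using p(1) C(2) by (intro member_le_sum suminf_nonneg sumS S0) auto
    finally show "(\<Sum>n<N. cmod (c n * mon n q)) \<le> (\<Sum>p\<in>C. suminf (S p))" .
  qed
qed

lemma mon_scaleR: "mon n (t *\<^sub>R p) = of_real (t ^ (fst (prod_decode n) + snd (prod_decode n))) * mon n p"
  by (simp add: mon_def scaleR_conv_of_real power_mult_distrib power_add mult_ac)

context
  fixes m :: nat
  assumes m: "m \<ge> 1"
begin

text \<open>Every point of the egg lies in an open polydisc about 0 whose closure is in the egg. The
  expansions fit together because their coefficients are independent of the polydisc.\<close>

lemma egg_expansion:
  assumes f: "f holomorphic2_on egg m"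
  obtains c where "series_dominated c (egg m)" "\<And>p. p \<in> egg m \<Longrightarrow> (\<lambda>n. c n * mon n p) sums f p"
proof -
  define c where "c n = (case prod_decode n of (a, b) \<Rightarrow> (deriv ^^ b) (coeff1 f a) 0 / fact b)" for n
  have larger: "\<exists>t>0. (complex_of_real (cmod (fst p) + t), complex_of_real (cmod (snd p) + t)) \<in> egg m"
    if p: "p \<in> egg m" for p
  proof -
    obtain t where t: "t > 0" "(cmod (fst p) + t)\<^sup>2 + (cmod (snd p) + t) ^ (2 * m) < 1"
      by (rule exists_pos_less[of "\<lambda>t. (cmod (fst p) + t)\<^sup>2 + (cmod (snd p) + t) ^ (2 * m)"])
        (use p in \<open>auto simp: egg_eq rho_eq intro!: continuous_intros\<close>)
    then have "rho m (complex_of_real (cmod (fst p) + t), complex_of_real (cmod (snd p) + t)) < 0"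
      unfolding rho_eq by (simp add: abs_of_pos add_nonneg_pos del: of_real_add)
    then show ?thesis using t by (auto simp: egg_eq)
  qed
  have expand: "summable (\<lambda>n. cmod (c n * mon n p))" "(\<lambda>n. c n * mon n p) sums f p" if p: "p \<in> egg m" for p
  proof -
    obtain t where t: "t > 0" "(complex_of_real (cmod (fst p) + t), complex_of_real (cmod (snd p) + t)) \<in> egg m"
      using larger[OF p] by blast
    let ?r1 = "cmod (fst p) + t" and ?r2 = "cmod (snd p) + t"
    have r: "?r1 > 0" "?r2 > 0" using t by (auto simp: add_nonneg_pos)
    have "cball 0 ?r1 \<times> cball 0 ?r2 \<subseteq> egg m"
    proof
      fix q assume "q \<in> cball (0::complex) ?r1 \<times> cball (0::complex) ?r2"
      then have "cmod (fst q) ^ 2 + cmod (snd q) ^ (2 * m) \<le> ?r1\<^sup>2 + ?r2 ^ (2 * m)"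
        by (intro add_mono power_mono) (auto simp: mem_Times_iff)
      also have "\<dots> < 1" using t(2) r unfolding egg_eq rho_eq by (simp add: abs_of_pos del: of_real_add)
      finally show "q \<in> egg m" by (simp add: egg_eq rho_eq)
    qed
    from polydisc_expansion[OF f this r, of "fst p" "snd p"] t(1)
    show "summable (\<lambda>n. cmod (c n * mon n p))" "(\<lambda>n. c n * mon n p) sums f p" by (simp_all add: c_def)
  qed
  have "series_dominated c (egg m)"
    unfolding series_dominated_def
  proof
    fix p assume "p \<in> egg m"
    then obtain t where t: "t > 0" "(complex_of_real (cmod (fst p) + t), complex_of_real (cmod (snd p) + t)) \<in> egg m"
      using larger by blast
    from expand(1)[OF t(2)] t(1)
    show "\<exists>R1 R2. cmod (fst p) < R1 \<and> cmod (snd p) < R2 \<and>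
      summable (\<lambda>n. cmod (c n) * cmod (mon n (complex_of_real R1, complex_of_real R2)))"
      unfolding norm_mult by (intro exI[of _ "cmod (fst p) + t"] exI[of _ "cmod (snd p) + t"]) simp
  qed
  with expand(2) that show ?thesis by blast
qed

text \<open>The image of \<open>h\<close> is compact, so the partial sums are dominated by a
  constant times |g|. The map \<open>h\<close> is a dilation into the egg in one application and the
  identity in the other.\<close>

lemma integral_series:
  assumes c: "series_dominated c V" and g: "integrable (fefferman_surface m) g"
    and h: "continuous_on (frontier (egg m)) h" "h ` frontier (egg m) \<subseteq> V"
  shows "(\<lambda>n. c n * (\<integral>\<xi>. g \<xi> * mon n (h \<xi>) \<partial>fefferman_surface m)) sums
    (\<integral>\<xi>. g \<xi> * (\<Sum>n. c n * mon n (h \<xi>)) \<partial>fefferman_surface m)"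
proof -
  let ?F = "frontier (egg m)" and ?\<sigma> = "fefferman_surface m"
  have "compact (h ` ?F)" using h(1) compact_frontier_egg[OF m] by (rule compact_continuous_image)
  then obtain B where B: "B \<ge> 0" "\<And>p N. p \<in> h ` ?F \<Longrightarrow> (\<Sum>n<N. cmod (c n * mon n p)) \<le> B"
    "\<And>p. p \<in> h ` ?F \<Longrightarrow> summable (\<lambda>n. cmod (c n * mon n p))"
    using series_dominated_bounded[OF c _ h(2)] by blast
  have gm [measurable]: "g \<in> borel_measurable ?\<sigma>" using g by (rule borel_measurable_integrable)
  have mm [measurable]: "(\<lambda>\<xi>. mon n (h \<xi>)) \<in> borel_measurable ?\<sigma>" for n
    by (intro measurable_fefferman_continuous[OF m] continuous_intros h)
  define G where "G n \<xi> = g \<xi> * (c n * mon n (h \<xi>))" for n \<xi>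
  have Gb: "(\<Sum>n<N. cmod (G n \<xi>)) \<le> cmod (g \<xi>) * B" if "\<xi> \<in> ?F" for N \<xi>
  proof -
    have "(\<Sum>n<N. cmod (G n \<xi>)) = cmod (g \<xi>) * (\<Sum>n<N. cmod (c n * mon n (h \<xi>)))"
      by (simp add: G_def norm_mult sum_distrib_left)
    also have "\<dots> \<le> cmod (g \<xi>) * B" using that by (intro mult_left_mono B) auto
    finally show ?thesis .
  qed
  have gB: "integrable ?\<sigma> (\<lambda>\<xi>. cmod (g \<xi>) * B)" using g by (intro integrable_mult_left integrable_norm)
  have Gi: "integrable ?\<sigma> (G n)" for n
  proof (rule Bochner_Integration.integrable_bound[OF gB])
    show "G n \<in> borel_measurable ?\<sigma>" unfolding G_def by measurable
    show "AE \<xi> in ?\<sigma>. norm (G n \<xi>) \<le> norm (cmod (g \<xi>) * B)"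
    proof (rule AE_I2)
      fix \<xi> assume "\<xi> \<in> space ?\<sigma>"
      then have "\<xi> \<in> ?F" using m by simp
      have "cmod (G n \<xi>) \<le> (\<Sum>n<Suc n. cmod (G n \<xi>))" by (simp add: sum_nonneg)
      also have "\<dots> \<le> cmod (g \<xi>) * B" by (rule Gb[OF \<open>\<xi> \<in> ?F\<close>])
      finally show "norm (G n \<xi>) \<le> norm (cmod (g \<xi>) * B)" using B(1) by (simp add: abs_mult)
    qed
  qed
  have "(\<lambda>n. integral\<^sup>L ?\<sigma> (G n)) sums (\<integral>\<xi>. (\<Sum>n. G n \<xi>) \<partial>?\<sigma>)"
  proof (rule sums_integral[OF Gi])
    show "AE \<xi> in ?\<sigma>. summable (\<lambda>n. norm (G n \<xi>))"
    proof (rule AE_I2)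
      fix \<xi> assume "\<xi> \<in> space ?\<sigma>"
      then have "\<xi> \<in> ?F" using m by simp
      then show "summable (\<lambda>n. norm (G n \<xi>))"
        unfolding G_def norm_mult[of "g \<xi>"] by (intro summable_mult B(3)) auto
    qed
    show "summable (\<lambda>n. \<integral>\<xi>. norm (G n \<xi>) \<partial>?\<sigma>)"
    proof (rule summableI_nonneg_bounded)
      fix N
      have "(\<Sum>n<N. \<integral>\<xi>. norm (G n \<xi>) \<partial>?\<sigma>) = (\<integral>\<xi>. (\<Sum>n<N. norm (G n \<xi>)) \<partial>?\<sigma>)"
        by (rule Bochner_Integration.integral_sum[symmetric]) (intro integrable_norm Gi)
      also have "\<dots> \<le> (\<integral>\<xi>. cmod (g \<xi>) * B \<partial>?\<sigma>)"
        using Gb m by (intro integral_mono gB Bochner_Integration.integrable_sum integrable_norm Gi) auto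
      finally show "(\<Sum>n<N. \<integral>\<xi>. norm (G n \<xi>) \<partial>?\<sigma>) \<le> (\<integral>\<xi>. cmod (g \<xi>) * B \<partial>?\<sigma>)" .
    qed simp
  qed
  moreover have "integral\<^sup>L ?\<sigma> (G n) = c n * (\<integral>\<xi>. g \<xi> * mon n (h \<xi>) \<partial>?\<sigma>)" for n
    unfolding G_def mult.left_commute[of _ "c n"] by (rule integral_mult_right_zero)
  moreover have "(\<integral>\<xi>. (\<Sum>n. G n \<xi>) \<partial>?\<sigma>) = (\<integral>\<xi>. g \<xi> * (\<Sum>n. c n * mon n (h \<xi>)) \<partial>?\<sigma>)"
  proof (rule Bochner_Integration.integral_cong)
    fix \<xi> assume "\<xi> \<in> space ?\<sigma>"
    then have "h \<xi> \<in> h ` ?F" using m by simp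
    from summable_norm_cancel[OF B(3)[OF this]] show "(\<Sum>n. G n \<xi>) = g \<xi> * (\<Sum>n. c n * mon n (h \<xi>))"
      unfolding G_def by (rule suminf_mult)
  qed simp
  ultimately show ?thesis by simp
qed

section \<open>Pairing boundary values with monomials\<close>

text \<open>The dilate maps the boundary into the egg, where the series may be integrated term by
  term; orthogonality leaves only the term with n = k.\<close>

lemma integral_dilate:
  assumes c: "series_dominated c (egg m)" and f: "\<And>p. p \<in> egg m \<Longrightarrow> (\<lambda>n. c n * mon n p) sums f p"
    and t: "0 \<le> t" "t < 1"
  shows "(\<integral>\<xi>. f (t *\<^sub>R \<xi>) * cnj (mon k \<xi>) \<partial>fefferman_surface m) =
    of_real (t ^ (fst (prod_decode k) + snd (prod_decode k))) * c k * of_real (mon_norm m k)"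
proof -
  let ?\<sigma> = "fefferman_surface m"
  let ?d = "\<lambda>n. fst (prod_decode n) + snd (prod_decode n)"
  have tin: "t *\<^sub>R \<xi> \<in> egg m" if "\<xi> \<in> frontier (egg m)" for \<xi>
    using that scaleR_in_egg[OF m t, of \<xi>] by (simp add: frontier_egg[OF m])
  have "(\<lambda>n. c n * (\<integral>\<xi>. cnj (mon k \<xi>) * mon n (t *\<^sub>R \<xi>) \<partial>?\<sigma>)) sums
    (\<integral>\<xi>. cnj (mon k \<xi>) * (\<Sum>n. c n * mon n (t *\<^sub>R \<xi>)) \<partial>?\<sigma>)"
    by (rule integral_series[OF c]) (use tin in \<open>auto intro!: integrable_fefferman_continuous[OF m] continuous_intros\<close>)
  moreover have "(\<integral>\<xi>. cnj (mon k \<xi>) * (\<Sum>n. c n * mon n (t *\<^sub>R \<xi>)) \<partial>?\<sigma>) = (\<integral>\<xi>. f (t *\<^sub>R \<xi>) * cnj (mon k \<xi>) \<partial>?\<sigma>)"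
    by (rule Bochner_Integration.integral_cong) (use sums_unique[OF f[OF tin]] m in \<open>auto simp: mult.commute\<close>)
  moreover have "c n * (\<integral>\<xi>. cnj (mon k \<xi>) * mon n (t *\<^sub>R \<xi>) \<partial>?\<sigma>)
    = (if n = k then of_real (t ^ ?d n) * c n * of_real (mon_norm m n) else 0)" for n
  proof -
    have "(\<integral>\<xi>. cnj (mon k \<xi>) * mon n (t *\<^sub>R \<xi>) \<partial>?\<sigma>) = (\<integral>\<xi>. of_real (t ^ ?d n) * (mon n \<xi> * cnj (mon k \<xi>)) \<partial>?\<sigma>)"
      by (rule Bochner_Integration.integral_cong) (simp_all add: mon_scaleR mult_ac)
    also have "\<dots> = of_real (t ^ ?d n) * (\<integral>\<xi>. mon n \<xi> * cnj (mon k \<xi>) \<partial>?\<sigma>)"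
      by (rule integral_mult_right_zero)
    finally show ?thesis by (simp add: integral_mon_mon[OF m])
  qed
  ultimately have "(\<lambda>n. if n = k then of_real (t ^ ?d n) * c n * of_real (mon_norm m n) else 0) sums
      (\<integral>\<xi>. f (t *\<^sub>R \<xi>) * cnj (mon k \<xi>) \<partial>?\<sigma>)" by simp
  then show ?thesis using sums_single[of k "\<lambda>n. of_real (t ^ ?d n) * c n * of_real (mon_norm m n)"]
    by (rule sums_unique2)
qed

lemma hardy_boundary:
  assumes \<alpha>: "\<alpha> > 0" and f: "f \<in> fefferman_hardy m \<alpha>" and fb: "nt_boundary_value m \<alpha> f fb"
  shows "integrable (fefferman_surface m) fb"
    and "integrable (fefferman_surface m) (\<lambda>\<xi>. cmod (fb \<xi>) ^ 2)"
    and "\<And>c. series_dominated c (egg m) \<Longrightarrow> (\<And>p. p \<in> egg m \<Longrightarrow> (\<lambda>n. c n * mon n p) sums f p) \<Longrightarrow>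
      (\<integral>\<xi>. fb \<xi> * cnj (mon k \<xi>) \<partial>fefferman_surface m) = c k * of_real (mon_norm m k)"
proof -
  let ?\<sigma> = "fefferman_surface m"
  let ?N = "nt_maximal m \<alpha> f"
  interpret finite_measure ?\<sigma> by (rule finite_measure_fefferman[OF m])
  have hol: "f holomorphic2_on egg m" and Nm [measurable]: "?N \<in> borel_measurable ?\<sigma>"
    and Nfin: "(\<integral>\<^sup>+ \<xi>. ?N \<xi> ^ 2 \<partial>?\<sigma>) < \<infinity>"
    using f by (auto simp: fefferman_hardy_def)
  have fbm [measurable]: "fb \<in> borel_measurable ?\<sigma>"
    and lim: "AE \<xi> in ?\<sigma>. (f \<longlongrightarrow> fb \<xi>) (at \<xi> within approach_region m \<alpha> \<xi>)"
    using fb by (auto simp: nt_boundary_value_def)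
  obtain t0 where t0: "0 \<le> t0" "t0 < 1"
    "\<And>\<xi> t. rho m \<xi> = 0 \<Longrightarrow> t0 < t \<Longrightarrow> t < 1 \<Longrightarrow> t *\<^sub>R \<xi> \<in> approach_region m \<alpha> \<xi>"
    using radial_approach[OF m \<alpha>] by blast
  \<comment> \<open>The double \<open>Suc\<close> keeps even the first value strictly above t0; a
    sequence is used so that dominated convergence applies.\<close>
  define t where "t j = 1 - (1 - t0) * inverse (real (Suc (Suc j)))" for j
  have t: "t0 < t j" "t j < 1" "0 \<le> t j" for j
  proof -
    have "(1 - t0) * inverse (real (Suc (Suc j))) < (1 - t0) * 1"
      using t0 by (intro mult_strict_left_mono) (auto simp: field_simps)
    then show "t0 < t j" by (simp add: t_def)
    then show "0 \<le> t j" using t0 by simp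
    have "0 < (1 - t0) * inverse (real (Suc (Suc j)))" using t0 by simp
    then show "t j < 1" by (simp add: t_def)
  qed
  have "(\<lambda>j. inverse (real (Suc (Suc j)))) \<longlonglongrightarrow> 0"
    using LIMSEQ_Suc[OF LIMSEQ_inverse_real_of_nat] .
  then have "t \<longlonglongrightarrow> 1 - (1 - t0) * 0" unfolding t_def by (intro tendsto_intros)
  then have tl: "t \<longlonglongrightarrow> 1" by simp
  \<comment> \<open>\<open>enn2real\<close> sends infinity to 0, so \<open>D\<close> never exceeds
    the maximal function; the two agree almost everywhere because the latter is square
    integrable.\<close>
  define D where "D \<xi> = enn2real (?N \<xi>)" for \<xi>
  have Dm [measurable]: "D \<in> borel_measurable ?\<sigma>" unfolding D_def by measurable
  have D2: "integrable ?\<sigma> (\<lambda>\<xi>. D \<xi> ^ 2)"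
  proof (rule integrableI_bounded)
    have "(\<integral>\<^sup>+ \<xi>. ennreal (norm (D \<xi> ^ 2)) \<partial>?\<sigma>) \<le> (\<integral>\<^sup>+ \<xi>. ?N \<xi> ^ 2 \<partial>?\<sigma>)"
    proof (rule nn_integral_mono)
      fix \<xi>
      have "ennreal (norm (D \<xi> ^ 2)) = ennreal (D \<xi>) ^ 2" by (simp add: D_def ennreal_power)
      also have "\<dots> \<le> ?N \<xi> ^ 2" unfolding D_def by (intro power_mono) (auto simp: ennreal_enn2real_if)
      finally show "ennreal (norm (D \<xi> ^ 2)) \<le> ?N \<xi> ^ 2" .
    qed
    then show "(\<integral>\<^sup>+ \<xi>. ennreal (norm (D \<xi> ^ 2)) \<partial>?\<sigma>) < \<infinity>" using Nfin by (rule le_less_trans)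
  qed simp
  have D0: "D \<xi> \<ge> 0" for \<xi> by (simp add: D_def)
  have D1: "integrable ?\<sigma> D"
  proof (rule Bochner_Integration.integrable_bound)
    show "integrable ?\<sigma> (\<lambda>\<xi>. 1 + D \<xi> ^ 2)" using D2 by simp
    \<comment> \<open>The measure is finite, so square integrability gives integrability.\<close>
    have "D \<xi> \<le> 1 + D \<xi> ^ 2" for \<xi>
    proof -
      have "0 \<le> (D \<xi> - 1)\<^sup>2 + D \<xi> ^ 2 + 1" by (intro add_nonneg_nonneg) auto
      then show ?thesis by (simp add: power2_eq_square algebra_simps)
    qed
    then show "AE \<xi> in ?\<sigma>. norm (D \<xi>) \<le> norm (1 + D \<xi> ^ 2)" using D0 by simp
  qed simp
  have "AE \<xi> in ?\<sigma>. ?N \<xi> ^ 2 \<noteq> \<infinity>"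
    using Nfin by (intro nn_integral_PInf_AE) auto
  then have dom: "AE \<xi> in ?\<sigma>. \<forall>j. cmod (f (t j *\<^sub>R \<xi>)) \<le> D \<xi>"
  proof (rule AE_mp, intro AE_I2 impI allI)
    fix \<xi> j assume \<xi>: "\<xi> \<in> space ?\<sigma>" "?N \<xi> ^ 2 \<noteq> \<infinity>"
    have "t j *\<^sub>R \<xi> \<in> approach_region m \<alpha> \<xi>"
      using \<xi>(1) t[of j] t0(3) by (simp add: space_fefferman[OF m] frontier_egg[OF m])
    then have "ennreal (cmod (f (t j *\<^sub>R \<xi>))) \<le> ?N \<xi>" unfolding nt_maximal_def by (rule SUP_upper)
    moreover have "?N \<xi> < top" using \<xi>(2) by (auto simp: less_top[symmetric] power2_eq_square)
    ultimately show "cmod (f (t j *\<^sub>R \<xi>)) \<le> D \<xi>"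
      unfolding D_def by (metis enn2real_ennreal enn2real_mono norm_ge_zero)
  qed
  have conv: "AE \<xi> in ?\<sigma>. (\<lambda>j. f (t j *\<^sub>R \<xi>)) \<longlonglongrightarrow> fb \<xi>"
    using lim
  proof (rule AE_mp, intro AE_I2 impI)
    fix \<xi> assume \<xi>: "\<xi> \<in> space ?\<sigma>" and l: "(f \<longlongrightarrow> fb \<xi>) (at \<xi> within approach_region m \<alpha> \<xi>)"
    have r: "rho m \<xi> = 0" using \<xi> by (simp add: space_fefferman[OF m] frontier_egg[OF m])
    \<comment> \<open>The filter \<open>at\<close> leaves out \<xi> itself; the dilates lie in the
      egg and so differ from the boundary point.\<close>
    have "t j *\<^sub>R \<xi> \<in> approach_region m \<alpha> \<xi> \<and> t j *\<^sub>R \<xi> \<noteq> \<xi>" for j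
    proof -
      have a: "t j *\<^sub>R \<xi> \<in> approach_region m \<alpha> \<xi>" using t[of j] t0(3) r by simp
      then have "rho m (t j *\<^sub>R \<xi>) < 0" by (simp add: approach_region_def egg_eq)
      with a r show ?thesis by auto
    qed
    moreover have "(\<lambda>j. t j *\<^sub>R \<xi>) \<longlonglongrightarrow> 1 *\<^sub>R \<xi>" by (intro tendsto_intros tl)
    ultimately have "filterlim (\<lambda>j. t j *\<^sub>R \<xi>) (at \<xi> within approach_region m \<alpha> \<xi>) sequentially"
      unfolding filterlim_at by simp
    then show "(\<lambda>j. f (t j *\<^sub>R \<xi>)) \<longlonglongrightarrow> fb \<xi>" by (rule filterlim_compose[OF l])
  qed
  have fbD: "AE \<xi> in ?\<sigma>. cmod (fb \<xi>) \<le> D \<xi>"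
    using dom conv
  proof eventually_elim
    case (elim \<xi>)
    have "(\<lambda>j. cmod (f (t j *\<^sub>R \<xi>))) \<longlonglongrightarrow> cmod (fb \<xi>)" using elim(2) by (rule tendsto_norm)
    then show ?case using elim(1) by (intro LIMSEQ_le_const2) auto
  qed
  show int: "integrable ?\<sigma> fb"
    by (rule Bochner_Integration.integrable_bound[OF D1 fbm]) (use fbD D0 in auto)
  show "integrable ?\<sigma> (\<lambda>\<xi>. cmod (fb \<xi>) ^ 2)"
  proof (rule Bochner_Integration.integrable_bound[OF D2])
    show "AE \<xi> in ?\<sigma>. norm (cmod (fb \<xi>) ^ 2) \<le> norm (D \<xi> ^ 2)"
      using fbD by eventually_elim (auto intro: power_mono)
  qed simp
  fix c assume c: "series_dominated c (egg m)" "\<And>p. p \<in> egg m \<Longrightarrow> (\<lambda>n. c n * mon n p) sums f p"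
  let ?d = "fst (prod_decode k) + snd (prod_decode k)"
  have mk1: "cmod (mon k \<xi>) \<le> 1" if "\<xi> \<in> frontier (egg m)" for \<xi>
    using cmod_mon_mono[of \<xi> 1 1 k] rho_le_0_bounds[OF m, of \<xi>] that by (simp add: frontier_egg[OF m] mon_def)
  have L: "(\<lambda>j. \<integral>\<xi>. f (t j *\<^sub>R \<xi>) * cnj (mon k \<xi>) \<partial>?\<sigma>) \<longlonglongrightarrow> (\<integral>\<xi>. fb \<xi> * cnj (mon k \<xi>) \<partial>?\<sigma>)"
  proof (rule integral_dominated_convergence[OF _ _ D1])
    have [measurable]: "(\<lambda>\<xi>. cnj (mon k \<xi>)) \<in> borel_measurable ?\<sigma>"
      by (intro measurable_fefferman_continuous[OF m] continuous_intros)
    show "(\<lambda>\<xi>. fb \<xi> * cnj (mon k \<xi>)) \<in> borel_measurable ?\<sigma>" by measurable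
    show "(\<lambda>\<xi>. f (t j *\<^sub>R \<xi>) * cnj (mon k \<xi>)) \<in> borel_measurable ?\<sigma>" for j
    proof (intro measurable_fefferman_continuous[OF m] continuous_intros)
      show "continuous_on (frontier (egg m)) (\<lambda>\<xi>. f (t j *\<^sub>R \<xi>))"
      proof (rule continuous_on_compose2[OF holomorphic2_on_imp_continuous_on[OF hol]])
        show "(\<lambda>\<xi>. t j *\<^sub>R \<xi>) ` frontier (egg m) \<subseteq> egg m"
          using scaleR_in_egg[OF m t(3,2)] by (auto simp: frontier_egg[OF m])
      qed (intro continuous_intros)
    qed
    show "AE \<xi> in ?\<sigma>. (\<lambda>j. f (t j *\<^sub>R \<xi>) * cnj (mon k \<xi>)) \<longlonglongrightarrow> fb \<xi> * cnj (mon k \<xi>)"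
      using conv by eventually_elim (intro tendsto_intros)
    show "AE \<xi> in ?\<sigma>. norm (f (t j *\<^sub>R \<xi>) * cnj (mon k \<xi>)) \<le> D \<xi>" for j
      using dom AE_space
    proof eventually_elim
      case (elim \<xi>)
      have "cmod (f (t j *\<^sub>R \<xi>)) * cmod (mon k \<xi>) \<le> D \<xi> * 1"
        using elim mk1[of \<xi>] D0 by (intro mult_mono) (auto simp: space_fefferman[OF m])
      then show ?case by (simp add: norm_mult)
    qed
  qed
  have R: "(\<lambda>j. of_real (t j ^ ?d) * c k * of_real (mon_norm m k)) \<longlonglongrightarrow> of_real (1 ^ ?d) * c k * of_real (mon_norm m k)"
    by (intro tendsto_intros tl)
  have "(\<integral>\<xi>. f (t j *\<^sub>R \<xi>) * cnj (mon k \<xi>) \<partial>?\<sigma>) = of_real (t j ^ ?d) * c k * of_real (mon_norm m k)" for j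
    by (rule integral_dilate[OF c t(3,2)])
  then have "(\<lambda>j. of_real (t j ^ ?d) * c k * of_real (mon_norm m k)) \<longlonglongrightarrow> (\<integral>\<xi>. fb \<xi> * cnj (mon k \<xi>) \<partial>?\<sigma>)"
    using L by (simp only:)
  from LIMSEQ_unique[OF this R]
  show "(\<integral>\<xi>. fb \<xi> * cnj (mon k \<xi>) \<partial>?\<sigma>) = c k * of_real (mon_norm m k)" by simp
qed

section \<open>The explicit kernel and its reproducing property\<close>

text \<open>The convergence condition of \<open>summable_mon_norm\<close> for the products of the
  moduli of corresponding coordinates.\<close>

definition kernel_domain :: "complex \<times> complex \<Rightarrow> (complex \<times> complex) set" where
  "kernel_domain \<eta> = {\<zeta>. cmod (fst \<eta>) * cmod (fst \<zeta>) + (cmod (snd \<eta>) * cmod (snd \<zeta>)) ^ m < 1}"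

definition kernel :: "complex \<times> complex \<Rightarrow> complex \<times> complex \<Rightarrow> complex" where
  "kernel \<eta> \<zeta> = (\<Sum>n. cnj (mon n \<eta>) / of_real (mon_norm m n) * mon n \<zeta>)"

lemma open_kernel_domain: "open (kernel_domain \<eta>)"
  unfolding kernel_domain_def by (intro open_Collect_less continuous_intros)

lemma closure_egg_subset_kernel_domain:
  assumes "\<eta> \<in> egg m"
  shows "closure (egg m) \<subseteq> kernel_domain \<eta>"
proof
  fix \<zeta> assume "\<zeta> \<in> closure (egg m)"
  then have \<zeta>: "cmod (fst \<zeta>) ^ 2 + cmod (snd \<zeta>) ^ (2 * m) \<le> 1" by (simp add: closure_egg[OF m] rho_eq)
  have \<eta>: "cmod (fst \<eta>) ^ 2 + cmod (snd \<eta>) ^ (2 * m) < 1" using assms by (simp add: egg_eq rho_eq)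
  \<comment> \<open>The strict inequality comes from \<eta> inside the egg, the weak one from
    \<zeta> in the closure; their average is strict.\<close>
  have avg: "a < 1" if "a \<le> (b + c) / 2 + (d + e) / 2" "c + e \<le> 1" "b + d < 1" for a b c d e :: real
    using that by (simp add: field_simps)
  have amgm: "x * y \<le> (x\<^sup>2 + y\<^sup>2) / 2" for x y :: real
    using zero_le_power2[of "x - y"] by (simp add: power2_eq_square algebra_simps)
  have "cmod (fst \<eta>) * cmod (fst \<zeta>) + cmod (snd \<eta>) ^ m * cmod (snd \<zeta>) ^ m
      \<le> (cmod (fst \<eta>) ^ 2 + cmod (fst \<zeta>) ^ 2) / 2 + ((cmod (snd \<eta>) ^ m)\<^sup>2 + (cmod (snd \<zeta>) ^ m)\<^sup>2) / 2"
    by (intro add_mono amgm)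
  moreover have "(cmod (snd \<eta>) ^ m)\<^sup>2 = cmod (snd \<eta>) ^ (2 * m)" "(cmod (snd \<zeta>) ^ m)\<^sup>2 = cmod (snd \<zeta>) ^ (2 * m)"
    by (simp_all add: power_mult[symmetric] mult.commute)
  ultimately have "cmod (fst \<eta>) * cmod (fst \<zeta>) + cmod (snd \<eta>) ^ m * cmod (snd \<zeta>) ^ m < 1"
    using \<zeta> \<eta> avg by (simp only:)
  then show "\<zeta> \<in> kernel_domain \<eta>" by (simp add: kernel_domain_def power_mult_distrib)
qed

lemma kernel_dominated:
  "series_dominated (\<lambda>n. cnj (mon n \<eta>) / of_real (mon_norm m n)) (kernel_domain \<eta>)"
  unfolding series_dominated_def
proof
  fix \<zeta> assume \<zeta>: "\<zeta> \<in> kernel_domain \<eta>"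
  let ?a = "cmod (fst \<eta>)" and ?b = "cmod (snd \<eta>)"
  obtain t where t: "t > 0" "?a * (cmod (fst \<zeta>) + t) + (?b * (cmod (snd \<zeta>) + t)) ^ m < 1"
    by (rule exists_pos_less[of "\<lambda>t. ?a * (cmod (fst \<zeta>) + t) + (?b * (cmod (snd \<zeta>) + t)) ^ m"])
      (use \<zeta> in \<open>auto simp: kernel_domain_def intro!: continuous_intros\<close>)
  let ?R1 = "cmod (fst \<zeta>) + t" and ?R2 = "cmod (snd \<zeta>) + t"
  have R: "?R1 > 0" "?R2 > 0" using t by (auto simp: add_nonneg_pos)
  have "summable (\<lambda>n. (?a * ?R1) ^ fst (prod_decode n) * (?b * ?R2) ^ snd (prod_decode n) / mon_norm m n)"
    by (rule summable_mon_norm[OF m]) (use t R in auto)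
  moreover have "cmod (cnj (mon n \<eta>) / of_real (mon_norm m n)) * cmod (mon n (complex_of_real ?R1, complex_of_real ?R2))
    = (?a * ?R1) ^ fst (prod_decode n) * (?b * ?R2) ^ snd (prod_decode n) / mon_norm m n" for n
    using mon_norm_pos[OF m, of n] R
    by (simp add: mon_def norm_mult norm_power norm_divide power_mult_distrib abs_of_pos del: of_real_add)
  ultimately show "\<exists>R1 R2. cmod (fst \<zeta>) < R1 \<and> cmod (snd \<zeta>) < R2 \<and>
      summable (\<lambda>n. cmod (cnj (mon n \<eta>) / of_real (mon_norm m n)) * cmod (mon n (complex_of_real R1, complex_of_real R2)))"
    using t by (intro exI[of _ ?R1] exI[of _ ?R2]) (simp del: of_real_add)
qed

lemma holomorphic_kernel: "kernel \<eta> holomorphic2_on kernel_domain \<eta>"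
  unfolding kernel_def[abs_def]
  by (rule power_series_holomorphic2[OF open_kernel_domain])
    (use kernel_dominated in \<open>auto simp: series_dominated_def\<close>)

lemma continuous_on_kernel: "\<eta> \<in> egg m \<Longrightarrow> continuous_on (closure (egg m)) (kernel \<eta>)"
  using holomorphic2_on_imp_continuous_on[OF holomorphic_kernel] closure_egg_subset_kernel_domain
  by (rule continuous_on_subset)

lemma continuous_on_frontier_kernel: "\<eta> \<in> egg m \<Longrightarrow> continuous_on (frontier (egg m)) (kernel \<eta>)"
  using continuous_on_kernel by (rule continuous_on_subset) (auto simp: frontier_closures)

text \<open>The kernel is continuous on the compact closed egg, so its maximal function is bounded,
  and the boundary has finite measure.\<close>

lemma kernel_in_hardy:
  assumes \<eta>: "\<eta> \<in> egg m"
  shows "kernel \<eta> \<in> fefferman_hardy m \<alpha>"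
proof -
  let ?\<sigma> = "fefferman_surface m"
  have sub: "egg m \<subseteq> kernel_domain \<eta>"
    using closure_egg_subset_kernel_domain[OF \<eta>] closure_subset by blast
  have hol: "kernel \<eta> holomorphic2_on egg m"
    using holomorphic_kernel[of \<eta>] sub by (auto simp: holomorphic2_on_def)
  have meas: "nt_maximal m \<alpha> (kernel \<eta>) \<in> borel_measurable ?\<sigma>"
    by (rule borel_measurableI_greater)
      (simp add: space_fefferman[OF m] sets_fefferman[OF m] sets_nt_maximal_greater[OF m])
  have "compact (closure (egg m))"
    using rho_le_0_bounds(3)[OF m] unfolding compact_eq_bounded_closed bounded_iff closure_egg[OF m]
    by (metis closed_closure closure_egg[OF m] mem_Collect_eq)
  then have "bounded (kernel \<eta> ` closure (egg m))"
    by (intro compact_imp_bounded compact_continuous_image continuous_on_kernel \<eta>)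
  then obtain B where B: "\<And>p. p \<in> closure (egg m) \<Longrightarrow> cmod (kernel \<eta> p) \<le> B" unfolding bounded_iff by auto
  have "nt_maximal m \<alpha> (kernel \<eta>) \<xi> \<le> ennreal B" for \<xi>
    unfolding nt_maximal_def using closure_subset[of "egg m"]
    by (intro SUP_least ennreal_leI B) (auto simp: approach_region_def)
  then have "(\<integral>\<^sup>+ \<xi>. nt_maximal m \<alpha> (kernel \<eta>) \<xi> ^ 2 \<partial>?\<sigma>) \<le> (\<integral>\<^sup>+ \<xi>. ennreal B ^ 2 \<partial>?\<sigma>)"
    by (intro nn_integral_mono power_mono) auto
  also have "\<dots> = ennreal B ^ 2 * emeasure ?\<sigma> (space ?\<sigma>)" by simp
  also have "\<dots> < \<infinity>"
    using finite_measure.emeasure_finite[OF finite_measure_fefferman[OF m]]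
    by (simp add: ennreal_mult_less_top power_less_top_ennreal less_top)
  finally show ?thesis using hol meas by (simp add: fefferman_hardy_def)
qed

lemma kernel_boundary_value:
  assumes \<eta>: "\<eta> \<in> egg m"
  shows "nt_boundary_value m \<alpha> (kernel \<eta>) (kernel \<eta>)"
  unfolding nt_boundary_value_def
proof
  show "kernel \<eta> \<in> borel_measurable (fefferman_surface m)"
    by (intro measurable_fefferman_continuous[OF m] continuous_on_frontier_kernel \<eta>)
  show "AE \<xi> in fefferman_surface m. (kernel \<eta> \<longlongrightarrow> kernel \<eta> \<xi>) (at \<xi> within approach_region m \<alpha> \<xi>)"
  proof (rule AE_I2)
    fix \<xi> assume "\<xi> \<in> space (fefferman_surface m)"
    then have "\<xi> \<in> kernel_domain \<eta>"
      using closure_egg_subset_kernel_domain[OF \<eta>] by (auto simp: space_fefferman[OF m] frontier_closures)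
    then have "isCont (kernel \<eta>) \<xi>"
      using holomorphic2_on_imp_continuous_on[OF holomorphic_kernel] open_kernel_domain
      by (simp add: continuous_on_eq_continuous_at)
    then show "(kernel \<eta> \<longlongrightarrow> kernel \<eta> \<xi>) (at \<xi> within approach_region m \<alpha> \<xi>)"
      unfolding isCont_def by (rule tendsto_within_subset) simp
  qed
qed

text \<open>Integrating the kernel series against \<open>fb\<close> turns each pairing into a Taylor
  coefficient times \<open>mon_norm\<close>. The denominators cancel and the Taylor series of
  \<open>f\<close> at \<eta> remains.\<close>

lemma kernel_reproduces:
  assumes \<alpha>: "\<alpha> > 0" and \<eta>: "\<eta> \<in> egg m" and f: "f \<in> fefferman_hardy m \<alpha>" and fb: "nt_boundary_value m \<alpha> f fb"
  shows "f \<eta> = (\<integral>\<xi>. fb \<xi> * cnj (kernel \<eta> \<xi>) \<partial>fefferman_surface m)"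
proof -
  let ?\<sigma> = "fefferman_surface m"
  obtain c where c: "series_dominated c (egg m)" "\<And>p. p \<in> egg m \<Longrightarrow> (\<lambda>n. c n * mon n p) sums f p"
    using egg_expansion[of f] f by (auto simp: fefferman_hardy_def)
  note hb = hardy_boundary[OF \<alpha> f fb]
  \<comment> \<open>\<open>integral_series\<close> has the monomials unconjugated, so the conjugate
    of the desired integral is computed first.\<close>
  have "(\<lambda>n. cnj (mon n \<eta>) / of_real (mon_norm m n) * (\<integral>\<xi>. cnj (fb \<xi>) * mon n \<xi> \<partial>?\<sigma>)) sums
      (\<integral>\<xi>. cnj (fb \<xi>) * (\<Sum>n. cnj (mon n \<eta>) / of_real (mon_norm m n) * mon n \<xi>) \<partial>?\<sigma>)"
  proof (rule integral_series[OF kernel_dominated])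
    show "integrable ?\<sigma> (\<lambda>\<xi>. cnj (fb \<xi>))" using hb(1) by simp
    show "(\<lambda>\<xi>. \<xi>) ` frontier (egg m) \<subseteq> kernel_domain \<eta>"
      using closure_egg_subset_kernel_domain[OF \<eta>] by (auto simp: frontier_closures)
  qed (intro continuous_intros)
  also have "(\<integral>\<xi>. cnj (fb \<xi>) * (\<Sum>n. cnj (mon n \<eta>) / of_real (mon_norm m n) * mon n \<xi>) \<partial>?\<sigma>)
      = (\<integral>\<xi>. cnj (fb \<xi> * cnj (kernel \<eta> \<xi>)) \<partial>?\<sigma>)" by (simp add: kernel_def)
  also have "\<dots> = cnj (\<integral>\<xi>. fb \<xi> * cnj (kernel \<eta> \<xi>) \<partial>?\<sigma>)" by (rule Bochner_Integration.integral_cnj)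
  finally have "(\<lambda>n. cnj (cnj (mon n \<eta>) / of_real (mon_norm m n) * (\<integral>\<xi>. cnj (fb \<xi>) * mon n \<xi> \<partial>?\<sigma>))) sums
      cnj (cnj (\<integral>\<xi>. fb \<xi> * cnj (kernel \<eta> \<xi>) \<partial>?\<sigma>))" by (simp only: sums_cnj)
  moreover have "cnj (cnj (mon n \<eta>) / of_real (mon_norm m n) * (\<integral>\<xi>. cnj (fb \<xi>) * mon n \<xi> \<partial>?\<sigma>)) = c n * mon n \<eta>" for n
  proof -
    have "cnj (\<integral>\<xi>. cnj (fb \<xi>) * mon n \<xi> \<partial>?\<sigma>) = (\<integral>\<xi>. cnj (cnj (fb \<xi>) * mon n \<xi>) \<partial>?\<sigma>)" by (rule Bochner_Integration.integral_cnj[symmetric])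
    also have "\<dots> = (\<integral>\<xi>. fb \<xi> * cnj (mon n \<xi>) \<partial>?\<sigma>)" by simp
    also have "\<dots> = c n * of_real (mon_norm m n)" by (rule hb(3)[OF c])
    finally show ?thesis using mon_norm_pos[OF m, of n] by simp
  qed
  ultimately have "(\<lambda>n. c n * mon n \<eta>) sums (\<integral>\<xi>. fb \<xi> * cnj (kernel \<eta> \<xi>) \<partial>?\<sigma>)" by simp
  with c(2)[OF \<eta>] show ?thesis by (rule sums_unique2)
qed

lemma kernel_represents:
  assumes "\<alpha> > 0" "\<eta> \<in> egg m"
  shows "represents_evaluation m \<alpha> \<eta> (kernel \<eta>)"
  unfolding represents_evaluation_def
  using kernel_in_hardy kernel_boundary_value kernel_reproduces assms by blast

text \<open>All four pairings of the boundary values of \<open>k\<close> and of the kernel agree, so these boundary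
  values have distance zero in \<open>L\<^sup>2\<close>.\<close>

lemma represents_evaluation_unique:
  assumes \<alpha>: "\<alpha> > 0" and \<eta>: "\<eta> \<in> egg m" and k: "represents_evaluation m \<alpha> \<eta> k" and \<zeta>: "\<zeta> \<in> egg m"
  shows "k \<zeta> = kernel \<eta> \<zeta>"
proof -
  let ?\<sigma> = "fefferman_surface m"
  let ?K = "kernel \<eta>"
  have [measurable]: "cnj \<in> borel_measurable borel"
    by (intro borel_measurable_continuous_onI continuous_intros)
  obtain kb where kH: "k \<in> fefferman_hardy m \<alpha>" and kb: "nt_boundary_value m \<alpha> k kb"
    and rep: "\<And>f fb. f \<in> fefferman_hardy m \<alpha> \<Longrightarrow> nt_boundary_value m \<alpha> f fb \<Longrightarrow>
      f \<eta> = (\<integral>\<xi>. fb \<xi> * cnj (kb \<xi>) \<partial>?\<sigma>)"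
    using k unfolding represents_evaluation_def by blast
  note KH = kernel_in_hardy[OF \<eta>, of \<alpha>] and KB = kernel_boundary_value[OF \<eta>, of \<alpha>]
  have [measurable]: "kb \<in> borel_measurable ?\<sigma>" "?K \<in> borel_measurable ?\<sigma>"
    using kb KB by (auto simp: nt_boundary_value_def)
  note hk = hardy_boundary(2)[OF \<alpha> kH kb] and hK = hardy_boundary(2)[OF \<alpha> KH KB]
  have int: "integrable ?\<sigma> (\<lambda>\<xi>. u \<xi> * cnj (v \<xi>))"
    if [measurable]: "u \<in> borel_measurable ?\<sigma>" "v \<in> borel_measurable ?\<sigma>"
      and "integrable ?\<sigma> (\<lambda>\<xi>. cmod (u \<xi>) ^ 2)" "integrable ?\<sigma> (\<lambda>\<xi>. cmod (v \<xi>) ^ 2)" for u v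
  proof (rule Bochner_Integration.integrable_bound)
    show "integrable ?\<sigma> (\<lambda>\<xi>. cmod (u \<xi>) ^ 2 + cmod (v \<xi>) ^ 2)" using that by simp
    have "cmod (u \<xi>) * cmod (v \<xi>) \<le> cmod (u \<xi>) ^ 2 + cmod (v \<xi>) ^ 2" for \<xi>
      using sum_squares_bound[of "cmod (u \<xi>)" "cmod (v \<xi>)"]
        mult_nonneg_nonneg[OF norm_ge_zero[of "u \<xi>"] norm_ge_zero[of "v \<xi>"]] by linarith
    then show "AE \<xi> in ?\<sigma>. norm (u \<xi> * cnj (v \<xi>)) \<le> norm (cmod (u \<xi>) ^ 2 + cmod (v \<xi>) ^ 2)"
      by (simp add: norm_mult)
  qed measurable
  have eqs: "(\<integral>\<xi>. kb \<xi> * cnj (kb \<xi>) \<partial>?\<sigma>) = k \<eta>" "(\<integral>\<xi>. kb \<xi> * cnj (?K \<xi>) \<partial>?\<sigma>) = k \<eta>"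
    "(\<integral>\<xi>. ?K \<xi> * cnj (?K \<xi>) \<partial>?\<sigma>) = ?K \<eta>" "(\<integral>\<xi>. ?K \<xi> * cnj (kb \<xi>) \<partial>?\<sigma>) = ?K \<eta>"
    using rep[OF kH kb] rep[OF KH KB] kernel_reproduces[OF \<alpha> \<eta> kH kb] kernel_reproduces[OF \<alpha> \<eta> KH KB] by auto
  have ints: "integrable ?\<sigma> (\<lambda>\<xi>. kb \<xi> * cnj (kb \<xi>))" "integrable ?\<sigma> (\<lambda>\<xi>. kb \<xi> * cnj (?K \<xi>))"
    "integrable ?\<sigma> (\<lambda>\<xi>. ?K \<xi> * cnj (?K \<xi>))" "integrable ?\<sigma> (\<lambda>\<xi>. ?K \<xi> * cnj (kb \<xi>))"
    by (intro int hk hK; measurable)+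
  \<comment> \<open>Within each bracket the first factor is the same, so by \<open>eqs\<close> both
    products have the same integral and the bracket integrates to zero.\<close>
  have expand: "complex_of_real (cmod (kb \<xi> - ?K \<xi>) ^ 2) =
      (kb \<xi> * cnj (kb \<xi>) - kb \<xi> * cnj (?K \<xi>)) + (?K \<xi> * cnj (?K \<xi>) - ?K \<xi> * cnj (kb \<xi>))" for \<xi>
    unfolding complex_norm_square by (simp add: algebra_simps)
  have cint: "integrable ?\<sigma> (\<lambda>\<xi>. complex_of_real (cmod (kb \<xi> - ?K \<xi>) ^ 2))"
    unfolding expand by (intro Bochner_Integration.integrable_add Bochner_Integration.integrable_diff ints)
  have "complex_of_real (\<integral>\<xi>. cmod (kb \<xi> - ?K \<xi>) ^ 2 \<partial>?\<sigma>) = (\<integral>\<xi>. complex_of_real (cmod (kb \<xi> - ?K \<xi>) ^ 2) \<partial>?\<sigma>)"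
    by (rule integral_complex_of_real[symmetric])
  also have "\<dots> = 0" unfolding expand by (simp add: ints eqs del: of_real_power)
  finally have "(\<integral>\<xi>. cmod (kb \<xi> - ?K \<xi>) ^ 2 \<partial>?\<sigma>) = 0" by simp
  moreover have "integrable ?\<sigma> (\<lambda>\<xi>. cmod (kb \<xi> - ?K \<xi>) ^ 2)"
    using cint by (simp only: complex_of_real_integrable_eq)
  ultimately have "AE \<xi> in ?\<sigma>. cmod (kb \<xi> - ?K \<xi>) ^ 2 = 0"
    by (subst (asm) integral_nonneg_eq_0_iff_AE) auto
  then have ae: "AE \<xi> in ?\<sigma>. kb \<xi> = ?K \<xi>" by eventually_elim simp
  have [measurable]: "kernel \<zeta> \<in> borel_measurable ?\<sigma>"
    using kernel_boundary_value[OF \<zeta>] by (auto simp: nt_boundary_value_def)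
  \<comment> \<open>Almost everywhere equal boundary values force equality inside: the kernel at
    \<zeta> evaluates both functions at \<zeta> from their boundary values.\<close>
  have "k \<zeta> = (\<integral>\<xi>. kb \<xi> * cnj (kernel \<zeta> \<xi>) \<partial>?\<sigma>)" by (rule kernel_reproduces[OF \<alpha> \<zeta> kH kb])
  also have "\<dots> = (\<integral>\<xi>. ?K \<xi> * cnj (kernel \<zeta> \<xi>) \<partial>?\<sigma>)"
    using ae by (intro integral_cong_AE) auto
  also have "\<dots> = ?K \<zeta>" by (rule kernel_reproduces[OF \<alpha> \<zeta> KH KB, symmetric])
  finally show ?thesis .
qed

end

theorem corollary3p7:
  fixes m :: nat and \<alpha> :: real and \<eta> :: "complex \<times> complex"
  assumes "m \<ge> 1" and "\<alpha> > 0" and "\<eta> \<in> egg m"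
  shows "\<exists>U g. open U \<and> closure (egg m) \<subseteq> U \<and> g holomorphic2_on U \<and>
           (\<forall>\<zeta>\<in>egg m. g \<zeta> = fefferman_szego m \<alpha> \<zeta> \<eta>)"
proof (intro exI conjI ballI)
  show "open (kernel_domain m \<eta>)" by (rule open_kernel_domain[OF assms(1)])
  show "closure (egg m) \<subseteq> kernel_domain m \<eta>" by (rule closure_egg_subset_kernel_domain[OF assms(1,3)])
  show "kernel m \<eta> holomorphic2_on kernel_domain m \<eta>" by (rule holomorphic_kernel[OF assms(1)])
  fix \<zeta> assume \<zeta>: "\<zeta> \<in> egg m"
  \<comment> \<open>\<open>kernel_represents\<close> provides the witness that makes the choice
    meaningful; uniqueness on the egg identifies the chosen function with the explicit
    kernel.\<close>
  have "represents_evaluation m \<alpha> \<eta> (SOME k. represents_evaluation m \<alpha> \<eta> k)"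
    by (rule someI[where P = "represents_evaluation m \<alpha> \<eta>", OF kernel_represents[OF assms]])
  from represents_evaluation_unique[OF assms this \<zeta>]
  show "kernel m \<eta> \<zeta> = fefferman_szego m \<alpha> \<zeta> \<eta>" by (simp add: fefferman_szego_def)
qed

end
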